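(* Let $\mathcal M=(M,\mathcal O_{\mathcal M})$ be a supermanifold with $M$ connected, $\mathcal E$ a locally free sheaf of $\mathcal O_{\mathcal M}$-supermodules on $\mathcal M$ and $\nabla$ a connection on $\mathcal E$. Then a parallel section $X\in\mathcal E(M)$ is uniquely defined by its value at any point $x\in M$; that is, if $X,X'\in\mathcal E(M)$ satisfy $\nabla X=0$, $\nabla X'=0$ and have equal values $X_x=X'_x\in\mathcal E_x$ at some point $x\in M$, then $X=X'$.
   Context: A real smooth supermanifold $\mathcal M=(M,\mathcal O_{\mathcal M})$ of dimension $n|m$ is a smooth $n$-manifold $M$ with a sheaf of real superalgebras $\mathcal O_{\mathcal M}$ locally isomorphic to $C^\infty(U)\otimes\Lambda(\xi^1,\dots,\xi^m)$ (Grassmann algebra). The value of a function $f$ at $x$ is $\tilde f(x)$, where $f\mapsto\tilde f$ is the canonical projection $\mathcal O_{\mathcal M}\to C^\infty_M$. $\mathcal T_{\mathcal M}$ is the tangent sheaf (superderivations of $\mathcal O_{\mathcal M}$). The fibre of a locally free sheaf $\mathcal E$ at $x$ is $\mathcal E_x=\mathcal E(V)/(\mathcal O_{\mathcal M}(V)_x\mathcal E(V))$, where $V\ni x$ is open and $\mathcal O_{\mathcal M}(V)_x$ is the ideal of functions vanishing at $x$; the value $X_x$ of a section $X$ is its image in $\mathcal E_x$. A connection on $\mathcal E$ is an even morphism $\nabla:\mathcal T_{\mathcal M}\otimes_{\mathbb R}\mathcal E\to\mathcal E$ of sheaves with $\nabla_{fY}X=f\nabla_YX$ and $\nabla_Y(fX)=(Yf)X+(-1)^{|Y||f|}f\nabla_YX$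 for homogeneous arguments ($|\cdot|$ is the parity). A section $X\in\mathcal E(M)$ is parallel if $\nabla X=0$. *)

theory Defs
  imports
    "HOL-Analysis.Analysis"
    "HOL-Algebra.Algebraic_Closure_Type"
    "HOL-Library.Z2"
begin

section \<open>Smooth manifolds\<close>

text \<open>
  The model space is \<^const>\<open>Euclidean_space\<close>, so that the dimension is an arbitrary natural
  number (including 0). A function is of class C^k on an open set if all iterated partial derivatives
  of order at most k exist and are continuous there. Both \<open>C_k k n U f\<close> and \<open>C_infinity n U f\<close>
  depend only on the restriction of \<open>f\<close> to \<open>U\<close>, as \<open>U\<close> is open in \<open>Euclidean_space n\<close>.
\<close>

definition partial_deriv :: "nat \<Rightarrow> ((nat \<Rightarrow> real) \<Rightarrow> real) \<Rightarrow> (nat \<Rightarrow> real) \<Rightarrow> real" where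
  "partial_deriv i f x = deriv (\<lambda>t. f (x(i := t))) (x i)"

primrec C_k :: "nat \<Rightarrow> nat \<Rightarrow> (nat \<Rightarrow> real) set \<Rightarrow> ((nat \<Rightarrow> real) \<Rightarrow> real) \<Rightarrow> bool" where
  "C_k 0 n U f \<longleftrightarrow> continuous_map (subtopology (Euclidean_space n) U) euclideanreal f"
| "C_k (Suc k) n U f \<longleftrightarrow> continuous_map (subtopology (Euclidean_space n) U) euclideanreal f \<and>
     (\<forall>i<n. (\<forall>x\<in>U. (\<lambda>t. f (x(i := t))) field_differentiable at (x i)) \<and>
            C_k k n U (partial_deriv i f))"

definition C_infinity :: "nat \<Rightarrow> (nat \<Rightarrow> real) set \<Rightarrow> ((nat \<Rightarrow> real) \<Rightarrow> real) \<Rightarrow> bool" where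
  "C_infinity n U f \<longleftrightarrow> (\<forall>k. C_k k n U f)"

type_synonym 'a chart = "'a set \<times> ('a \<Rightarrow> nat \<Rightarrow> real)"

locale smooth_manifold =
  fixes n :: nat and M :: "'a topology" and \<A> :: "'a chart set"
  assumes Hausdorff: "Hausdorff_space M"
    and second_countable: "second_countable M"
    and chart_domain: "(W, \<phi>) \<in> \<A> \<Longrightarrow> openin M W"
    and chart_image: "(W, \<phi>) \<in> \<A> \<Longrightarrow> openin (Euclidean_space n) (\<phi> ` W)"
    and chart_homeo: "(W, \<phi>) \<in> \<A> \<Longrightarrow>
      homeomorphic_map (subtopology M W) (subtopology (Euclidean_space n) (\<phi> ` W)) \<phi>"
    and charts_cover: "(\<Union>(W, \<phi>)\<in>\<A>. W) = topspace M"
    and charts_compatible: "(W, \<phi>) \<in> \<A> \<Longrightarrow> (W', \<phi>') \<in> \<A> \<Longrightarrow> i < n \<Longrightarrow>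
      C_infinity n (\<phi> ` (W \<inter> W')) (\<lambda>y. \<phi>' (inv_into W \<phi> y) i)"

text \<open>Functions on an open subset \<open>V\<close> of \<open>M\<close> are represented by functions on the whole type that
  are 0 outside \<open>V\<close>.\<close>

definition smooth_functions :: "nat \<Rightarrow> 'a chart set \<Rightarrow> 'a set \<Rightarrow> ('a \<Rightarrow> real) set" where
  "smooth_functions n \<A> V =
     {f. (\<forall>x. x \<notin> V \<longrightarrow> f x = 0) \<and>
         (\<forall>(W, \<phi>)\<in>\<A>. C_infinity n (\<phi> ` (V \<inter> W)) (\<lambda>y. f (inv_into W \<phi> y)))}"


section \<open>Superalgebras and supermodules\<close>

text \<open>
  Parities are elements of the field \<^typ>\<open>bit\<close> with two elements. Modules use the record of
  the library theory of modules; as there, the fields \<open>mult\<close> and \<open>one\<close> of that record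
  are only meaningful for algebras. Real superalgebras are not assumed to be supercommutative; for
  the structure sheaf of a supermanifold this follows from the local models.
\<close>

record ('r, 's) supermodule = "('r, 's) module" +
  homog :: "bit \<Rightarrow> 's set"

locale super_group = abelian_group A for A :: "('r, 's, 'z) supermodule_scheme" (structure) +
  assumes homog_subgroup: "additive_subgroup (homog A p) A"
    and homog_disjoint: "homog A 0 \<inter> homog A 1 = {\<zero>}"
    and homog_generate: "carrier A = homog A 0 <+> homog A 1"

abbreviation real_ring :: "real ring" where
  "real_ring \<equiv> ring_of_type_algebra"

locale real_superalgebra = ring A + super_group A + module real_ring A
  for A :: "(real, 's, 'z) supermodule_scheme" (structure) +
  assumes smult_mult_left:
      "\<lbrakk>x \<in> carrier A; y \<in> carrier A\<rbrakk> \<Longrightarrow> (r \<odot> x) \<otimes> y = r \<odot> (x \<otimes> y)"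
    and smult_mult_right:
      "\<lbrakk>x \<in> carrier A; y \<in> carrier A\<rbrakk> \<Longrightarrow> x \<otimes> (r \<odot> y) = r \<odot> (x \<otimes> y)"
    and smult_homog: "x \<in> homog A p \<Longrightarrow> r \<odot> x \<in> homog A p"
    and mult_homog: "\<lbrakk>x \<in> homog A p; y \<in> homog A q\<rbrakk> \<Longrightarrow> x \<otimes> y \<in> homog A (p + q)"

definition superalgebra_hom ::
  "(real, 's) supermodule \<Rightarrow> (real, 't) supermodule \<Rightarrow> ('s \<Rightarrow> 't) set" where
  "superalgebra_hom A B =
     {h \<in> ring_hom A B.
        (\<forall>r. \<forall>x\<in>carrier A. h (r \<odot>\<^bsub>A\<^esub> x) = r \<odot>\<^bsub>B\<^esub> h x) \<and>
        (\<forall>p. h ` homog A p \<subseteq> homog B p)}"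

text \<open>Left supermodules over a superalgebra. The library locale for modules requires
  commutative scalars.\<close>

locale left_supermodule = A: real_superalgebra A + E: super_group E
  for A :: "(real, 's) supermodule" and E :: "('s, 'e) supermodule" +
  assumes smult_closed: "\<lbrakk>f \<in> carrier A; x \<in> carrier E\<rbrakk> \<Longrightarrow> f \<odot>\<^bsub>E\<^esub> x \<in> carrier E"
    and smult_l_distr: "\<lbrakk>f \<in> carrier A; g \<in> carrier A; x \<in> carrier E\<rbrakk> \<Longrightarrow>
      (f \<oplus>\<^bsub>A\<^esub> g) \<odot>\<^bsub>E\<^esub> x = f \<odot>\<^bsub>E\<^esub> x \<oplus>\<^bsub>E\<^esub> g \<odot>\<^bsub>E\<^esub> x"
    and smult_r_distr: "\<lbrakk>f \<in> carrier A; x \<in> carrier E; y \<in> carrier E\<rbrakk> \<Longrightarrow>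
      f \<odot>\<^bsub>E\<^esub> (x \<oplus>\<^bsub>E\<^esub> y) = f \<odot>\<^bsub>E\<^esub> x \<oplus>\<^bsub>E\<^esub> f \<odot>\<^bsub>E\<^esub> y"
    and smult_assoc: "\<lbrakk>f \<in> carrier A; g \<in> carrier A; x \<in> carrier E\<rbrakk> \<Longrightarrow>
      (f \<otimes>\<^bsub>A\<^esub> g) \<odot>\<^bsub>E\<^esub> x = f \<odot>\<^bsub>E\<^esub> (g \<odot>\<^bsub>E\<^esub> x)"
    and smult_one: "x \<in> carrier E \<Longrightarrow> \<one>\<^bsub>A\<^esub> \<odot>\<^bsub>E\<^esub> x = x"
    and smult_homog: "\<lbrakk>f \<in> homog A p; x \<in> homog E q\<rbrakk> \<Longrightarrow> f \<odot>\<^bsub>E\<^esub> x \<in> homog E (p + q)"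

text \<open>\<open>super_sign E a x\<close> is (-1)^a x.\<close>

definition super_sign :: "('e, 'z) ring_scheme \<Rightarrow> bit \<Rightarrow> 'e \<Rightarrow> 'e" where
  "super_sign E a x = (if a = 0 then x else \<ominus>\<^bsub>E\<^esub> x)"


section \<open>Sheaves\<close>

text \<open>\<open>restr F U V\<close> is the restriction map from sections over \<open>U\<close> to sections over \<open>V \<subseteq> U\<close>.\<close>

record ('a, 'r, 's) super_sheaf =
  sections :: "'a set \<Rightarrow> ('r, 's) supermodule"
  restr :: "'a set \<Rightarrow> 'a set \<Rightarrow> 's \<Rightarrow> 's"

locale sheaf_of_super_groups =
  fixes M :: "'a topology" and F :: "('a, 'r, 's) super_sheaf"
  assumes super_group_sections: "openin M U \<Longrightarrow> super_group (sections F U)"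
    and restr_closed: "\<lbrakk>openin M U; openin M V; V \<subseteq> U; s \<in> carrier (sections F U)\<rbrakk> \<Longrightarrow>
      restr F U V s \<in> carrier (sections F V)"
    and restr_add: "\<lbrakk>openin M U; openin M V; V \<subseteq> U;
      s \<in> carrier (sections F U); t \<in> carrier (sections F U)\<rbrakk> \<Longrightarrow>
      restr F U V (s \<oplus>\<^bsub>sections F U\<^esub> t) = restr F U V s \<oplus>\<^bsub>sections F V\<^esub> restr F U V t"
    and restr_homog: "\<lbrakk>openin M U; openin M V; V \<subseteq> U; s \<in> homog (sections F U) p\<rbrakk> \<Longrightarrow>
      restr F U V s \<in> homog (sections F V) p"
    and restr_id: "\<lbrakk>openin M U; s \<in> carrier (sections F U)\<rbrakk> \<Longrightarrow> restr F U U s = s"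
    and restr_restr: "\<lbrakk>openin M U; openin M V; openin M W; W \<subseteq> V; V \<subseteq> U;
      s \<in> carrier (sections F U)\<rbrakk> \<Longrightarrow> restr F V W (restr F U V s) = restr F U W s"
    and locality: "\<lbrakk>\<And>V. V \<in> \<U> \<Longrightarrow> openin M V; U = \<Union>\<U>;
      s \<in> carrier (sections F U); t \<in> carrier (sections F U);
      \<And>V. V \<in> \<U> \<Longrightarrow> restr F U V s = restr F U V t\<rbrakk> \<Longrightarrow> s = t"
    and gluing: "\<lbrakk>\<And>V. V \<in> \<U> \<Longrightarrow> openin M V; U = \<Union>\<U>;
      \<And>V. V \<in> \<U> \<Longrightarrow> \<sigma> V \<in> carrier (sections F V);
      \<And>V W. V \<in> \<U> \<Longrightarrow> W \<in> \<U> \<Longrightarrow> restr F V (V \<inter> W) (\<sigma> V) = restr F W (V \<inter> W) (\<sigma> W)\<rbrakk> \<Longrightarrow>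
      \<exists>s\<in>carrier (sections F U). \<forall>V\<in>\<U>. restr F U V s = \<sigma> V"

locale sheaf_of_superalgebras = sheaf_of_super_groups M \<O>
  for M :: "'a topology" and \<O> :: "('a, real, 's) super_sheaf" +
  assumes superalgebra_sections: "openin M U \<Longrightarrow> real_superalgebra (sections \<O> U)"
    and restr_superalgebra_hom: "\<lbrakk>openin M U; openin M V; V \<subseteq> U\<rbrakk> \<Longrightarrow>
      restr \<O> U V \<in> superalgebra_hom (sections \<O> U) (sections \<O> V)"

locale sheaf_of_supermodules =
    \<O>: sheaf_of_superalgebras M \<O> + \<E>: sheaf_of_super_groups M \<E>
  for M :: "'a topology" and \<O> :: "('a, real, 's) super_sheaf"
    and \<E> :: "('a, 's, 'e) super_sheaf" +
  assumes supermodule_sections: "openin M U \<Longrightarrow> left_supermodule (sections \<O> U) (sections \<E> U)"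
    and restr_smult: "\<lbrakk>openin M U; openin M V; V \<subseteq> U;
      f \<in> carrier (sections \<O> U); s \<in> carrier (sections \<E> U)\<rbrakk> \<Longrightarrow>
      restr \<E> U V (f \<odot>\<^bsub>sections \<E> U\<^esub> s) = restr \<O> U V f \<odot>\<^bsub>sections \<E> V\<^esub> restr \<E> U V s"


section \<open>Supermanifolds\<close>

text \<open>
  The model sheaf: smooth functions tensored with the Grassmann algebra in \<open>m\<close> generators,
  written in the basis of monomials \<open>\<xi>^I\<close> for \<open>I \<subseteq> {..<m}\<close> (factors in increasing order). An
  element is the family of its smooth coefficients, \<open>F I\<close> being the coefficient of \<open>\<xi>^I\<close> and
  \<open>F I = 0\<close> unless \<open>I \<subseteq> {..<m}\<close>. For disjoint \<open>I\<close> and \<open>J\<close>,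
  \<open>\<xi>^I \<xi>^J = grassmann_sign I J \<xi>^(I \<union> J)\<close>.
\<close>

definition grassmann_sign :: "nat set \<Rightarrow> nat set \<Rightarrow> real" where
  "grassmann_sign I J = (-1) ^ card {(i, j). i \<in> I \<and> j \<in> J \<and> j < i}"

definition model_carrier ::
  "nat \<Rightarrow> nat \<Rightarrow> 'a chart set \<Rightarrow> 'a set \<Rightarrow> (nat set \<Rightarrow> 'a \<Rightarrow> real) set" where
  "model_carrier n m \<A> V =
     {F. (\<forall>I. F I \<in> smooth_functions n \<A> V) \<and> (\<forall>I. \<not> I \<subseteq> {..<m} \<longrightarrow> F I = (\<lambda>x. 0))}"

definition model_sheaf ::
  "nat \<Rightarrow> nat \<Rightarrow> 'a chart set \<Rightarrow> ('a, real, nat set \<Rightarrow> 'a \<Rightarrow> real) super_sheaf" where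
  "model_sheaf n m \<A> =
     \<lparr> sections = (\<lambda>V.
         \<lparr> carrier = model_carrier n m \<A> V,
           mult = (\<lambda>F G K x. \<Sum>I\<in>Pow K. grassmann_sign I (K - I) * F I x * G (K - I) x),
           monoid.one = (\<lambda>I x. if I = {} \<and> x \<in> V then 1 else 0),
           ring.zero = (\<lambda>I x. 0),
           add = (\<lambda>F G I x. F I x + G I x),
           smult = (\<lambda>r F I x. r * F I x),
           homog = (\<lambda>p. {F \<in> model_carrier n m \<A> V.
                          \<forall>I. of_nat (card I) \<noteq> p \<longrightarrow> F I = (\<lambda>x. 0)}) \<rparr>),
       restr = (\<lambda>U V F I x. if x \<in> V then F I x else 0) \<rparr>"

text \<open>\<open>\<psi>\<close> is an isomorphism of sheaves of superalgebras from \<open>\<O>\<close> to the model sheaf over \<open>W\<close>.\<close>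

definition local_trivialization ::
  "nat \<Rightarrow> nat \<Rightarrow> 'a topology \<Rightarrow> 'a chart set \<Rightarrow> ('a, real, 's) super_sheaf \<Rightarrow>
   'a set \<Rightarrow> ('a set \<Rightarrow> 's \<Rightarrow> nat set \<Rightarrow> 'a \<Rightarrow> real) \<Rightarrow> bool" where
  "local_trivialization n m M \<A> \<O> W \<psi> \<longleftrightarrow> openin M W \<and>
     (\<forall>V. openin M V \<and> V \<subseteq> W \<longrightarrow>
        \<psi> V \<in> superalgebra_hom (sections \<O> V) (sections (model_sheaf n m \<A>) V) \<and>
        bij_betw (\<psi> V) (carrier (sections \<O> V)) (carrier (sections (model_sheaf n m \<A>) V))) \<and>
     (\<forall>U V f. openin M U \<and> openin M V \<and> V \<subseteq> U \<and> U \<subseteq> W \<and> f \<in> carrier (sections \<O> U) \<longrightarrow>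
        \<psi> V (restr \<O> U V f) = restr (model_sheaf n m \<A>) U V (\<psi> U f))"

locale supermanifold = smooth_manifold n M \<A> + sheaf_of_superalgebras M \<O>
  for n m :: nat and M :: "'a topology" and \<A> :: "'a chart set"
    and \<O> :: "('a, real, 's) super_sheaf" +
  assumes locally_trivial:
    "x \<in> topspace M \<Longrightarrow> \<exists>W \<psi>. x \<in> W \<and> local_trivialization n m M \<A> \<O> W \<psi>"

text \<open>The canonical projection from \<open>\<O>(U)\<close> to the smooth functions on \<open>U\<close>: locally, it takes the
  coefficient of \<open>\<xi>^{} = 1\<close>, which does not depend on the local trivialization.\<close>

definition body ::
  "nat \<Rightarrow> nat \<Rightarrow> 'a topology \<Rightarrow> 'a chart set \<Rightarrow> ('a, real, 's) super_sheaf \<Rightarrow>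
   'a set \<Rightarrow> 's \<Rightarrow> 'a \<Rightarrow> real" where
  "body n m M \<A> \<O> U f x =
     (if x \<in> U then
        (THE c. \<exists>W \<psi>. local_trivialization n m M \<A> \<O> W \<psi> \<and> x \<in> W \<and> W \<subseteq> U \<and>
                      c = \<psi> W (restr \<O> U W f) {} x)
      else 0)"

definition vanishing_ideal ::
  "nat \<Rightarrow> nat \<Rightarrow> 'a topology \<Rightarrow> 'a chart set \<Rightarrow> ('a, real, 's) super_sheaf \<Rightarrow>
   'a set \<Rightarrow> 'a \<Rightarrow> 's set" where
  "vanishing_ideal n m M \<A> \<O> V x = {f \<in> carrier (sections \<O> V). body n m M \<A> \<O> V f x = 0}"


section \<open>Locally free sheaves and their fibres\<close>

text \<open>\<open>e\<close> consists of \<open>p\<close> even and \<open>q\<close> odd sections over \<open>U\<close> such that the even morphism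
  \<open>(c_i) \<mapsto> \<Sum> c_i e_i\<close> from the free sheaf of rank \<open>p|q\<close> to \<open>\<E>\<close> is an isomorphism over \<open>U\<close>.\<close>

definition local_frame ::
  "'a topology \<Rightarrow> ('a, real, 's) super_sheaf \<Rightarrow> ('a, 's, 'e) super_sheaf \<Rightarrow>
   'a set \<Rightarrow> nat \<Rightarrow> nat \<Rightarrow> (nat \<Rightarrow> 'e) \<Rightarrow> bool" where
  "local_frame M \<O> \<E> U p q e \<longleftrightarrow> openin M U \<and>
     (\<forall>i<p. e i \<in> homog (sections \<E> U) 0) \<and>
     (\<forall>i\<in>{p..<p + q}. e i \<in> homog (sections \<E> U) 1) \<and>
     (\<forall>V. openin M V \<and> V \<subseteq> U \<longrightarrow>
        bij_betw
          (\<lambda>c. \<Oplus>\<^bsub>sections \<E> V\<^esub> i \<in> {..<p + q}. c i \<odot>\<^bsub>sections \<E> V\<^esub> restr \<E> U V (e i))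
          ({..<p + q} \<rightarrow>\<^sub>E carrier (sections \<O> V)) (carrier (sections \<E> V)))"

locale locally_free_sheaf = sheaf_of_supermodules M \<O> \<E>
  for M :: "'a topology" and \<O> :: "('a, real, 's) super_sheaf"
    and \<E> :: "('a, 's, 'e) super_sheaf" +
  assumes locally_free: "x \<in> topspace M \<Longrightarrow> \<exists>U p q e. x \<in> U \<and> local_frame M \<O> \<E> U p q e"

text \<open>The product of a set of scalars with a module: all finite sums of products.\<close>

definition ideal_smult :: "'s set \<Rightarrow> ('s, 'e) supermodule \<Rightarrow> 'e set" where
  "ideal_smult I E =
     {(\<Oplus>\<^bsub>E\<^esub> i \<in> {..<k}. f i \<odot>\<^bsub>E\<^esub> s i) | (k :: nat) f s.
        f \<in> {..<k} \<rightarrow> I \<and> s \<in> {..<k} \<rightarrow> carrier E}"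

text \<open>The fibre at \<open>x\<close>, and the value at \<open>x\<close> of a section over \<open>V\<close> as an element of it, computed
  from the open neighbourhood \<open>V\<close> of \<open>x\<close>.\<close>

definition fibre ::
  "nat \<Rightarrow> nat \<Rightarrow> 'a topology \<Rightarrow> 'a chart set \<Rightarrow> ('a, real, 's) super_sheaf \<Rightarrow>
   ('a, 's, 'e) super_sheaf \<Rightarrow> 'a set \<Rightarrow> 'a \<Rightarrow> 'e set monoid" where
  "fibre n m M \<A> \<O> \<E> V x =
     sections \<E> V A_Mod ideal_smult (vanishing_ideal n m M \<A> \<O> V x) (sections \<E> V)"

definition fibre_value ::
  "nat \<Rightarrow> nat \<Rightarrow> 'a topology \<Rightarrow> 'a chart set \<Rightarrow> ('a, real, 's) super_sheaf \<Rightarrow>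
   ('a, 's, 'e) super_sheaf \<Rightarrow> 'a set \<Rightarrow> 'a \<Rightarrow> 'e \<Rightarrow> 'e set" where
  "fibre_value n m M \<A> \<O> \<E> V x s =
     ideal_smult (vanishing_ideal n m M \<A> \<O> V x) (sections \<E> V) +>\<^bsub>sections \<E> V\<^esub> s"


section \<open>The tangent sheaf and connections\<close>

text \<open>
  A vector field over \<open>U\<close> is a superderivation of the sheaf \<open>\<O>\<close> restricted to \<open>U\<close>, that is, a
  family \<open>D V\<close> of superderivations of \<open>\<O>(V)\<close>, for \<open>V \<subseteq> U\<close> open, that commutes with restrictions.
  The families are made extensional, so that equality is equality of vector fields.
\<close>

type_synonym ('a, 's) vector_field = "'a set \<Rightarrow> 's \<Rightarrow> 's"

definition opens_in :: "'a topology \<Rightarrow> 'a set \<Rightarrow> 'a set set" where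
  "opens_in M U = {V. openin M V \<and> V \<subseteq> U}"

definition superderivations ::
  "'a topology \<Rightarrow> ('a, real, 's) super_sheaf \<Rightarrow> 'a set \<Rightarrow> bit \<Rightarrow> ('a, 's) vector_field set" where
  "superderivations M \<O> U p =
     {D \<in> extensional (opens_in M U).
        (\<forall>V\<in>opens_in M U. let A = sections \<O> V in
           D V \<in> carrier A \<rightarrow>\<^sub>E carrier A \<and>
           (\<forall>f\<in>carrier A. \<forall>g\<in>carrier A. D V (f \<oplus>\<^bsub>A\<^esub> g) = D V f \<oplus>\<^bsub>A\<^esub> D V g) \<and>
           (\<forall>r. \<forall>f\<in>carrier A. D V (r \<odot>\<^bsub>A\<^esub> f) = r \<odot>\<^bsub>A\<^esub> D V f) \<and>
           (\<forall>q. \<forall>f\<in>homog A q. D V f \<in> homog A (p + q)) \<and>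
           (\<forall>q. \<forall>f\<in>homog A q. \<forall>g\<in>carrier A.
              D V (f \<otimes>\<^bsub>A\<^esub> g) = D V f \<otimes>\<^bsub>A\<^esub> g \<oplus>\<^bsub>A\<^esub> super_sign A (p * q) (f \<otimes>\<^bsub>A\<^esub> D V g))) \<and>
        (\<forall>V\<in>opens_in M U. \<forall>W\<in>opens_in M V. \<forall>f\<in>carrier (sections \<O> V).
           restr \<O> V W (D V f) = D W (restr \<O> V W f))}"

definition vector_field_add ::
  "'a topology \<Rightarrow> ('a, real, 's) super_sheaf \<Rightarrow> 'a set \<Rightarrow>
   ('a, 's) vector_field \<Rightarrow> ('a, 's) vector_field \<Rightarrow> ('a, 's) vector_field" where
  "vector_field_add M \<O> U D D' =
     (\<lambda>V\<in>opens_in M U. \<lambda>f\<in>carrier (sections \<O> V). D V f \<oplus>\<^bsub>sections \<O> V\<^esub> D' V f)"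

definition tangent_sheaf ::
  "'a topology \<Rightarrow> ('a, real, 's) super_sheaf \<Rightarrow> ('a, 's, ('a, 's) vector_field) super_sheaf" where
  "tangent_sheaf M \<O> =
     \<lparr> sections = (\<lambda>U.
         \<lparr> carrier = {vector_field_add M \<O> U D D' | D D'.
                       D \<in> superderivations M \<O> U 0 \<and> D' \<in> superderivations M \<O> U 1},
           mult = undefined,
           monoid.one = undefined,
           ring.zero = (\<lambda>V\<in>opens_in M U. \<lambda>f\<in>carrier (sections \<O> V). \<zero>\<^bsub>sections \<O> V\<^esub>),
           add = vector_field_add M \<O> U,
           smult = (\<lambda>g D. \<lambda>V\<in>opens_in M U. \<lambda>f\<in>carrier (sections \<O> V).
                      restr \<O> U V g \<otimes>\<^bsub>sections \<O> V\<^esub> D V f),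
           homog = superderivations M \<O> U \<rparr>),
       restr = (\<lambda>U V D. restrict D (opens_in M V)) \<rparr>"

abbreviation vector_fields ::
  "'a topology \<Rightarrow> ('a, real, 's) super_sheaf \<Rightarrow> 'a set \<Rightarrow> ('s, ('a, 's) vector_field) supermodule" where
  "vector_fields M \<O> U \<equiv> sections (tangent_sheaf M \<O>) U"

text \<open>A sheaf morphism out of the tensor product over the reals is given by real bilinear maps that
  commute with restrictions. A real number \<open>r\<close> acts on modules over \<open>A\<close> through \<open>r 1\<close>.\<close>

definition real_smult ::
  "(real, 's) supermodule \<Rightarrow> ('s, 'e) supermodule \<Rightarrow> real \<Rightarrow> 'e \<Rightarrow> 'e" where
  "real_smult A E r s = (r \<odot>\<^bsub>A\<^esub> \<one>\<^bsub>A\<^esub>) \<odot>\<^bsub>E\<^esub> s"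

locale super_connection =
  fixes M :: "'a topology" and \<O> :: "('a, real, 's) super_sheaf"
    and \<E> :: "('a, 's, 'e) super_sheaf"
    and nabla :: "'a set \<Rightarrow> ('a, 's) vector_field \<Rightarrow> 'e \<Rightarrow> 'e"
  assumes nabla_closed: "\<lbrakk>openin M U; Y \<in> carrier (vector_fields M \<O> U);
      s \<in> carrier (sections \<E> U)\<rbrakk> \<Longrightarrow>
      nabla U Y s \<in> carrier (sections \<E> U)"
    and nabla_add_left: "\<lbrakk>openin M U; Y \<in> carrier (vector_fields M \<O> U);
      Y' \<in> carrier (vector_fields M \<O> U);
      s \<in> carrier (sections \<E> U)\<rbrakk> \<Longrightarrow>
      nabla U (Y \<oplus>\<^bsub>vector_fields M \<O> U\<^esub> Y') s = nabla U Y s \<oplus>\<^bsub>sections \<E> U\<^esub> nabla U Y' s"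
    and nabla_add_right: "\<lbrakk>openin M U; Y \<in> carrier (vector_fields M \<O> U);
      s \<in> carrier (sections \<E> U); s' \<in> carrier (sections \<E> U)\<rbrakk> \<Longrightarrow>
      nabla U Y (s \<oplus>\<^bsub>sections \<E> U\<^esub> s') = nabla U Y s \<oplus>\<^bsub>sections \<E> U\<^esub> nabla U Y s'"
    and nabla_real_left: "\<lbrakk>openin M U; Y \<in> carrier (vector_fields M \<O> U);
      s \<in> carrier (sections \<E> U)\<rbrakk> \<Longrightarrow>
      nabla U (real_smult (sections \<O> U) (vector_fields M \<O> U) r Y) s =
      real_smult (sections \<O> U) (sections \<E> U) r (nabla U Y s)"
    and nabla_real_right: "\<lbrakk>openin M U; Y \<in> carrier (vector_fields M \<O> U);
      s \<in> carrier (sections \<E> U)\<rbrakk> \<Longrightarrow>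
      nabla U Y (real_smult (sections \<O> U) (sections \<E> U) r s) =
      real_smult (sections \<O> U) (sections \<E> U) r (nabla U Y s)"
    and nabla_even: "\<lbrakk>openin M U; Y \<in> homog (vector_fields M \<O> U) p;
      s \<in> homog (sections \<E> U) q\<rbrakk> \<Longrightarrow>
      nabla U Y s \<in> homog (sections \<E> U) (p + q)"
    and nabla_restr: "\<lbrakk>openin M U; openin M V; V \<subseteq> U;
      Y \<in> carrier (vector_fields M \<O> U);
      s \<in> carrier (sections \<E> U)\<rbrakk> \<Longrightarrow>
      restr \<E> U V (nabla U Y s) = nabla V (restr (tangent_sheaf M \<O>) U V Y) (restr \<E> U V s)"
    and nabla_smult: "\<lbrakk>openin M U; f \<in> homog (sections \<O> U) a;
      Y \<in> homog (vector_fields M \<O> U) p;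
      s \<in> homog (sections \<E> U) q\<rbrakk> \<Longrightarrow>
      nabla U (f \<odot>\<^bsub>vector_fields M \<O> U\<^esub> Y) s = f \<odot>\<^bsub>sections \<E> U\<^esub> nabla U Y s"
    and nabla_Leibniz: "\<lbrakk>openin M U; f \<in> homog (sections \<O> U) a;
      Y \<in> homog (vector_fields M \<O> U) p;
      s \<in> homog (sections \<E> U) q\<rbrakk> \<Longrightarrow>
      nabla U Y (f \<odot>\<^bsub>sections \<E> U\<^esub> s) =
      Y U f \<odot>\<^bsub>sections \<E> U\<^esub> s \<oplus>\<^bsub>sections \<E> U\<^esub>
        super_sign (sections \<E> U) (p * a) (f \<odot>\<^bsub>sections \<E> U\<^esub> nabla U Y s)"

text \<open>\<open>\<nabla> s = 0\<close> as a morphism from the tangent sheaf to \<open>\<E>\<close>.\<close>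

definition parallel ::
  "'a topology \<Rightarrow> ('a, real, 's) super_sheaf \<Rightarrow> ('a, 's, 'e) super_sheaf \<Rightarrow>
   ('a set \<Rightarrow> ('a, 's) vector_field \<Rightarrow> 'e \<Rightarrow> 'e) \<Rightarrow> 'e \<Rightarrow> bool" where
  "parallel M \<O> \<E> nabla s \<longleftrightarrow>
     s \<in> carrier (sections \<E> (topspace M)) \<and>
     (\<forall>U. openin M U \<longrightarrow> (\<forall>Y\<in>carrier (vector_fields M \<O> U).
        nabla U Y (restr \<E> (topspace M) U s) = \<zero>\<^bsub>sections \<E> U\<^esub>))"

end

theory Submission
  imports Defs
begin

text \<open>
  It is enough to look at the set \<open>Z\<close> of the points around which the two sections
  agree. It is open by definition, and by locality the sections are equal once \<open>Z\<close>
  is all of \<open>M\<close>; as \<open>M\<close> is connected, this follows if \<open>Z\<close>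
  is nonempty and closed. Both are consequences of one local statement: over a small region
  \<open>B\<close>, where \<open>M\<close> has coordinates \<open>x^k\<close> with image a box,
  \<open>\<O>\<close> is trivial with odd coordinates \<open>\<xi>^a\<close> and
  \<open>\<E>\<close> has a frame \<open>e_i\<close>, a parallel section \<open>t\<close>
  vanishes if the bodies of its coefficients vanish at a single point of \<open>B\<close>
  (\<open>parallel_zero_on_box\<close>). At the given point the bodies of the coefficients of
  the difference vanish because it lies in the product of the ideal of functions vanishing there
  with the module of sections (\<open>coeff_body_eq_if_fibre_value_eq\<close>). If
  \<open>B\<close> meets \<open>Z\<close>, they vanish at a common point of \<open>B\<close> and
  \<open>Z\<close> because coefficients commute with restriction (\<open>coeff_local\<close>).

  For the local statement write \<open>t = \<Sum> c_i e_i\<close> and \<open>c_i = \<Sum>_I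
  c_i^I \<xi>^I\<close>. For a derivation \<open>D\<close>, the equation \<open>\<nabla>_D t =
  0\<close> says \<open>D c_j = - \<Sum>_i c_i' \<Gamma>_i^j\<close>, where \<open>\<nabla>_D
  e_i = \<Sum>_j \<Gamma>_i^j e_j\<close> and \<open>c_i'\<close> is \<open>c_i\<close> up to
  signs of its coefficients (\<open>parallel_equation\<close>). It is used for two kinds of
  derivations.

  For \<open>D = \<partial>/\<partial>x^k\<close> the coefficient at \<open>\<xi>^{} = 1\<close>
  gives \<open>\<partial>_k c_j^{} = - \<Sum>_i c_i^{} (\<Gamma>_{k i}^j)^{}\<close>, a linear
  system of differential equations for the bodies. On a segment in the box it is a linear
  ordinary differential equation, so the bodies vanish on \<open>B\<close> if they do at one
  point (\<open>body_zero_on_box\<close>).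

  For \<open>D = \<partial>/\<partial>\<xi>^a\<close> the coefficient at \<open>\<xi>^J\<close>,
  with \<open>a\<close> outside \<open>J\<close>, gives \<open>c_j^{J \<union> {a}}\<close> up
  to sign on the left and only coefficients \<open>c_i^K\<close> with \<open>K \<subseteq>
  J\<close> on the right. By induction on the number of odd coordinates all coefficients vanish
  once the bodies do (\<open>coeff_zero_if_body_zero\<close>).

  Two preparations take most of the work. The coordinate derivations have to be exhibited as
  superderivations of \<open>\<O>\<close>: their product rules are
  \<open>coord_deriv_grassmann_mult\<close> and \<open>odd_deriv_grassmann_mult\<close>, and the
  result of \<open>\<partial>/\<partial>x^k\<close> is smooth in every chart by the chain rule
  (\<open>C_1_chain_rule\<close>, \<open>C_k_compose\<close>). And the body of a function must
  not depend on the trivialization (\<open>body_eq\<close>): it is the value of a homomorphism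
  to the reals, which kills nilpotents and cannot kill an invertible function.
\<close>

section \<open>Calculus in coordinates\<close>

abbreviation has_partial_deriv ::
  "((nat \<Rightarrow> real) \<Rightarrow> real) \<Rightarrow> real \<Rightarrow> nat \<Rightarrow> (nat \<Rightarrow> real) \<Rightarrow> bool" where
  "has_partial_deriv f D i x \<equiv> ((\<lambda>t. f (x(i := t))) has_real_derivative D) (at (x i))"

definition open_box :: "nat \<Rightarrow> (nat \<Rightarrow> real) \<Rightarrow> real \<Rightarrow> (nat \<Rightarrow> real) set" where
  "open_box n c d = {z \<in> topspace (Euclidean_space n). \<forall>i<n. \<bar>z i - c i\<bar> < d}"

lemma Euclidean_space_eq_top_of_set: "Euclidean_space n = top_of_set (topspace (Euclidean_space n))"
  by (simp add: Euclidean_space_def euclidean_product_topology)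

lemma continuous_map_Euclidean_subspace:
  assumes "U \<subseteq> topspace (Euclidean_space n)"
  shows "continuous_map (subtopology (Euclidean_space n) U) euclideanreal f \<longleftrightarrow> continuous_on U f"
  using assms
  by (subst Euclidean_space_eq_top_of_set)
     (simp add: subtopology_subtopology Int_absorb1)

lemma openin_open_box: "openin (Euclidean_space n) (open_box n c d)"
proof -
  have "open {z :: nat \<Rightarrow> real. \<bar>z i - c i\<bar> < d}" for i
    by (intro open_Collect_less continuous_intros continuous_on_product_coordinates)
  then have "open (\<Inter>i\<in>{..<n}. {z :: nat \<Rightarrow> real. \<bar>z i - c i\<bar> < d})"
    by (intro open_INT) auto
  moreover have "open_box n c d =
      topspace (Euclidean_space n) \<inter> (\<Inter>i\<in>{..<n}. {z. \<bar>z i - c i\<bar> < d})"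
    by (auto simp: open_box_def)
  ultimately show ?thesis
    by (subst Euclidean_space_eq_top_of_set) (simp add: openin_open_Int)
qed

text \<open>
  A basic open set of the product topology restricts only finitely many coordinates, but what
  matters here is that only the first \<open>n\<close> coordinates are free: the others are 0 on
  both sides.
\<close>

lemma openin_Euclidean_contains_box:
  assumes "openin (Euclidean_space n) U" "y \<in> U"
  obtains d where "d > 0" "open_box n y d \<subseteq> U"
proof -
  obtain T where T: "openin (powertop_real UNIV) T" "U = T \<inter> topspace (Euclidean_space n)"
    using assms(1) unfolding Euclidean_space_def openin_subtopology by auto
  obtain B where B: "y \<in> PiE UNIV B" "\<And>i. open (B i)" "PiE UNIV B \<subseteq> T"
    using product_topology_open_contains_basis[OF T(1)] assms(2) T(2) by (metis IntD1 open_openin)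
  have "\<exists>e>0. ball (y i) e \<subseteq> B i" for i
    using B(1) B(2)[of i] by (auto simp: open_contains_ball PiE_iff)
  then obtain e where e: "\<And>i. e i > 0" "\<And>i. ball (y i) (e i) \<subseteq> B i"
    by metis
  define d where "d = Min (insert 1 (e ` {..<n}))"
  have "d > 0"
    unfolding d_def using e(1) by (subst Min_gr_iff) auto
  moreover have "open_box n y d \<subseteq> U"
  proof
    fix z assume z: "z \<in> open_box n y d"
    have "z i \<in> B i" for i
    proof (cases "i < n")
      case True
      then have "d \<le> e i"
        unfolding d_def by (intro Min_le) auto
      then have "z i \<in> ball (y i) (e i)"
        using z True by (auto simp: open_box_def dist_real_def abs_minus_commute dest!: spec[of _ i])
      then show ?thesis
        using e(2) by blast
    next
      case False
      then have "z i = y i"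
        using z assms(2) T(2) by (auto simp: open_box_def topspace_Euclidean_space)
      then show ?thesis
        using B(1) by auto
    qed
    then show "z \<in> U"
      using B(3) T(2) z by (auto simp: open_box_def)
  qed
  ultimately show ?thesis
    using that by blast
qed

lemma fun_upd_in_Euclidean_space:
  "x \<in> topspace (Euclidean_space n) \<Longrightarrow> i < n \<Longrightarrow> x(i := t) \<in> topspace (Euclidean_space n)"
  by (auto simp: topspace_Euclidean_space)

lemma eventually_fun_upd_in_open:
  assumes "openin (Euclidean_space n) U" "x \<in> U" "i < n"
  shows "\<forall>\<^sub>F t in nhds (x i). x(i := t) \<in> U"
proof -
  obtain d where d: "d > 0" "open_box n x d \<subseteq> U"
    using openin_Euclidean_contains_box assms(1,2) by blast
  have "x \<in> topspace (Euclidean_space n)"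
    using assms(1,2) openin_subset by blast
  then have "x(i := t) \<in> U" if "dist t (x i) < d" for t
    using that d assms(3) fun_upd_in_Euclidean_space[of x n i t]
    by (auto simp: open_box_def dist_real_def subset_iff)
  then show ?thesis
    using d(1) unfolding eventually_nhds_metric by blast
qed

lemma has_partial_deriv_transform:
  assumes "has_partial_deriv f D i x" "openin (Euclidean_space n) U" "x \<in> U" "i < n"
    and "\<And>y. y \<in> U \<Longrightarrow> f y = g y"
  shows "has_partial_deriv g D i x"
  using assms(1)
proof (rule DERIV_cong_ev[THEN iffD1, rotated -1])
  show "\<forall>\<^sub>F t in nhds (x i). f (x(i := t)) = g (x(i := t))"
    using eventually_fun_upd_in_open[OF assms(2-4)] by eventually_elim (use assms(5) in simp)
qed auto

lemma partial_deriv_eqI: "has_partial_deriv f D i x \<Longrightarrow> partial_deriv i f x = D"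
  by (simp add: partial_deriv_def DERIV_imp_deriv)

lemma partial_deriv_cong:
  assumes "openin (Euclidean_space n) U" "x \<in> U" "i < n" "\<And>y. y \<in> U \<Longrightarrow> f y = g y"
  shows "partial_deriv i f x = partial_deriv i g x"
proof -
  have "has_partial_deriv f D i x \<longleftrightarrow> has_partial_deriv g D i x" for D
    using has_partial_deriv_transform[OF _ assms(1-3)] assms(4) by metis
  then show ?thesis
    by (simp add: partial_deriv_def deriv_def)
qed

subsection \<open>Closure properties of the classes C^k\<close>

lemma C_k_imp_continuous_on:
  assumes "C_k k n U f" "openin (Euclidean_space n) U"
  shows "continuous_on U f"
  using assms openin_subset[OF assms(2)]
  by (cases k) (auto simp: continuous_map_Euclidean_subspace)

lemma C_k_SucI:
  assumes "openin (Euclidean_space n) U" "continuous_on U f"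
    and "\<And>i x. i < n \<Longrightarrow> x \<in> U \<Longrightarrow> has_partial_deriv f (g i x) i x"
    and "\<And>i. i < n \<Longrightarrow> C_k k n U (partial_deriv i f)"
  shows "C_k (Suc k) n U f"
  using assms openin_subset[OF assms(1)]
  by (auto simp: continuous_map_Euclidean_subspace field_differentiable_def)

lemma C_k_Suc_has_partial_deriv:
  assumes "C_k (Suc k) n U f" "i < n" "x \<in> U"
  shows "has_partial_deriv f (partial_deriv i f x) i x"
  using assms by (auto simp: partial_deriv_def field_differentiable_derivI)

lemma C_k_cong:
  assumes "openin (Euclidean_space n) U" "\<And>x. x \<in> U \<Longrightarrow> f x = g x" "C_k k n U f"
  shows "C_k k n U g"
  using assms(2,3)
proof (induction k arbitrary: f g)
  case 0
  then show ?case
    using openin_subset[OF assms(1)]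
    by (auto simp: continuous_map_Euclidean_subspace cong: continuous_on_cong)
next
  case (Suc k)
  show ?case
  proof (rule C_k_SucI[OF assms(1)])
    show "continuous_on U g"
      using C_k_imp_continuous_on[OF Suc.prems(2) assms(1)] Suc.prems(1)
      by (simp cong: continuous_on_cong)
    show "has_partial_deriv g (partial_deriv i f x) i x" if "i < n" "x \<in> U" for i x
      by (rule has_partial_deriv_transform[OF C_k_Suc_has_partial_deriv[OF Suc.prems(2) that] assms(1)])
         (use Suc.prems(1) that in auto)
    show "C_k k n U (partial_deriv i g)" if "i < n" for i
    proof (rule Suc.IH)
      show "C_k k n U (partial_deriv i f)"
        using Suc.prems(2) that by simp
    qed (use partial_deriv_cong[OF assms(1) _ that] Suc.prems(1) in blast)
  qed
qed

text \<open>
  The form in which closure properties are proved by induction: partial derivatives may be given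
  by a formula, which agrees with the constant \<open>partial_deriv\<close> only on the open
  set.
\<close>

lemma C_k_SucI':
  assumes "openin (Euclidean_space n) U" "continuous_on U f"
    and "\<And>i x. i < n \<Longrightarrow> x \<in> U \<Longrightarrow> has_partial_deriv f (g i x) i x"
    and "\<And>i. i < n \<Longrightarrow> C_k k n U (g i)"
  shows "C_k (Suc k) n U f"
  using assms(1-3)
proof (rule C_k_SucI)
  show "C_k k n U (partial_deriv i f)" if i: "i < n" for i
  proof (rule C_k_cong[OF assms(1) _ assms(4)[OF i]])
    show "g i x = partial_deriv i f x" if "x \<in> U" for x
      using partial_deriv_eqI[OF assms(3)[OF i that]] by simp
  qed
qed

lemma C_k_Suc_imp: "C_k (Suc k) n U f \<Longrightarrow> C_k k n U f"
proof (induction k arbitrary: f)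
  case (Suc k)
  have "C_k k n U (partial_deriv i f)" if "i < n" for i
    using Suc.prems Suc.IH[of "partial_deriv i f"] that by (metis C_k.simps(2))
  then show ?case
    using Suc.prems by simp
qed simp

lemma C_k_mono: "C_k k n U f \<Longrightarrow> l \<le> k \<Longrightarrow> C_k l n U f"
proof (induction k)
  case (Suc k)
  then show ?case
    using C_k_Suc_imp by (metis le_SucE)
qed simp

lemma C_k_subset:
  assumes "C_k k n U f" "U' \<subseteq> U" "openin (Euclidean_space n) U"
  shows "C_k k n U' f"
proof -
  have *: "U' \<subseteq> topspace (Euclidean_space n)" "U \<subseteq> topspace (Euclidean_space n)"
    using assms(2,3) openin_subset by blast+
  show ?thesis
    using assms(1)
  proof (induction k arbitrary: f)
    case 0
    then show ?case
      using continuous_on_subset[OF _ assms(2)] * by (simp add: continuous_map_Euclidean_subspace)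
  next
    case (Suc k)
    then show ?case
      using continuous_on_subset[OF _ assms(2)] assms(2) *
      by (auto simp: continuous_map_Euclidean_subspace)
  qed
qed

lemma C_k_const:
  assumes "openin (Euclidean_space n) U"
  shows "C_k k n U (\<lambda>x. c)"
proof (induction k arbitrary: c)
  case 0
  then show ?case by simp
next
  case (Suc k)
  show ?case
    by (rule C_k_SucI'[OF assms, where g = "\<lambda>i x. 0"]) (use Suc in auto)
qed

lemma C_k_add:
  assumes "openin (Euclidean_space n) U" "C_k k n U f" "C_k k n U g"
  shows "C_k k n U (\<lambda>x. f x + g x)"
  using assms(2,3)
proof (induction k arbitrary: f g)
  case 0
  then show ?case
    by (auto intro: continuous_map_add)
next
  case (Suc k)
  show ?case
  proof (rule C_k_SucI'[OF assms(1), where g = "\<lambda>i x. partial_deriv i f x + partial_deriv i g x"])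
    show "continuous_on U (\<lambda>x. f x + g x)"
      using Suc.prems by (intro continuous_intros C_k_imp_continuous_on[OF _ assms(1)])
    show "has_partial_deriv (\<lambda>x. f x + g x) (partial_deriv i f x + partial_deriv i g x) i x"
      if "i < n" "x \<in> U" for i x
      by (rule DERIV_add[OF Suc.prems[THEN C_k_Suc_has_partial_deriv, OF that]])
    show "C_k k n U (\<lambda>x. partial_deriv i f x + partial_deriv i g x)" if "i < n" for i
      using Suc.prems Suc.IH that by simp
  qed
qed

lemma C_k_mult:
  assumes "openin (Euclidean_space n) U" "C_k k n U f" "C_k k n U g"
  shows "C_k k n U (\<lambda>x. f x * g x)"
  using assms(2,3)
proof (induction k arbitrary: f g)
  case 0
  then show ?case
    by (auto intro: continuous_map_real_mult)
next
  case (Suc k)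
  have f: "C_k k n U f" and g: "C_k k n U g"
    using Suc.prems C_k_Suc_imp by blast+
  show ?case
  proof (rule C_k_SucI'[OF assms(1)])
    show "continuous_on U (\<lambda>x. f x * g x)"
      using Suc.prems by (intro continuous_intros C_k_imp_continuous_on[OF _ assms(1)])
    show "has_partial_deriv (\<lambda>x. f x * g x) (partial_deriv i f x * g x + partial_deriv i g x * f x) i x"
      if "i < n" "x \<in> U" for i x
      using DERIV_mult[OF Suc.prems[THEN C_k_Suc_has_partial_deriv, OF that]]
      by (simp only: fun_upd_triv)
    show "C_k k n U (\<lambda>x. partial_deriv i f x * g x + partial_deriv i g x * f x)" if "i < n" for i
      using Suc.prems that f g by (intro C_k_add[OF assms(1)] Suc.IH) simp_all
  qed
qed

lemma C_k_sum:
  assumes "openin (Euclidean_space n) U" "\<And>i. i \<in> I \<Longrightarrow> C_k k n U (f i)"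
  shows "C_k k n U (\<lambda>x. \<Sum>i\<in>I. f i x)"
  using assms(2)
  by (induction I rule: infinite_finite_induct)
     (auto intro!: C_k_const[OF assms(1)] C_k_add[OF assms(1)] simp del: C_k.simps)

lemma C_k_inverse:
  assumes "openin (Euclidean_space n) U" "C_k k n U f" "\<And>x. x \<in> U \<Longrightarrow> f x \<noteq> 0"
  shows "C_k k n U (\<lambda>x. inverse (f x))"
  using assms(2)
proof (induction k)
  case 0
  then show ?case
    using assms(3) openin_subset[OF assms(1)]
    by (auto simp: continuous_map_Euclidean_subspace intro: continuous_intros)
next
  case (Suc k)
  then have IH: "C_k k n U (\<lambda>x. inverse (f x))"
    using C_k_Suc_imp by blast
  show ?case
  proof (rule C_k_SucI'[OF assms(1)])
    show "continuous_on U (\<lambda>x. inverse (f x))"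
      using assms(3) by (intro continuous_intros C_k_imp_continuous_on[OF Suc.prems assms(1)]) auto
    show "has_partial_deriv (\<lambda>x. inverse (f x))
            ((- 1) * (inverse (f x) * partial_deriv i f x * inverse (f x))) i x"
      if "i < n" "x \<in> U" for i x
    proof -
      have "f (x(i := x i)) \<noteq> 0"
        using assms(3) that by simp
      from DERIV_inverse'[OF C_k_Suc_has_partial_deriv[OF Suc.prems that] this] show ?thesis
        by (simp only: fun_upd_triv mult_minus_left mult_1)
    qed
    show "C_k k n U (\<lambda>x. (- 1) * (inverse (f x) * partial_deriv i f x * inverse (f x)))" if "i < n" for i
      using Suc.prems IH that by (intro C_k_mult[OF assms(1)] C_k_const[OF assms(1)] IH) (simp add: that)
  qed
qed

subsection \<open>The chain rule\<close>

text \<open>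
  Continuous partial derivatives give total differentiability: pass from \<open>y\<close> to
  \<open>z\<close> changing one coordinate at a time. In each step the mean value inequality,
  applied to the function minus its expected linear part, leaves an error of at most
  \<open>e\<close> times the change of the coordinate, because near \<open>y\<close> the partial
  derivatives differ from those at \<open>y\<close> by less than \<open>e\<close>.
\<close>

lemma C_1_first_order_approximation:
  assumes U: "openin (Euclidean_space n) U" and f: "C_k (Suc 0) n U f" and y: "y \<in> U" and "e > 0"
  obtains d where "d > 0" "open_box n y d \<subseteq> U"
    "\<And>z. z \<in> open_box n y d \<Longrightarrow>
      \<bar>f z - f y - (\<Sum>j<n. partial_deriv j f y * (z j - y j))\<bar> \<le> e * (\<Sum>j<n. \<bar>z j - y j\<bar>)"
proof -
  have yE: "y \<in> topspace (Euclidean_space n)"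
    using U y openin_subset by blast
  define N where "N = U \<inter> {z. \<forall>j\<in>{..<n}. \<bar>partial_deriv j f z - partial_deriv j f y\<bar> < e}"
  have cont: "continuous_on U (partial_deriv j f)" if "j < n" for j
    using f that openin_subset[OF U] by (auto simp: continuous_map_Euclidean_subspace)
  have "openin (top_of_set U) {z \<in> U. \<bar>partial_deriv j f z - partial_deriv j f y\<bar> < e}" if "j < n" for j
  proof -
    have "continuous_on U (\<lambda>z. \<bar>partial_deriv j f z - partial_deriv j f y\<bar>)"
      by (intro continuous_intros cont that)
    from continuous_openin_preimage_gen[OF this, of "{..<e}"] show ?thesis
      by (auto simp: vimage_def elim!: back_subst[of "openin _"])
  qed
  then have "openin (top_of_set U) (U \<inter> (\<Inter>j\<in>{..<n}. {z \<in> U. \<bar>partial_deriv j f z - partial_deriv j f y\<bar> < e}))"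
    by (intro openin_Int_Inter) auto
  also have "(U \<inter> (\<Inter>j\<in>{..<n}. {z \<in> U. \<bar>partial_deriv j f z - partial_deriv j f y\<bar> < e})) = N"
    by (auto simp: N_def)
  finally have "openin (Euclidean_space n) N"
    using U by (metis Euclidean_space_eq_top_of_set openin_trans)
  moreover have "y \<in> N"
    using y \<open>e > 0\<close> by (simp add: N_def)
  ultimately obtain d where d: "d > 0" "open_box n y d \<subseteq> N"
    using openin_Euclidean_contains_box by blast
  have "\<bar>f z - f y - (\<Sum>j<n. partial_deriv j f y * (z j - y j))\<bar> \<le> e * (\<Sum>j<n. \<bar>z j - y j\<bar>)"
    if z: "z \<in> open_box n y d" for z
  proof -
    define p where "p j = (\<lambda>i. if i < j then z i else y i)" for j
    \<comment> \<open>Each step changes the \<open>j\<close>-th coordinate from \<open>y j\<close> to \<open>z j\<close> along a segment inside the box.\<close>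
    have step: "\<bar>f (p (Suc j)) - f (p j) - partial_deriv j f y * (z j - y j)\<bar> \<le> e * \<bar>z j - y j\<bar>"
      if j: "j < n" for j
    proof -
      define g where "g t = f ((p j)(j := t)) - partial_deriv j f y * t" for t
      have in_box: "(p j)(j := t) \<in> open_box n y d" if t: "t \<in> closed_segment (y j) (z j)" for t
      proof -
        have "\<bar>t - y j\<bar> \<le> \<bar>z j - y j\<bar>"
          using segment_bound1[OF t] by (simp add: abs_minus_commute)
        also have "\<dots> < d"
          using z j by (simp add: open_box_def)
        finally show ?thesis
          using z yE d(1) j by (auto simp: open_box_def p_def topspace_Euclidean_space)
      qed
      have "norm (g (z j) - g (y j)) \<le> e * norm (z j - y j)"
      proof (rule field_differentiable_bound)
        show "convex (closed_segment (y j) (z j))"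
          by simp
        fix t assume t: "t \<in> closed_segment (y j) (z j)"
        then have N: "(p j)(j := t) \<in> N"
          using in_box d(2) by blast
        then have "has_partial_deriv f (partial_deriv j f ((p j)(j := t))) j ((p j)(j := t))"
          by (intro C_k_Suc_has_partial_deriv[OF f j]) (simp add: N_def)
        then have "(g has_real_derivative (partial_deriv j f ((p j)(j := t)) - partial_deriv j f y * 1)) (at t)"
          unfolding g_def fun_upd_upd fun_upd_same by (intro DERIV_diff DERIV_cmult DERIV_ident)
        then show "(g has_real_derivative (partial_deriv j f ((p j)(j := t)) - partial_deriv j f y))
            (at t within closed_segment (y j) (z j))"
          using has_field_derivative_at_within by fastforce
        show "norm (partial_deriv j f ((p j)(j := t)) - partial_deriv j f y) \<le> e"
          using N j by (auto simp: N_def dest!: bspec[of _ _ j])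
      qed auto
      moreover have "(p j)(j := z j) = p (Suc j)" "(p j)(j := y j) = p j"
        by (auto simp: p_def fun_eq_iff less_Suc_eq)
      ultimately show ?thesis
        by (simp add: g_def algebra_simps)
    qed
    have "p n = z"
      using z yE by (auto simp: p_def fun_eq_iff open_box_def topspace_Euclidean_space)
    moreover have "p 0 = y"
      by (simp add: p_def)
    ultimately have "f z - f y = (\<Sum>j<n. f (p (Suc j)) - f (p j))"
      by (simp add: sum_lessThan_telescope[of "\<lambda>j. f (p j)"])
    then have "\<bar>f z - f y - (\<Sum>j<n. partial_deriv j f y * (z j - y j))\<bar> =
        \<bar>\<Sum>j<n. f (p (Suc j)) - f (p j) - partial_deriv j f y * (z j - y j)\<bar>"
      by (simp add: sum_subtractf)
    also have "\<dots> \<le> (\<Sum>j<n. e * \<bar>z j - y j\<bar>)"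
      using step by (intro sum_abs[THEN order_trans] sum_mono) auto
    finally show ?thesis
      by (simp add: sum_distrib_left)
  qed
  then show ?thesis
    using that[OF d(1)] d(2) by (auto simp: N_def)
qed

text \<open>
  Insert a curve into the first order approximation and divide by the increment of the
  parameter: the error is at most \<open>e\<close> times the sum of the absolute difference
  quotients of the coordinates, which stay bounded because they converge.
\<close>

lemma C_1_chain_rule:
  assumes U: "openin (Euclidean_space n) U" and f: "C_k (Suc 0) n U f"
    and ev: "\<forall>\<^sub>F t in nhds t0. \<gamma> t \<in> U"
    and \<gamma>: "\<And>j. j < n \<Longrightarrow> ((\<lambda>t. \<gamma> t j) has_real_derivative \<gamma>' j) (at t0)"
  shows "((\<lambda>t. f (\<gamma> t)) has_real_derivative (\<Sum>j<n. partial_deriv j f (\<gamma> t0) * \<gamma>' j)) (at t0)"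
proof -
  define q where "q j t = (\<gamma> t j - \<gamma> t0 j) / (t - t0)" for j t
  have q: "(q j \<longlongrightarrow> \<gamma>' j) (at t0)" if "j < n" for j
    using \<gamma>[OF that] by (simp add: q_def[abs_def] has_field_derivative_iff)
  have y: "\<gamma> t0 \<in> U"
    using ev by (rule eventually_nhds_x_imp_x)
  let ?r = "\<lambda>t. (f (\<gamma> t) - f (\<gamma> t0)) / (t - t0) - (\<Sum>j<n. partial_deriv j f (\<gamma> t0) * q j t)"
  have "(?r \<longlongrightarrow> 0) (at t0)"
  proof (rule tendstoI)
    fix e :: real assume "e > 0"
    define C where "C = (\<Sum>j<n. \<bar>\<gamma>' j\<bar>) + 1"
    have "C > 0"
      unfolding C_def by (intro add_nonneg_pos sum_nonneg) auto
    \<comment> \<open>The sum of the absolute difference quotients is eventually below \<open>C\<close>.\<close>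
    define e' where "e' = e / (2 * C)"
    have "e' > 0"
      using \<open>e > 0\<close> \<open>C > 0\<close> by (simp add: e'_def)
    obtain d where d: "d > 0" "open_box n (\<gamma> t0) d \<subseteq> U"
      and approx: "\<And>z. z \<in> open_box n (\<gamma> t0) d \<Longrightarrow>
        \<bar>f z - f (\<gamma> t0) - (\<Sum>j<n. partial_deriv j f (\<gamma> t0) * (z j - \<gamma> t0 j))\<bar>
        \<le> e' * (\<Sum>j<n. \<bar>z j - \<gamma> t0 j\<bar>)"
      using C_1_first_order_approximation[OF U f y \<open>e' > 0\<close>] by blast
    have "((\<lambda>t. \<Sum>j<n. \<bar>q j t\<bar>) \<longlongrightarrow> (\<Sum>j<n. \<bar>\<gamma>' j\<bar>)) (at t0)"
      by (intro tendsto_sum tendsto_rabs q) auto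
    then have ev1: "\<forall>\<^sub>F t in at t0. (\<Sum>j<n. \<bar>q j t\<bar>) < C"
      by (rule order_tendstoD) (simp add: C_def)
    have "\<forall>\<^sub>F t in at t0. \<bar>\<gamma> t j - \<gamma> t0 j\<bar> < d" if "j < n" for j
    proof -
      have "((\<lambda>t. \<gamma> t j) \<longlongrightarrow> \<gamma> t0 j) (at t0)"
        using DERIV_isCont[OF \<gamma>[OF that]] by (simp add: isCont_def)
      from tendstoD[OF this d(1)] show ?thesis
        by (simp add: dist_real_def)
    qed
    then have ev2: "\<forall>\<^sub>F t in at t0. \<forall>j\<in>{..<n}. \<bar>\<gamma> t j - \<gamma> t0 j\<bar> < d"
      by (intro eventually_ball_finite) auto
    have ev3: "\<forall>\<^sub>F t in at t0. \<gamma> t \<in> U"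
      using ev eventually_nhds_conv_at by blast
    have ev4: "\<forall>\<^sub>F t in at t0. t \<noteq> t0"
      by (simp add: eventually_at_filter)
    show "\<forall>\<^sub>F t in at t0. dist (?r t) 0 < e"
      using ev1 ev2 ev3 ev4
    proof eventually_elim
      case (elim t)
      let ?R = "f (\<gamma> t) - f (\<gamma> t0) - (\<Sum>j<n. partial_deriv j f (\<gamma> t0) * (\<gamma> t j - \<gamma> t0 j))"
      have "\<gamma> t \<in> open_box n (\<gamma> t0) d"
        using elim(2,3) openin_subset[OF U] by (auto simp: open_box_def)
      then have "\<bar>?R\<bar> \<le> e' * (\<Sum>j<n. \<bar>\<gamma> t j - \<gamma> t0 j\<bar>)"
        by (rule approx)
      then have "\<bar>?R\<bar> / \<bar>t - t0\<bar> \<le> (e' * (\<Sum>j<n. \<bar>\<gamma> t j - \<gamma> t0 j\<bar>)) / \<bar>t - t0\<bar>"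
        by (rule divide_right_mono) simp
      also have "\<dots> = e' * (\<Sum>j<n. \<bar>q j t\<bar>)"
        by (simp only: q_def abs_divide sum_divide_distrib[symmetric] times_divide_eq_right)
      also have "\<dots> \<le> e' * C"
        using elim(1) \<open>e' > 0\<close> by (intro mult_left_mono) auto
      also have "\<dots> < e"
        using \<open>e > 0\<close> \<open>C > 0\<close> by (simp add: e'_def)
      finally have "\<bar>?R / (t - t0)\<bar> < e"
        by (simp only: abs_divide)
      moreover have "?R / (t - t0) = ?r t"
        unfolding q_def times_divide_eq_right
        by (subst diff_divide_distrib) (simp only: sum_divide_distrib)
      ultimately show ?case
        by (simp only: dist_real_def diff_0_right)
    qed
  qed
  moreover have "((\<lambda>t. \<Sum>j<n. partial_deriv j f (\<gamma> t0) * q j t) \<longlongrightarrow>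
      (\<Sum>j<n. partial_deriv j f (\<gamma> t0) * \<gamma>' j)) (at t0)"
    by (intro tendsto_sum tendsto_mult q tendsto_const) auto
  ultimately have "((\<lambda>t. ?r t + (\<Sum>j<n. partial_deriv j f (\<gamma> t0) * q j t)) \<longlongrightarrow>
      0 + (\<Sum>j<n. partial_deriv j f (\<gamma> t0) * \<gamma>' j)) (at t0)"
    by (rule tendsto_add)
  then show ?thesis
    by (simp add: has_field_derivative_iff)
qed

text \<open>
  By the chain rule a partial derivative of the composite is a sum of products of partial
  derivatives, one factor of each product being composed with \<open>h\<close> again; the
  induction is on the order of differentiability, for all outer functions at once.
\<close>

lemma C_k_compose:
  assumes U: "openin (Euclidean_space n) U" and U': "openin (Euclidean_space n) U'"
    and f: "C_k k n U' f" and h: "\<And>i. i < n \<Longrightarrow> C_k k n U (\<lambda>y. h y i)"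
    and maps: "h \<in> U \<rightarrow> U'"
  shows "C_k k n U (\<lambda>y. f (h y))"
  using f h
proof (induction k arbitrary: f)
  case 0
  have "h y i = 0" if "y \<in> U" "\<not> i < n" for y i
    using maps that openin_subset[OF U'] by (auto simp: Pi_iff topspace_Euclidean_space subset_iff)
  then have "continuous_on U (\<lambda>y. h y i)" for i
    using 0(2)[of i] C_k_imp_continuous_on[OF _ U] continuous_on_cong[of U U "\<lambda>y. h y i" "\<lambda>y. 0"]
    by (cases "i < n") (auto simp del: C_k.simps)
  then have "continuous_on U h"
    by (rule continuous_on_coordinatewise_then_product)
  moreover have "continuous_on U' f"
    using 0 C_k_imp_continuous_on[OF _ U'] by blast
  ultimately have "continuous_on U (\<lambda>y. f (h y))"
    using maps by (intro continuous_on_compose2[of U' f U h]) auto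
  then show ?case
    using openin_subset[OF U] by (simp add: continuous_map_Euclidean_subspace)
next
  case (Suc k)
  have cont: "continuous_on U (\<lambda>y. f (h y))"
  proof -
    have "C_k 0 n U' f" "\<And>i. i < n \<Longrightarrow> C_k 0 n U (\<lambda>y. h y i)"
      using Suc.prems C_k_mono by blast+
    then have "C_k k n U (\<lambda>y. f (h y))"
      using Suc C_k_Suc_imp by blast
    then show ?thesis
      using C_k_imp_continuous_on U by blast
  qed
  have f1: "C_k (Suc 0) n U' f"
    using Suc.prems(1) by (rule C_k_mono) simp
  show ?case
  proof (rule C_k_SucI'[OF U cont])
    fix i assume i: "i < n"
    show "has_partial_deriv (\<lambda>y. f (h y))
        (\<Sum>j<n. partial_deriv j f (h x) * partial_deriv i (\<lambda>y. h y j) x) i x" if x: "x \<in> U" for x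
    proof -
      have "\<forall>\<^sub>F t in nhds (x i). h (x(i := t)) \<in> U'"
        using eventually_fun_upd_in_open[OF U x i] by eventually_elim (use maps in auto)
      from C_1_chain_rule[OF U' f1 this C_k_Suc_has_partial_deriv[OF Suc.prems(2) i x]]
      show ?thesis
        by (simp only: fun_upd_triv)
    qed
    show "C_k k n U (\<lambda>x. \<Sum>j<n. partial_deriv j f (h x) * partial_deriv i (\<lambda>y. h y j) x)"
    proof (rule C_k_sum[OF U], rule C_k_mult[OF U])
      fix j assume j: "j \<in> {..<n}"
      have "C_k k n U' (partial_deriv j f)"
        using Suc.prems(1) j by simp
      then show "C_k k n U (\<lambda>x. partial_deriv j f (h x))"
        by (rule Suc.IH) (rule C_k_Suc_imp[OF Suc.prems(2)])
      show "C_k k n U (partial_deriv i (\<lambda>y. h y j))"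
        using Suc.prems(2)[of j] i j by simp
    qed
  qed
qed

subsection \<open>Linear systems of first order\<close>

text \<open>
  The argument of Gronwall: for \<open>g = \<Sum> h_j^2\<close> the equation gives \<open>g'
  \<le> 2 C r g\<close>, where \<open>C\<close> bounds the coefficients on the compact interval.
  Hence \<open>g(t) exp(- 2 C r t)\<close> is nonincreasing; it is 0 at 0 and never negative.
\<close>

lemma linear_ODE_unique_zero:
  fixes h :: "nat \<Rightarrow> real \<Rightarrow> real"
  assumes deriv: "\<And>j t. j < r \<Longrightarrow> t \<in> {0..1} \<Longrightarrow>
      (h j has_real_derivative (\<Sum>i<r. h i t * b i j t)) (at t)"
    and cont: "\<And>i j. i < r \<Longrightarrow> j < r \<Longrightarrow> continuous_on {0..1} (b i j)"
    and init: "\<And>j. j < r \<Longrightarrow> h j 0 = 0" and "j < r"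
  shows "h j 1 = 0"
proof -
  have "\<exists>C. \<forall>t\<in>{0..1}. \<bar>b i j t\<bar> \<le> C" if "i < r" "j < r" for i j
  proof -
    have "bounded (b i j ` {0..1})"
      using cont[OF that] by (intro compact_imp_bounded compact_continuous_image) auto
    then show ?thesis
      by (auto simp: bounded_iff)
  qed
  then obtain C' where C': "\<And>i j t. i < r \<Longrightarrow> j < r \<Longrightarrow> t \<in> {0..1} \<Longrightarrow> \<bar>b i j t\<bar> \<le> C' i j"
    by metis
  define C where "C = (\<Sum>i<r. \<Sum>j<r. \<bar>C' i j\<bar>)"
  have C: "\<bar>b i j t\<bar> \<le> C" if "i < r" "j < r" "t \<in> {0..1}" for i j t
  proof -
    have "\<bar>b i j t\<bar> \<le> \<bar>C' i j\<bar>"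
      using C'[OF that] by linarith
    also have "\<dots> \<le> (\<Sum>j<r. \<bar>C' i j\<bar>)"
      using that by (intro member_le_sum) auto
    also have "\<dots> \<le> C"
      unfolding C_def using that
      by (intro member_le_sum[of i _ "\<lambda>i. \<Sum>j<r. \<bar>C' i j\<bar>"]) (auto intro: sum_nonneg)
    finally show ?thesis .
  qed
  define g where "g t = (\<Sum>j<r. (h j t)\<^sup>2)" for t
  define g' where "g' t = (\<Sum>j<r. 2 * h j t * (\<Sum>i<r. h i t * b i j t))" for t
  have g: "(g has_real_derivative g' t) (at t)" if "t \<in> {0..1}" for t
    unfolding g_def g'_def
    by (rule derivative_eq_intros deriv that refl | simp)+ (auto intro!: sum.cong)
  have bound: "g' t \<le> 2 * C * r * g t" if t: "t \<in> {0..1}" for t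
  proof -
    have "g' t = (\<Sum>j<r. \<Sum>i<r. 2 * (h j t * h i t) * b i j t)"
      by (simp add: g'_def sum_distrib_left mult_ac)
    also have "\<dots> \<le> (\<Sum>j<r. \<Sum>i<r. C * ((h j t)\<^sup>2 + (h i t)\<^sup>2))"
    proof (intro sum_mono)
      fix i j assume ij: "j \<in> {..<r}" "i \<in> {..<r}"
      have "2 * (h j t * h i t) * b i j t \<le> \<bar>2 * (h j t * h i t)\<bar> * \<bar>b i j t\<bar>"
        by (metis abs_ge_self abs_mult)
      also have "\<dots> \<le> ((h j t)\<^sup>2 + (h i t)\<^sup>2) * C"
      proof (intro mult_mono)
        have "0 \<le> (\<bar>h j t\<bar> - \<bar>h i t\<bar>)\<^sup>2"
          by simp
        then show "\<bar>2 * (h j t * h i t)\<bar> \<le> (h j t)\<^sup>2 + (h i t)\<^sup>2"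
          by (simp add: power2_diff abs_mult)
        show "\<bar>b i j t\<bar> \<le> C"
          using C ij t by auto
      qed auto
      finally show "2 * (h j t * h i t) * b i j t \<le> C * ((h j t)\<^sup>2 + (h i t)\<^sup>2)"
        by (simp add: mult.commute)
    qed
    also have "\<dots> = 2 * C * r * g t"
      by (simp add: g_def sum.distrib sum_distrib_left sum_distrib_right algebra_simps)
    finally show ?thesis .
  qed
  define k where "k t = g t * exp (- (2 * C * r) * t)" for t
  have "k 1 \<le> k 0"
  proof (rule DERIV_nonpos_imp_nonincreasing[of 0 1 k])
    fix t :: real assume "0 \<le> t" "t \<le> 1"
    then have t: "t \<in> {0..1}"
      by simp
    have "(k has_real_derivative (g' t - 2 * C * r * g t) * exp (- (2 * C * r) * t)) (at t)"
      unfolding k_def by (rule derivative_eq_intros g t refl | simp add: algebra_simps)+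
    moreover have "(g' t - 2 * C * r * g t) * exp (- (2 * C * r) * t) \<le> 0"
      using bound[OF t] by (intro mult_nonpos_nonneg) auto
    ultimately show "\<exists>y. (k has_real_derivative y) (at t) \<and> y \<le> 0"
      by blast
  qed simp
  also have "k 0 = 0"
    by (simp add: k_def g_def init)
  finally have "g 1 \<le> 0"
    by (simp add: k_def mult_le_0_iff)
  then have "g 1 = 0"
    unfolding g_def by (intro antisym sum_nonneg) auto
  then show ?thesis
    using \<open>j < r\<close> by (simp add: g_def sum_nonneg_eq_0_iff)
qed

text \<open>
  A box is convex, so the segment from \<open>y0\<close> to \<open>y\<close> stays in it. Along
  the segment the system becomes an ordinary linear differential equation.
\<close>

lemma linear_PDE_unique_zero:
  fixes u :: "nat \<Rightarrow> (nat \<Rightarrow> real) \<Rightarrow> real"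
  assumes u: "\<And>j. j < r \<Longrightarrow> C_k (Suc 0) n (open_box n c d) (u j)"
    and a: "\<And>k i j. k < n \<Longrightarrow> i < r \<Longrightarrow> j < r \<Longrightarrow> continuous_on (open_box n c d) (a k i j)"
    and system: "\<And>k j y. k < n \<Longrightarrow> j < r \<Longrightarrow> y \<in> open_box n c d \<Longrightarrow>
      partial_deriv k (u j) y = (\<Sum>i<r. u i y * a k i j y)"
    and y0: "y0 \<in> open_box n c d" and init: "\<And>j. j < r \<Longrightarrow> u j y0 = 0"
    and y: "y \<in> open_box n c d" and j: "j < r"
  shows "u j y = 0"
proof -
  define \<gamma> where "\<gamma> t = (\<lambda>i. y0 i + t * (y i - y0 i))" for t
  have \<gamma>E: "\<gamma> t \<in> topspace (Euclidean_space n)" for t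
    using y y0 by (auto simp: \<gamma>_def open_box_def topspace_Euclidean_space)
  have \<gamma>: "\<gamma> t \<in> open_box n c d" if "t \<in> {0..1}" for t
  proof -
    have "\<bar>\<gamma> t i - c i\<bar> < d" if "i < n" for i
    proof -
      have "\<gamma> t i - c i = (1 - t) * (y0 i - c i) + t * (y i - c i)"
        by (simp add: \<gamma>_def algebra_simps)
      moreover have "y0 i - c i \<in> {-d<..<d}" "y i - c i \<in> {-d<..<d}"
        using y y0 that by (auto simp: open_box_def abs_less_iff dest!: spec[of _ i])
      then have "(1 - t) *\<^sub>R (y0 i - c i) + t *\<^sub>R (y i - c i) \<in> {-d<..<d}"
        using \<open>t \<in> {0..1}\<close> by (intro convexD_alt convex_real_interval) auto
      ultimately show ?thesis
        by (auto simp: abs_less_iff)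
    qed
    then show ?thesis
      using \<gamma>E by (auto simp: open_box_def)
  qed
  have cont_\<gamma>: "continuous_on S \<gamma>" for S
    unfolding \<gamma>_def by (intro continuous_on_coordinatewise_then_product continuous_intros)
  define b where "b i j t = (\<Sum>k<n. a k i j (\<gamma> t) * (y k - y0 k))" for i j t
  have "u j (\<gamma> 1) = 0"
  proof (rule linear_ODE_unique_zero[where h = "\<lambda>j t. u j (\<gamma> t)" and b = b])
    fix j t assume j: "j < r" and t: "t \<in> {0..1 :: real}"
    have "\<forall>\<^sub>F s in nhds t. \<forall>i\<in>{..<n}. \<bar>\<gamma> s i - c i\<bar> < d"
    proof (intro eventually_ball_finite ballI)
      fix i assume "i \<in> {..<n}"
      then have "\<bar>\<gamma> t i - c i\<bar> < d"
        using \<gamma>[OF t] by (auto simp: open_box_def)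
      moreover have "isCont (\<lambda>s. \<bar>\<gamma> s i - c i\<bar>) t"
        unfolding \<gamma>_def by (intro continuous_intros)
      then have "((\<lambda>s. \<bar>\<gamma> s i - c i\<bar>) \<longlongrightarrow> \<bar>\<gamma> t i - c i\<bar>) (nhds t)"
        unfolding isCont_def by (rule tendsto_at_iff_tendsto_nhds[THEN iffD1])
      ultimately show "\<forall>\<^sub>F s in nhds t. \<bar>\<gamma> s i - c i\<bar> < d"
        using order_tendstoD(2) by blast
    qed simp
    then have ev: "\<forall>\<^sub>F s in nhds t. \<gamma> s \<in> open_box n c d"
      by eventually_elim (use \<gamma>E in \<open>auto simp: open_box_def\<close>)
    have "((\<lambda>t. \<gamma> t k) has_real_derivative (y k - y0 k)) (at t)" for k
      unfolding \<gamma>_def by (rule derivative_eq_intros refl | simp)+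
    from C_1_chain_rule[OF openin_open_box u[OF j] ev this]
    have "((\<lambda>t. u j (\<gamma> t)) has_real_derivative
        (\<Sum>k<n. partial_deriv k (u j) (\<gamma> t) * (y k - y0 k))) (at t)" .
    also have "(\<Sum>k<n. partial_deriv k (u j) (\<gamma> t) * (y k - y0 k)) =
        (\<Sum>k<n. \<Sum>i<r. u i (\<gamma> t) * (a k i j (\<gamma> t) * (y k - y0 k)))"
      using system[OF _ j \<gamma>[OF t]] by (simp add: sum_distrib_right mult.assoc)
    also have "\<dots> = (\<Sum>i<r. u i (\<gamma> t) * b i j t)"
      by (subst sum.swap) (simp add: b_def sum_distrib_left)
    finally show "((\<lambda>t. u j (\<gamma> t)) has_real_derivative (\<Sum>i<r. u i (\<gamma> t) * b i j t)) (at t)" .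
  next
    fix i j assume "i < r" "j < r"
    then show "continuous_on {0..1} (b i j)"
      unfolding b_def using \<gamma>
      by (intro continuous_intros continuous_on_compose2[OF a cont_\<gamma>]) auto
  next
    show "u j (\<gamma> 0) = 0" if "j < r" for j
      using init[OF that] by (simp add: \<gamma>_def)
  qed (use j in auto)
  then show ?thesis
    by (simp add: \<gamma>_def)
qed

section \<open>Smooth functions and the Grassmann algebra\<close>

lemma C_infinity_cong:
  assumes "openin (Euclidean_space n) U" "\<And>x. x \<in> U \<Longrightarrow> f x = g x" "C_infinity n U f"
  shows "C_infinity n U g"
  using assms C_k_cong unfolding C_infinity_def by metis

lemma C_infinity_partial_deriv:
  "C_infinity n U f \<Longrightarrow> i < n \<Longrightarrow> C_infinity n U (partial_deriv i f)"
  unfolding C_infinity_def by (metis C_k.simps(2))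

lemma C_infinity_has_partial_deriv:
  "C_infinity n U f \<Longrightarrow> i < n \<Longrightarrow> x \<in> U \<Longrightarrow> has_partial_deriv f (partial_deriv i f x) i x"
  unfolding C_infinity_def by (metis C_k_Suc_has_partial_deriv)

lemma C_infinity_compose:
  assumes "openin (Euclidean_space n) U" "openin (Euclidean_space n) U'" "C_infinity n U' f"
    and "\<And>i. i < n \<Longrightarrow> C_infinity n U (\<lambda>y. h y i)" "h \<in> U \<rightarrow> U'"
  shows "C_infinity n U (\<lambda>y. f (h y))"
  using assms C_k_compose[of n U U'] unfolding C_infinity_def by blast

lemma C_infinity_subset:
  "C_infinity n U f \<Longrightarrow> U' \<subseteq> U \<Longrightarrow> openin (Euclidean_space n) U \<Longrightarrow> C_infinity n U' f"
  using C_k_subset unfolding C_infinity_def by blast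

subsection \<open>Smooth functions and coordinate derivatives on a manifold\<close>

text \<open>
  The vector field \<open>\<partial>/\<partial>x^k\<close> of the chart \<open>\<phi>\<close> on
  functions over \<open>V\<close>; the value outside \<open>V\<close> follows the convention for
  functions on \<open>V\<close>.
\<close>

definition coord_deriv ::
  "'a set \<Rightarrow> ('a \<Rightarrow> nat \<Rightarrow> real) \<Rightarrow> nat \<Rightarrow> 'a set \<Rightarrow> ('a \<Rightarrow> real) \<Rightarrow> 'a \<Rightarrow> real" where
  "coord_deriv W \<phi> k V f x = (if x \<in> V then partial_deriv k (\<lambda>y. f (inv_into W \<phi> y)) (\<phi> x) else 0)"

context smooth_manifold
begin

lemma chart_inj_on: "(W, \<phi>) \<in> \<A> \<Longrightarrow> inj_on \<phi> W"
  using chart_homeo[of W \<phi>] chart_domain[of W \<phi>] openin_subset[of M W]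
  by (auto simp: homeomorphic_eq_everything_map Int_absorb1)

lemma chart_inverse: "(W, \<phi>) \<in> \<A> \<Longrightarrow> z \<in> W \<Longrightarrow> inv_into W \<phi> (\<phi> z) = z"
  by (simp add: chart_inj_on)

lemma openin_chart_image:
  assumes "(W, \<phi>) \<in> \<A>" "openin M V"
  shows "openin (Euclidean_space n) (\<phi> ` (V \<inter> W))"
proof -
  have "openin (subtopology M W) (V \<inter> W)"
    using assms(2) by (auto simp: openin_subtopology)
  then have "openin (subtopology (Euclidean_space n) (\<phi> ` W)) (\<phi> ` (V \<inter> W))"
    using chart_homeo[OF assms(1)] homeomorphic_imp_open_map open_map_def by blast
  then show ?thesis
    using chart_image[OF assms(1)] openin_trans_full by blast
qed

lemma openin_chart_preimage:
  assumes "(W, \<phi>) \<in> \<A>" "openin (Euclidean_space n) Q"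
  shows "openin M {z \<in> W. \<phi> z \<in> Q}"
proof -
  have W: "openin M W" "topspace (subtopology M W) = W"
    using chart_domain[OF assms(1)] openin_subset by auto
  have "continuous_map (subtopology M W) (Euclidean_space n) \<phi>"
    using chart_homeo[OF assms(1)] homeomorphic_imp_continuous_map continuous_map_in_subtopology by blast
  from openin_continuous_map_preimage[OF this assms(2)]
  have "openin (subtopology M W) {z \<in> W. \<phi> z \<in> Q}"
    unfolding W(2) .
  then show ?thesis
    using W(1) by (rule openin_trans_full)
qed

lemma smooth_functions_chart:
  "f \<in> smooth_functions n \<A> V \<Longrightarrow> (W, \<phi>) \<in> \<A> \<Longrightarrow>
    C_infinity n (\<phi> ` (V \<inter> W)) (\<lambda>y. f (inv_into W \<phi> y))"
  by (auto simp: smooth_functions_def)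

lemma smooth_functions_nonzero_nhd:
  assumes "openin M V" "f \<in> smooth_functions n \<A> V" "x \<in> V" "f x \<noteq> 0"
  obtains V' where "openin M V'" "x \<in> V'" "V' \<subseteq> V" "\<forall>z\<in>V'. f z \<noteq> 0"
proof -
  have "x \<in> topspace M"
    using assms(1,3) openin_subset by blast
  then obtain W \<phi> where W: "(W, \<phi>) \<in> \<A>" "x \<in> W"
    by (auto simp flip: charts_cover)
  have op: "openin (Euclidean_space n) (\<phi> ` (V \<inter> W))"
    by (rule openin_chart_image[OF W(1) assms(1)])
  have "continuous_on (\<phi> ` (V \<inter> W)) (\<lambda>y. f (inv_into W \<phi> y))"
    using smooth_functions_chart[OF assms(2) W(1)] C_k_imp_continuous_on[OF _ op]
    unfolding C_infinity_def by blast
  from continuous_openin_preimage_gen[OF this, of "- {0}"]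
  have "openin (top_of_set (\<phi> ` (V \<inter> W))) (\<phi> ` (V \<inter> W) \<inter> (\<lambda>y. f (inv_into W \<phi> y)) -` (- {0}))"
    by (simp add: open_Compl)
  with op have "openin (Euclidean_space n) (\<phi> ` (V \<inter> W) \<inter> (\<lambda>y. f (inv_into W \<phi> y)) -` (- {0}))"
    by (metis Euclidean_space_eq_top_of_set openin_trans)
  note preimage = openin_chart_preimage[OF W(1) this]
  have "\<phi> z \<in> \<phi> ` (V \<inter> W) \<longleftrightarrow> z \<in> V" if "z \<in> W" for z
    using that inj_on_image_mem_iff[OF chart_inj_on[OF W(1)] that, of "V \<inter> W"] by simp
  then have "{z \<in> W. \<phi> z \<in> \<phi> ` (V \<inter> W) \<inter> (\<lambda>y. f (inv_into W \<phi> y)) -` (- {0})} =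
      {z \<in> V \<inter> W. f z \<noteq> 0}"
    using chart_inverse[OF W(1)] by (intro Collect_cong) (simp, metis)
  with preimage have "openin M {z \<in> V \<inter> W. f z \<noteq> 0}"
    by (simp only:)
  then show ?thesis
    by (rule that) (use assms(3,4) W(2) in auto)
qed

lemma smooth_functions_inverse:
  assumes "openin M V" "openin M V'" "V' \<subseteq> V" "f \<in> smooth_functions n \<A> V"
    and "\<And>z. z \<in> V' \<Longrightarrow> f z \<noteq> 0"
  shows "(\<lambda>x. if x \<in> V' then inverse (f x) else 0) \<in> smooth_functions n \<A> V'"
proof -
  have "C_infinity n (\<phi> ` (V' \<inter> W)) (\<lambda>y. if inv_into W \<phi> y \<in> V' then inverse (f (inv_into W \<phi> y)) else 0)"
    if W: "(W, \<phi>) \<in> \<A>" for W \<phi>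
  proof (rule C_infinity_cong[OF openin_chart_image[OF W assms(2)]])
    have inv: "inv_into W \<phi> y \<in> V'" if "y \<in> \<phi> ` (V' \<inter> W)" for y
      using that chart_inverse[OF W] by auto
    then show "inverse (f (inv_into W \<phi> y)) =
        (if inv_into W \<phi> y \<in> V' then inverse (f (inv_into W \<phi> y)) else 0)"
      if "y \<in> \<phi> ` (V' \<inter> W)" for y
      using that by simp
    have "C_infinity n (\<phi> ` (V' \<inter> W)) (\<lambda>y. f (inv_into W \<phi> y))"
      using smooth_functions_chart[OF assms(4) W] openin_chart_image[OF W assms(1)] assms(3)
      by (auto intro: C_infinity_subset)
    then show "C_infinity n (\<phi> ` (V' \<inter> W)) (\<lambda>y. inverse (f (inv_into W \<phi> y)))"
      unfolding C_infinity_def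
      using C_k_inverse[OF openin_chart_image[OF W assms(2)]] inv assms(5) by blast
  qed
  then show ?thesis
    by (auto simp: smooth_functions_def)
qed

text \<open>
  In the chart \<open>\<phi>\<close> itself this is immediate. Smoothness of functions is asked
  for in every chart of the atlas, though, and in another chart \<open>\<phi>'\<close> the
  function is composed with the change of coordinates.
\<close>

lemma coord_deriv_smooth:
  assumes W: "(W, \<phi>) \<in> \<A>" and V: "openin M V" "V \<subseteq> W" and "k < n"
    and f: "f \<in> smooth_functions n \<A> V"
  shows "coord_deriv W \<phi> k V f \<in> smooth_functions n \<A> V"
proof -
  let ?g = "partial_deriv k (\<lambda>y. f (inv_into W \<phi> y))"
  have VW: "V \<inter> W = V"
    using V(2) by blast
  have g: "C_infinity n (\<phi> ` V) ?g"
    using C_infinity_partial_deriv[OF smooth_functions_chart[OF f W] \<open>k < n\<close>] VW by simp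
  have "C_infinity n (\<phi>' ` (V \<inter> W')) (\<lambda>y. coord_deriv W \<phi> k V f (inv_into W' \<phi>' y))"
    if W': "(W', \<phi>') \<in> \<A>" for W' \<phi>'
  proof (rule C_infinity_cong[OF openin_chart_image[OF W' V(1)]])
    show "?g (\<phi> (inv_into W' \<phi>' y)) = coord_deriv W \<phi> k V f (inv_into W' \<phi>' y)"
      if "y \<in> \<phi>' ` (V \<inter> W')" for y
      using that chart_inverse[OF W'] by (auto simp: coord_deriv_def)
    show "C_infinity n (\<phi>' ` (V \<inter> W')) (\<lambda>y. ?g (\<phi> (inv_into W' \<phi>' y)))"
    proof (rule C_infinity_compose[OF openin_chart_image[OF W' V(1)] _ g])
      show "openin (Euclidean_space n) (\<phi> ` V)"
        using openin_chart_image[OF W V(1)] VW by simp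
      have "openin (Euclidean_space n) (\<phi>' ` (W' \<inter> W))"
        using openin_chart_image[OF W' chart_domain[OF W]] by (simp add: Int_commute)
      moreover have "\<phi>' ` (V \<inter> W') \<subseteq> \<phi>' ` (W' \<inter> W)"
        using V(2) by auto
      ultimately show "C_infinity n (\<phi>' ` (V \<inter> W')) (\<lambda>y. \<phi> (inv_into W' \<phi>' y) i)" if "i < n" for i
        using C_infinity_subset[OF charts_compatible[OF W' W that]] by blast
      show "(\<lambda>y. \<phi> (inv_into W' \<phi>' y)) \<in> \<phi>' ` (V \<inter> W') \<rightarrow> \<phi> ` V"
        using chart_inverse[OF W'] by auto
    qed
  qed
  then show ?thesis
    by (auto simp: smooth_functions_def coord_deriv_def)
qed

lemma coord_deriv_has_partial_deriv:
  assumes W: "(W, \<phi>) \<in> \<A>" and V: "openin M V" "V \<subseteq> W" and "k < n"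
    and f: "f \<in> smooth_functions n \<A> V" and "x \<in> V"
  shows "has_partial_deriv (\<lambda>y. f (inv_into W \<phi> y)) (coord_deriv W \<phi> k V f x) k (\<phi> x)"
  using C_infinity_has_partial_deriv[OF smooth_functions_chart[OF f W] \<open>k < n\<close>, of "\<phi> x"] assms(3,6)
  by (auto simp: coord_deriv_def)

lemma coord_deriv_eqI:
  assumes "has_partial_deriv (\<lambda>y. f (inv_into W \<phi> y)) D k (\<phi> x)" "x \<in> V"
  shows "coord_deriv W \<phi> k V f x = D"
  using partial_deriv_eqI[OF assms(1)] assms(2) by (simp add: coord_deriv_def)

lemma coord_deriv_restrict:
  assumes W: "(W, \<phi>) \<in> \<A>" and V: "openin M V'" "V' \<subseteq> V" "V \<subseteq> W" and "k < n"
  shows "coord_deriv W \<phi> k V' (\<lambda>x. if x \<in> V' then f x else 0) x =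
    (if x \<in> V' then coord_deriv W \<phi> k V f x else 0)"
proof (cases "x \<in> V'")
  case True
  have "V' \<inter> W = V'"
    using V by blast
  then have op: "openin (Euclidean_space n) (\<phi> ` V')"
    using openin_chart_image[OF W V(1)] by simp
  have "partial_deriv k (\<lambda>y. if inv_into W \<phi> y \<in> V' then f (inv_into W \<phi> y) else 0) (\<phi> x) =
      partial_deriv k (\<lambda>y. f (inv_into W \<phi> y)) (\<phi> x)"
    using True V chart_inverse[OF W] by (intro partial_deriv_cong[OF op _ \<open>k < n\<close>]) auto
  then show ?thesis
    using True V by (auto simp: coord_deriv_def)
qed (simp add: coord_deriv_def)

end

subsection \<open>The product of the Grassmann algebra\<close>

lemma grassmann_sign_empty [simp]: "grassmann_sign {} J = 1" "grassmann_sign I {} = 1"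
  by (simp_all add: grassmann_sign_def)

lemma grassmann_sign_square [simp]: "grassmann_sign I J * grassmann_sign I J = 1"
  by (simp add: grassmann_sign_def flip: power_add)

lemma finite_inversions: "finite I \<Longrightarrow> finite J \<Longrightarrow> finite {(i, j). i \<in> I \<and> j \<in> J \<and> j < i}"
  by (rule finite_subset[of _ "I \<times> J"]) auto

lemma grassmann_sign_Un_left:
  assumes "finite I" "finite I'" "finite J" "I \<inter> I' = {}"
  shows "grassmann_sign (I \<union> I') J = grassmann_sign I J * grassmann_sign I' J"
proof -
  have "{(i, j). i \<in> I \<union> I' \<and> j \<in> J \<and> j < i} =
      {(i, j). i \<in> I \<and> j \<in> J \<and> j < i} \<union> {(i, j). i \<in> I' \<and> j \<in> J \<and> j < i}"
    by auto
  moreover have "{(i, j). i \<in> I \<and> j \<in> J \<and> j < i} \<inter> {(i, j). i \<in> I' \<and> j \<in> J \<and> j < i} = {}"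
    using assms(4) by auto
  ultimately show ?thesis
    using assms by (simp add: grassmann_sign_def card_Un_disjoint finite_inversions power_add)
qed

lemma grassmann_sign_Un_right:
  assumes "finite I" "finite J" "finite J'" "J \<inter> J' = {}"
  shows "grassmann_sign I (J \<union> J') = grassmann_sign I J * grassmann_sign I J'"
proof -
  have "{(i, j). i \<in> I \<and> j \<in> J \<union> J' \<and> j < i} =
      {(i, j). i \<in> I \<and> j \<in> J \<and> j < i} \<union> {(i, j). i \<in> I \<and> j \<in> J' \<and> j < i}"
    by auto
  moreover have "{(i, j). i \<in> I \<and> j \<in> J \<and> j < i} \<inter> {(i, j). i \<in> I \<and> j \<in> J' \<and> j < i} = {}"
    using assms(4) by auto
  ultimately show ?thesis
    using assms by (simp add: grassmann_sign_def card_Un_disjoint finite_inversions power_add)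
qed

lemma grassmann_sign_insert_left:
  "finite K \<Longrightarrow> finite J \<Longrightarrow> a \<notin> K \<Longrightarrow>
    grassmann_sign (insert a K) J = grassmann_sign {a} J * grassmann_sign K J"
  using grassmann_sign_Un_left[of "{a}" K J] by simp

lemma grassmann_sign_insert_right:
  "finite K \<Longrightarrow> finite J \<Longrightarrow> a \<notin> J \<Longrightarrow>
    grassmann_sign K (insert a J) = grassmann_sign K {a} * grassmann_sign K J"
  using grassmann_sign_Un_right[of K "{a}" J] by simp

text \<open>
  Each element of \<open>K\<close> forms an inversion with \<open>a\<close> in exactly one of
  the two orders.
\<close>

lemma grassmann_sign_swap:
  assumes "finite K" "a \<notin> K"
  shows "grassmann_sign {a} K * grassmann_sign K {a} = (-1) ^ card K"
proof -
  have 1: "{(i, j). i \<in> {a} \<and> j \<in> K \<and> j < i} = Pair a ` {j \<in> K. j < a}"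
    and 2: "{(i, j). i \<in> K \<and> j \<in> {a} \<and> j < i} = (\<lambda>i. (i, a)) ` {j \<in> K. a < j}"
    by auto
  have "card {j \<in> K. j < a} + card {j \<in> K. a < j} = card ({j \<in> K. j < a} \<union> {j \<in> K. a < j})"
    using assms(1) by (subst card_Un_disjoint) auto
  also have "{j \<in> K. j < a} \<union> {j \<in> K. a < j} = K"
    using assms(2) by (auto simp: linorder_not_less intro: le_neq_trans)
  finally show ?thesis
    unfolding grassmann_sign_def 1 2
    by (simp add: card_image inj_on_def flip: power_add)
qed

definition grassmann_mult ::
  "(nat set \<Rightarrow> 'a \<Rightarrow> real) \<Rightarrow> (nat set \<Rightarrow> 'a \<Rightarrow> real) \<Rightarrow> nat set \<Rightarrow> 'a \<Rightarrow> real" where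
  "grassmann_mult F G K x = (\<Sum>I\<in>Pow K. grassmann_sign I (K - I) * F I x * G (K - I) x)"

lemma grassmann_mult_empty [simp]: "grassmann_mult F G {} x = F {} x * G {} x"
  by (simp add: grassmann_mult_def)

text \<open>
  The left derivative \<open>\<partial>/\<partial>\<xi>^a\<close>: as \<open>\<xi>^(insert a I)
  = grassmann_sign {a} I \<xi>^a \<xi>^I\<close> for \<open>a\<close> outside \<open>I\<close>,
  removing the leading \<open>\<xi>^a\<close> leaves the coefficient at \<open>\<xi>^I\<close>
  given here.
\<close>

definition odd_deriv :: "nat \<Rightarrow> (nat set \<Rightarrow> 'a \<Rightarrow> real) \<Rightarrow> nat set \<Rightarrow> 'a \<Rightarrow> real" where
  "odd_deriv a F I x = (if a \<in> I then 0 else grassmann_sign {a} I * F (insert a I) x)"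

lemma sum_Pow_insert:
  assumes "finite I" "a \<notin> I"
  shows "(\<Sum>K\<in>Pow (insert a I). f K) = (\<Sum>K\<in>Pow I. f K + f (insert a K))"
proof -
  have "inj_on (insert a) (Pow I)"
    using assms(2) by (auto simp: inj_on_def)
  moreover have "Pow I \<inter> insert a ` Pow I = {}"
    using assms(2) by auto
  ultimately show ?thesis
    using assms(1) by (simp add: Pow_insert sum.union_disjoint sum.reindex sum.distrib)
qed

text \<open>
  The product rule for a homogeneous \<open>F\<close>, with \<open>s\<close> the sign of moving
  \<open>\<partial>/\<partial>\<xi>^a\<close> past it. Both sides are sums over the ways
  \<open>K \<union> L\<close> to split an index set. If \<open>a\<close> is not in
  \<open>I\<close>, on the left \<open>a\<close> can be put into \<open>K\<close>, which gives
  the first product, or into \<open>L\<close>, which gives the second one. If \<open>a\<close>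
  is in \<open>I\<close>, the left side is 0, and on the right the two ways to put
  \<open>a\<close> into \<open>K\<close> or \<open>L\<close> cancel.
\<close>

lemma odd_deriv_grassmann_mult:
  assumes s: "\<And>K. F K x \<noteq> 0 \<Longrightarrow> s = (-1) ^ card K"
  shows "odd_deriv a (grassmann_mult F G) I x =
    grassmann_mult (odd_deriv a F) G I x + s * grassmann_mult F (odd_deriv a G) I x"
proof (cases "finite I")
  case False
  then show ?thesis
    by (simp add: odd_deriv_def grassmann_mult_def)
next
  case fin: True
  let ?\<sigma> = grassmann_sign
  show ?thesis
  proof (cases "a \<in> I")
    case False
    have "odd_deriv a (grassmann_mult F G) I x =
        (\<Sum>K\<in>Pow I. ?\<sigma> {a} I * (?\<sigma> K (insert a I - K) * F K x * G (insert a I - K) x) +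
          ?\<sigma> {a} I * (?\<sigma> (insert a K) (insert a I - insert a K) * F (insert a K) x * G (insert a I - insert a K) x))"
      using False by (simp add: odd_deriv_def grassmann_mult_def sum_Pow_insert[OF fin False] sum_distrib_left
          distrib_left)
    also have "\<dots> = (\<Sum>K\<in>Pow I. ?\<sigma> K (I - K) * odd_deriv a F K x * G (I - K) x +
          s * (?\<sigma> K (I - K) * F K x * odd_deriv a G (I - K) x))"
    proof (rule sum.cong[OF refl])
      fix K assume "K \<in> Pow I"
      then obtain L where L: "I = K \<union> L" "K \<inter> L = {}" and "I - K = L"
        by (auto intro: that[of "I - K"])
      have aK: "a \<notin> K" "a \<notin> L" "finite K" "finite L"
        using L False fin by auto
      have "insert a I - K = insert a L" "insert a I - insert a K = L"
        using L aK by auto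
      have 1: "?\<sigma> {a} I = ?\<sigma> {a} K * ?\<sigma> {a} L"
        using grassmann_sign_Un_right[of "{a}" K L] L aK by simp
      have 2: "?\<sigma> K (insert a L) = ?\<sigma> K {a} * ?\<sigma> K L" "?\<sigma> (insert a K) L = ?\<sigma> {a} L * ?\<sigma> K L"
        by (intro grassmann_sign_insert_left grassmann_sign_insert_right aK)+
      have "?\<sigma> {a} I * (?\<sigma> K (insert a L) * F K x * G (insert a L) x) =
          (?\<sigma> {a} K * ?\<sigma> K {a}) * (?\<sigma> K L * F K x * (?\<sigma> {a} L * G (insert a L) x))"
        by (simp add: 1 2)
      also have "\<dots> = s * (?\<sigma> K L * F K x * (?\<sigma> {a} L * G (insert a L) x))"
        using grassmann_sign_swap[of K a] aK s[of K] by (cases "F K x = 0") auto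
      finally have 3: "?\<sigma> {a} I * (?\<sigma> K (insert a L) * F K x * G (insert a L) x) =
          s * (?\<sigma> K L * F K x * (?\<sigma> {a} L * G (insert a L) x))" .
      have "?\<sigma> {a} I * (?\<sigma> (insert a K) L * F (insert a K) x * G L x) =
          (?\<sigma> {a} L * ?\<sigma> {a} L) * (?\<sigma> K L * (?\<sigma> {a} K * F (insert a K) x) * G L x)"
        by (simp only: 1 2 mult_ac)
      then have 4: "?\<sigma> {a} I * (?\<sigma> (insert a K) L * F (insert a K) x * G L x) =
          ?\<sigma> K L * (?\<sigma> {a} K * F (insert a K) x) * G L x"
        by simp
      show "?\<sigma> {a} I * (?\<sigma> K (insert a I - K) * F K x * G (insert a I - K) x) +
          ?\<sigma> {a} I * (?\<sigma> (insert a K) (insert a I - insert a K) * F (insert a K) x * G (insert a I - insert a K) x) =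
          ?\<sigma> K (I - K) * odd_deriv a F K x * G (I - K) x +
          s * (?\<sigma> K (I - K) * F K x * odd_deriv a G (I - K) x)"
        unfolding \<open>I - K = L\<close> \<open>insert a I - K = insert a L\<close> \<open>insert a I - insert a K = L\<close> 3 4
        using aK by (simp add: odd_deriv_def)
    qed
    also have "\<dots> = grassmann_mult (odd_deriv a F) G I x + s * grassmann_mult F (odd_deriv a G) I x"
      by (simp add: grassmann_mult_def sum.distrib sum_distrib_left)
    finally show ?thesis .
  next
    case True
    define I' where "I' = I - {a}"
    have I': "I = insert a I'" "a \<notin> I'" "finite I'"
      using True fin by (auto simp: I'_def)
    have "grassmann_mult (odd_deriv a F) G I x + s * grassmann_mult F (odd_deriv a G) I x =
      (\<Sum>K\<in>Pow I'. ?\<sigma> K (I - K) * odd_deriv a F K x * G (I - K) x +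
         ?\<sigma> (insert a K) (I - insert a K) * odd_deriv a F (insert a K) x * G (I - insert a K) x +
         s * (?\<sigma> K (I - K) * F K x * odd_deriv a G (I - K) x +
         ?\<sigma> (insert a K) (I - insert a K) * F (insert a K) x * odd_deriv a G (I - insert a K) x))"
      unfolding I'(1) by (simp add: grassmann_mult_def sum_Pow_insert[OF I'(3,2)] sum.distrib sum_distrib_left
          distrib_left)
    also have "\<dots> = (\<Sum>K\<in>Pow I'. 0)"
    proof (rule sum.cong[OF refl])
      fix K assume "K \<in> Pow I'"
      then obtain L where L: "I' = K \<union> L" "K \<inter> L = {}"
        by (auto intro: that[of "I' - K"])
      have aK: "a \<notin> K" "a \<notin> L" "finite K" "finite L"
        using L I' by auto
      have IK: "I - K = insert a L" "I - insert a K = L"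
        using L aK I' by auto
      have "?\<sigma> K (insert a L) * (?\<sigma> {a} K * F (insert a K) x) * G (insert a L) x =
          (?\<sigma> {a} K * ?\<sigma> K {a}) * (?\<sigma> K L * F (insert a K) x * G (insert a L) x)"
        using grassmann_sign_insert_right[of K L a] aK by simp
      also have "\<dots> = (-1) ^ card K * (?\<sigma> K L * F (insert a K) x * G (insert a L) x)"
        using grassmann_sign_swap[of K a] aK by simp
      finally have 1: "?\<sigma> K (insert a L) * (?\<sigma> {a} K * F (insert a K) x) * G (insert a L) x =
          (-1) ^ card K * (?\<sigma> K L * F (insert a K) x * G (insert a L) x)" .
      have "?\<sigma> (insert a K) L * F (insert a K) x * (?\<sigma> {a} L * G (insert a L) x) =
          (?\<sigma> {a} L * ?\<sigma> {a} L) * (?\<sigma> K L * F (insert a K) x * G (insert a L) x)"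
        by (simp only: grassmann_sign_insert_left[OF aK(3,4,1)] mult_ac)
      then have 2: "?\<sigma> (insert a K) L * F (insert a K) x * (?\<sigma> {a} L * G (insert a L) x) =
          ?\<sigma> K L * F (insert a K) x * G (insert a L) x"
        by simp
      have 3: "s * F (insert a K) x = - ((-1) ^ card K) * F (insert a K) x"
        using s[of "insert a K"] aK by (cases "F (insert a K) x = 0") auto
      have "s * (?\<sigma> K L * F (insert a K) x * G (insert a L) x) =
          ?\<sigma> K L * (s * F (insert a K) x) * G (insert a L) x"
        by simp
      then have 4: "s * (?\<sigma> K L * F (insert a K) x * G (insert a L) x) =
          - ((-1) ^ card K * (?\<sigma> K L * F (insert a K) x * G (insert a L) x))"
        unfolding 3 by simp
      have od: "odd_deriv a F K x = ?\<sigma> {a} K * F (insert a K) x" "odd_deriv a F (insert a K) x = 0"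
          "odd_deriv a G L x = ?\<sigma> {a} L * G (insert a L) x" "odd_deriv a G (insert a L) x = 0"
        using aK by (simp_all add: odd_deriv_def)
      show "?\<sigma> K (I - K) * odd_deriv a F K x * G (I - K) x +
         ?\<sigma> (insert a K) (I - insert a K) * odd_deriv a F (insert a K) x * G (I - insert a K) x +
         s * (?\<sigma> K (I - K) * F K x * odd_deriv a G (I - K) x +
         ?\<sigma> (insert a K) (I - insert a K) * F (insert a K) x * odd_deriv a G (I - insert a K) x) = 0"
        unfolding IK od 1 2 using 4 by simp
    qed
    finally show ?thesis
      using True by (simp add: odd_deriv_def)
  qed
qed

lemma (in smooth_manifold) coord_deriv_grassmann_mult:
  assumes W: "(W, \<phi>) \<in> \<A>" and V: "openin M V" "V \<subseteq> W" and k: "k < n"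
    and F: "\<And>I. F I \<in> smooth_functions n \<A> V" and G: "\<And>I. G I \<in> smooth_functions n \<A> V"
  shows "coord_deriv W \<phi> k V (grassmann_mult F G I) x =
    grassmann_mult (\<lambda>I. coord_deriv W \<phi> k V (F I)) G I x +
    grassmann_mult F (\<lambda>I. coord_deriv W \<phi> k V (G I)) I x"
proof (cases "x \<in> V")
  case True
  let ?D = "\<lambda>f. coord_deriv W \<phi> k V f x"
  have x: "inv_into W \<phi> (\<phi> x) = x"
    using True V chart_inverse[OF W] by auto
  have "has_partial_deriv (\<lambda>y. \<Sum>K\<in>Pow I. grassmann_sign K (I - K) *
          (F K (inv_into W \<phi> y) * G (I - K) (inv_into W \<phi> y)))
      (\<Sum>K\<in>Pow I. grassmann_sign K (I - K) * (?D (F K) * G (I - K) x + ?D (G (I - K)) * F K x)) k (\<phi> x)"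
  proof (rule DERIV_sum, rule DERIV_cmult)
    fix K assume "K \<in> Pow I"
    show "has_partial_deriv (\<lambda>y. F K (inv_into W \<phi> y) * G (I - K) (inv_into W \<phi> y))
        (?D (F K) * G (I - K) x + ?D (G (I - K)) * F K x) k (\<phi> x)"
      using DERIV_mult[OF coord_deriv_has_partial_deriv[OF W V k F True, of K]
          coord_deriv_has_partial_deriv[OF W V k G True, of "I - K"]]
      by (simp only: fun_upd_triv x)
  qed
  then have "has_partial_deriv (\<lambda>y. grassmann_mult F G I (inv_into W \<phi> y))
      (\<Sum>K\<in>Pow I. grassmann_sign K (I - K) * (?D (F K) * G (I - K) x + ?D (G (I - K)) * F K x)) k (\<phi> x)"
    unfolding grassmann_mult_def by (simp only: mult.assoc)
  then have "?D (grassmann_mult F G I) =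
      (\<Sum>K\<in>Pow I. grassmann_sign K (I - K) * (?D (F K) * G (I - K) x + ?D (G (I - K)) * F K x))"
    using True by (rule coord_deriv_eqI)
  also have "\<dots> = grassmann_mult (\<lambda>I. coord_deriv W \<phi> k V (F I)) G I x +
      grassmann_mult F (\<lambda>I. coord_deriv W \<phi> k V (G I)) I x"
    by (simp add: grassmann_mult_def sum.distrib algebra_simps)
  finally show ?thesis .
next
  case False
  have "F K x = 0" "G K x = 0" for K
    using F[of K] G[of K] False by (auto simp: smooth_functions_def)
  then show ?thesis
    using False by (simp add: coord_deriv_def grassmann_mult_def)
qed

section \<open>Vector fields on a trivialized region\<close>

definition bit_sign :: "bit \<Rightarrow> real" where
  "bit_sign p = (if p = 0 then 1 else - 1)"

lemma bit_sign_of_nat: "bit_sign (of_nat k) = (- 1) ^ k"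
proof (induction k)
  case (Suc k)
  have "bit_sign (1 + p) = - bit_sign p" for p
    by (cases p) (simp_all add: bit_sign_def)
  with Suc show ?case
    by simp
qed (simp add: bit_sign_def)

lemma bit_sign_simps [simp]: "bit_sign 0 = 1" "bit_sign 1 = - 1"
  by (simp_all add: bit_sign_def)

lemma model_sheaf_simps:
  "carrier (sections (model_sheaf n m \<A>) V) = model_carrier n m \<A> V"
  "F \<otimes>\<^bsub>sections (model_sheaf n m \<A>) V\<^esub> G = grassmann_mult F G"
  "F \<oplus>\<^bsub>sections (model_sheaf n m \<A>) V\<^esub> G = (\<lambda>I x. F I x + G I x)"
  "r \<odot>\<^bsub>sections (model_sheaf n m \<A>) V\<^esub> F = (\<lambda>I x. r * F I x)"
  "\<one>\<^bsub>sections (model_sheaf n m \<A>) V\<^esub> = (\<lambda>I x. if I = {} \<and> x \<in> V then 1 else 0)"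
  "restr (model_sheaf n m \<A>) U V F = (\<lambda>I x. if x \<in> V then F I x else 0)"
  "homog (sections (model_sheaf n m \<A>) V) p =
    {F \<in> model_carrier n m \<A> V. \<forall>I. of_nat (card I) \<noteq> p \<longrightarrow> F I = (\<lambda>x. 0)}"
  by (simp_all add: model_sheaf_def grassmann_mult_def fun_eq_iff)

lemma model_carrier_outside: "F \<in> model_carrier n m \<A> V \<Longrightarrow> x \<notin> V \<Longrightarrow> F I x = 0"
  by (auto simp: model_carrier_def smooth_functions_def)

lemma model_carrier_large: "F \<in> model_carrier n m \<A> V \<Longrightarrow> \<not> I \<subseteq> {..<m} \<Longrightarrow> F I x = 0"
  by (auto simp: model_carrier_def)

lemma (in sheaf_of_superalgebras) ring_sections: "openin M U \<Longrightarrow> ring (sections \<O> U)"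
  using superalgebra_sections real_superalgebra.axioms(1) by blast

lemma (in sheaf_of_superalgebras) real_smult_closed:
  assumes "openin M U" "f \<in> carrier (sections \<O> U)"
  shows "r \<odot>\<^bsub>sections \<O> U\<^esub> f \<in> carrier (sections \<O> U)"
proof -
  have "module real_ring (sections \<O> U)"
    using superalgebra_sections[OF assms(1)] by (simp add: real_superalgebra_def)
  from module.smult_closed[OF this, of r f] show ?thesis
    using assms(2) by (simp add: ring_of_type_algebra_def)
qed

text \<open>
  A region \<open>B\<close> on which \<open>\<O>\<close> is identified with the model sheaf by
  \<open>\<psi>\<close>. All computations with functions are done with the coefficients
  \<open>\<psi> V f I\<close> at \<open>\<xi>^I\<close>.
\<close>

locale trivialized_region = supermanifold n m M \<A> \<O>
  for n m :: nat and M :: "'a topology" and \<A> :: "'a chart set"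
    and \<O> :: "('a, real, 's) super_sheaf" +
  fixes B :: "'a set" and \<psi> :: "'a set \<Rightarrow> 's \<Rightarrow> nat set \<Rightarrow> 'a \<Rightarrow> real"
  assumes trivialization: "local_trivialization n m M \<A> \<O> B \<psi>"
begin

lemma openin_region: "openin M B"
  using trivialization by (simp add: local_trivialization_def)

context
  fixes V assumes V: "openin M V" "V \<subseteq> B"
begin

lemma triv_hom: "\<psi> V \<in> superalgebra_hom (sections \<O> V) (sections (model_sheaf n m \<A>) V)"
  using trivialization V by (simp add: local_trivialization_def)

lemma triv_bij: "bij_betw (\<psi> V) (carrier (sections \<O> V)) (model_carrier n m \<A> V)"
  using trivialization V by (simp add: local_trivialization_def model_sheaf_simps)

lemma triv_closed: "f \<in> carrier (sections \<O> V) \<Longrightarrow> \<psi> V f \<in> model_carrier n m \<A> V"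
  using triv_bij by (auto simp: bij_betw_def)

lemma triv_inj:
  "f \<in> carrier (sections \<O> V) \<Longrightarrow> g \<in> carrier (sections \<O> V) \<Longrightarrow> \<psi> V f = \<psi> V g \<Longrightarrow> f = g"
  using triv_bij by (auto simp: bij_betw_def dest: inj_onD)

lemma triv_surj:
  assumes "F \<in> model_carrier n m \<A> V"
  obtains f where "f \<in> carrier (sections \<O> V)" "\<psi> V f = F"
proof -
  have "F \<in> \<psi> V ` carrier (sections \<O> V)"
    using assms by (simp only: bij_betw_imp_surj_on[OF triv_bij])
  then show thesis
    by (auto intro: that)
qed

lemma triv_mult:
  "f \<in> carrier (sections \<O> V) \<Longrightarrow> g \<in> carrier (sections \<O> V) \<Longrightarrow>
    \<psi> V (f \<otimes>\<^bsub>sections \<O> V\<^esub> g) = grassmann_mult (\<psi> V f) (\<psi> V g)"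
  using triv_hom by (auto simp: superalgebra_hom_def ring_hom_def model_sheaf_simps)

lemma triv_add:
  "f \<in> carrier (sections \<O> V) \<Longrightarrow> g \<in> carrier (sections \<O> V) \<Longrightarrow>
    \<psi> V (f \<oplus>\<^bsub>sections \<O> V\<^esub> g) = (\<lambda>I x. \<psi> V f I x + \<psi> V g I x)"
  using triv_hom by (auto simp: superalgebra_hom_def ring_hom_def model_sheaf_simps)

lemma triv_one: "\<psi> V \<one>\<^bsub>sections \<O> V\<^esub> = (\<lambda>I x. if I = {} \<and> x \<in> V then 1 else 0)"
  using triv_hom by (auto simp: superalgebra_hom_def ring_hom_def model_sheaf_simps)

lemma triv_smult:
  "f \<in> carrier (sections \<O> V) \<Longrightarrow> \<psi> V (r \<odot>\<^bsub>sections \<O> V\<^esub> f) = (\<lambda>I x. r * \<psi> V f I x)"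
  using triv_hom by (auto simp: superalgebra_hom_def model_sheaf_simps)

lemma triv_homog:
  "f \<in> homog (sections \<O> V) p \<Longrightarrow> \<psi> V f \<in> homog (sections (model_sheaf n m \<A>) V) p"
  using triv_hom unfolding superalgebra_hom_def by blast

lemma triv_homog_coeff:
  assumes "f \<in> homog (sections \<O> V) p" "\<psi> V f I x \<noteq> 0"
  shows "p = of_nat (card I)"
  using triv_homog[OF assms(1)] assms(2) by (auto simp: model_sheaf_simps)

interpretation A: ring "sections \<O> V"
  by (rule ring_sections[OF V(1)])

lemma triv_zero: "\<psi> V \<zero>\<^bsub>sections \<O> V\<^esub> = (\<lambda>I x. 0)"
proof -
  have "\<psi> V \<zero>\<^bsub>sections \<O> V\<^esub> I x = \<psi> V \<zero>\<^bsub>sections \<O> V\<^esub> I x + \<psi> V \<zero>\<^bsub>sections \<O> V\<^esub> I x" for I x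
    using triv_add[of "\<zero>\<^bsub>sections \<O> V\<^esub>" "\<zero>\<^bsub>sections \<O> V\<^esub>"]
    by (metis A.r_zero A.zero_closed)
  then show ?thesis
    by (simp add: fun_eq_iff)
qed

lemma triv_minus:
  assumes "f \<in> carrier (sections \<O> V)"
  shows "\<psi> V (\<ominus>\<^bsub>sections \<O> V\<^esub> f) = (\<lambda>I x. - \<psi> V f I x)"
proof -
  have "(\<lambda>I x. \<psi> V f I x + \<psi> V (\<ominus>\<^bsub>sections \<O> V\<^esub> f) I x) = (\<lambda>I x. 0)"
    using triv_add[of f "\<ominus>\<^bsub>sections \<O> V\<^esub> f"] assms triv_zero by (simp add: A.r_neg)
  then have "\<psi> V f I x + \<psi> V (\<ominus>\<^bsub>sections \<O> V\<^esub> f) I x = 0" for I x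
    by (metis (no_types))
  then show ?thesis
    by (simp add: fun_eq_iff add_eq_0_iff)
qed

lemma triv_super_sign:
  "f \<in> carrier (sections \<O> V) \<Longrightarrow>
    \<psi> V (super_sign (sections \<O> V) a f) = (\<lambda>I x. bit_sign a * \<psi> V f I x)"
  by (simp add: super_sign_def triv_minus bit_sign_def)

lemma homog_carrier: "f \<in> homog (sections \<O> V) p \<Longrightarrow> f \<in> carrier (sections \<O> V)"
  using super_group.homog_subgroup[OF super_group_sections[OF V(1)]] additive_subgroup.a_subset by blast

lemma homog_decomposition:
  assumes "f \<in> carrier (sections \<O> V)"
  obtains f0 f1 where "f0 \<in> homog (sections \<O> V) 0" "f1 \<in> homog (sections \<O> V) 1"
    "f = f0 \<oplus>\<^bsub>sections \<O> V\<^esub> f1"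
  using assms super_group.homog_generate[OF super_group_sections[OF V(1)]] by (auto simp: set_add_def' intro: that)

text \<open>
  The inverse of an even isomorphism is even: the component of \<open>f\<close> of the other
  parity has coefficients of the other parity only, and these are missing in \<open>\<psi> V
  f\<close>.
\<close>

lemma triv_homogD:
  assumes f: "f \<in> carrier (sections \<O> V)" and F: "\<psi> V f \<in> homog (sections (model_sheaf n m \<A>) V) p"
  shows "f \<in> homog (sections \<O> V) p"
proof -
  obtain f0 f1 where f01: "f0 \<in> homog (sections \<O> V) 0" "f1 \<in> homog (sections \<O> V) 1"
    "f = f0 \<oplus>\<^bsub>sections \<O> V\<^esub> f1"
    using homog_decomposition[OF f] .
  note c = f01(1,2)[THEN homog_carrier]
  have sum: "\<psi> V f I x = \<psi> V f0 I x + \<psi> V f1 I x" for I x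
    using triv_add[OF c] f01(3) by simp
  have F0: "\<psi> V f I x = 0" if "of_nat (card I) \<noteq> p" for I x
    using F that by (auto simp: model_sheaf_simps)
  have "p = 0 \<or> p = 1"
    by (cases p) auto
  then show ?thesis
  proof
    assume p: "p = 0"
    have "\<psi> V f1 I x = 0" for I x
    proof (cases "of_nat (card I) = (1::bit)")
      case True
      then have "\<psi> V f0 I x = 0"
        using triv_homog_coeff[OF f01(1), of I x] by auto
      then show ?thesis
        using sum[of I x] F0[of I x] True p by simp
    qed (use triv_homog_coeff[OF f01(2), of I x] in auto)
    then have "f1 = \<zero>\<^bsub>sections \<O> V\<^esub>"
      using c(2) triv_zero by (intro triv_inj) (auto simp: fun_eq_iff)
    then show ?thesis
      using f01 c p by simp
  next
    assume p: "p = 1"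
    have "\<psi> V f0 I x = 0" for I x
    proof (cases "of_nat (card I) = (0::bit)")
      case True
      then have "\<psi> V f1 I x = 0"
        using triv_homog_coeff[OF f01(2), of I x] by auto
      then show ?thesis
        using sum[of I x] F0[of I x] True p by simp
    qed (use triv_homog_coeff[OF f01(1), of I x] in auto)
    then have "f0 = \<zero>\<^bsub>sections \<O> V\<^esub>"
      using c(1) triv_zero by (intro triv_inj) (auto simp: fun_eq_iff)
    then show ?thesis
      using f01 c p by simp
  qed
qed

end

lemma triv_restr:
  "openin M U \<Longrightarrow> openin M V \<Longrightarrow> V \<subseteq> U \<Longrightarrow> U \<subseteq> B \<Longrightarrow> f \<in> carrier (sections \<O> U) \<Longrightarrow>
    \<psi> V (restr \<O> U V f) = (\<lambda>I x. if x \<in> V then \<psi> U f I x else 0)"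
  using trivialization by (simp add: local_trivialization_def model_sheaf_simps)

subsection \<open>Transport of superderivations of the model\<close>

text \<open>
  A superderivation of the model, given compatibly over all open subsets of \<open>B\<close>,
  yields one of \<open>\<O>\<close> by conjugation with \<open>\<psi>\<close>. All identities
  hold because \<open>\<psi>\<close> is injective and respects the operations.
\<close>

lemma superderivation_transfer:
  assumes closed: "\<And>V F. openin M V \<Longrightarrow> V \<subseteq> B \<Longrightarrow> F \<in> model_carrier n m \<A> V \<Longrightarrow>
      \<delta> V F \<in> model_carrier n m \<A> V"
    and add: "\<And>V F G. openin M V \<Longrightarrow> V \<subseteq> B \<Longrightarrow> F \<in> model_carrier n m \<A> V \<Longrightarrow>
      G \<in> model_carrier n m \<A> V \<Longrightarrow>
      \<delta> V (\<lambda>I x. F I x + G I x) = (\<lambda>I x. \<delta> V F I x + \<delta> V G I x)"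
    and smult: "\<And>V r F. openin M V \<Longrightarrow> V \<subseteq> B \<Longrightarrow> F \<in> model_carrier n m \<A> V \<Longrightarrow>
      \<delta> V (\<lambda>I x. r * F I x) = (\<lambda>I x. r * \<delta> V F I x)"
    and homog: "\<And>V F q. openin M V \<Longrightarrow> V \<subseteq> B \<Longrightarrow> F \<in> homog (sections (model_sheaf n m \<A>) V) q \<Longrightarrow>
      \<delta> V F \<in> homog (sections (model_sheaf n m \<A>) V) (p + q)"
    and Leibniz: "\<And>V F G q. openin M V \<Longrightarrow> V \<subseteq> B \<Longrightarrow>
      F \<in> homog (sections (model_sheaf n m \<A>) V) q \<Longrightarrow> G \<in> model_carrier n m \<A> V \<Longrightarrow>
      \<delta> V (grassmann_mult F G) =
        (\<lambda>I x. grassmann_mult (\<delta> V F) G I x + bit_sign (p * q) * grassmann_mult F (\<delta> V G) I x)"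
    and restr: "\<And>V W F. openin M V \<Longrightarrow> openin M W \<Longrightarrow> W \<subseteq> V \<Longrightarrow> V \<subseteq> B \<Longrightarrow>
      F \<in> model_carrier n m \<A> V \<Longrightarrow>
      \<delta> W (\<lambda>I x. if x \<in> W then F I x else 0) = (\<lambda>I x. if x \<in> W then \<delta> V F I x else 0)"
  obtains D where "D \<in> superderivations M \<O> B p"
    "\<And>V f. openin M V \<Longrightarrow> V \<subseteq> B \<Longrightarrow> f \<in> carrier (sections \<O> V) \<Longrightarrow> \<psi> V (D V f) = \<delta> V (\<psi> V f)"
proof -
  define D where "D = (\<lambda>V\<in>opens_in M B. \<lambda>f\<in>carrier (sections \<O> V).
    inv_into (carrier (sections \<O> V)) (\<psi> V) (\<delta> V (\<psi> V f)))"
  have D: "D V f \<in> carrier (sections \<O> V)" "\<psi> V (D V f) = \<delta> V (\<psi> V f)"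
    if V: "openin M V" "V \<subseteq> B" and f: "f \<in> carrier (sections \<O> V)" for V f
  proof -
    have "\<delta> V (\<psi> V f) \<in> \<psi> V ` carrier (sections \<O> V)"
      using closed[OF V triv_closed[OF V f]] triv_bij[OF V] by (auto simp: bij_betw_def)
    moreover have "D V f = inv_into (carrier (sections \<O> V)) (\<psi> V) (\<delta> V (\<psi> V f))"
      using V f by (simp add: D_def opens_in_def)
    ultimately show "D V f \<in> carrier (sections \<O> V)" "\<psi> V (D V f) = \<delta> V (\<psi> V f)"
      by (simp_all add: inv_into_into f_inv_into_f)
  qed
  have "D \<in> superderivations M \<O> B p"
    unfolding superderivations_def Let_def
  proof (intro CollectI conjI ballI allI)
    show "D \<in> extensional (opens_in M B)"
      by (simp add: D_def)
  next
    fix V assume "V \<in> opens_in M B"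
    then have V: "openin M V" "V \<subseteq> B"
      by (simp_all add: opens_in_def)
    interpret A: ring "sections \<O> V"
      by (rule ring_sections[OF V(1)])
    note D' = D[OF V] and c = triv_closed[OF V]
    show "D V \<in> carrier (sections \<O> V) \<rightarrow>\<^sub>E carrier (sections \<O> V)"
      using D'(1) V by (auto simp: D_def opens_in_def)
    show "D V (f \<oplus>\<^bsub>sections \<O> V\<^esub> g) = D V f \<oplus>\<^bsub>sections \<O> V\<^esub> D V g"
      if "f \<in> carrier (sections \<O> V)" "g \<in> carrier (sections \<O> V)" for f g
      using that by (intro triv_inj[OF V]) (simp_all add: D' triv_add[OF V] add[OF V] c)
    show "D V (r \<odot>\<^bsub>sections \<O> V\<^esub> f) = r \<odot>\<^bsub>sections \<O> V\<^esub> D V f"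
      if f: "f \<in> carrier (sections \<O> V)" for r f
    proof -
      have r: "r \<odot>\<^bsub>sections \<O> V\<^esub> g \<in> carrier (sections \<O> V)" if "g \<in> carrier (sections \<O> V)" for g
        using that V(1) by (rule real_smult_closed[rotated])
      then show ?thesis
        using f by (intro triv_inj[OF V]) (simp_all add: D' triv_smult[OF V] smult[OF V] c)
    qed
    show "D V f \<in> homog (sections \<O> V) (p + q)" if "f \<in> homog (sections \<O> V) q" for q f
      using homog_carrier[OF V that] homog[OF V triv_homog[OF V that]] D'
      by (intro triv_homogD[OF V]) simp_all
    show "D V (f \<otimes>\<^bsub>sections \<O> V\<^esub> g) = D V f \<otimes>\<^bsub>sections \<O> V\<^esub> g \<oplus>\<^bsub>sections \<O> V\<^esub>
        super_sign (sections \<O> V) (p * q) (f \<otimes>\<^bsub>sections \<O> V\<^esub> D V g)"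
      if f: "f \<in> homog (sections \<O> V) q" and g: "g \<in> carrier (sections \<O> V)" for q f g
    proof -
      have sgn: "super_sign (sections \<O> V) a h \<in> carrier (sections \<O> V)"
        if "h \<in> carrier (sections \<O> V)" for a h
        using that by (simp add: super_sign_def)
      note fc = homog_carrier[OF V f]
      show ?thesis
        using fc g
        by (intro triv_inj[OF V])
           (simp_all add: D' triv_add[OF V] triv_mult[OF V] triv_super_sign[OF V] sgn
              Leibniz[OF V triv_homog[OF V f]] c)
    qed
  next
    fix V W f assume VW: "V \<in> opens_in M B" "W \<in> opens_in M V" and f: "f \<in> carrier (sections \<O> V)"
    then have V: "openin M V" "V \<subseteq> B" and W: "openin M W" "W \<subseteq> V" and WB: "W \<subseteq> B"
      by (auto simp: opens_in_def)
    note r = restr_closed[OF V(1) W]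
    show "restr \<O> V W (D V f) = D W (restr \<O> V W f)"
      by (intro triv_inj[OF W(1) WB] r D(1)[OF V f] D(1)[OF W(1) WB] f)
         (simp only: D(2)[OF W(1) WB r[OF f]] triv_restr[OF V(1) W V(2)] D(1)[OF V f] f
            restr[OF V(1) W V(2) triv_closed[OF V f]] D(2)[OF V f])
  qed
  then show ?thesis
    using that D(2) by blast
qed

text \<open>
  A vector field is by definition a sum of an even and an odd superderivation. A homogeneous one
  is therefore completed by the zero derivation of the other parity.
\<close>

lemma zero_superderivation:
  obtains Z where "Z \<in> superderivations M \<O> B p"
    "\<And>V f. openin M V \<Longrightarrow> V \<subseteq> B \<Longrightarrow> f \<in> carrier (sections \<O> V) \<Longrightarrow> Z V f = \<zero>\<^bsub>sections \<O> V\<^esub>"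
proof -
  have z: "(\<lambda>I x. 0) \<in> model_carrier n m \<A> V" if V: "openin M V" "V \<subseteq> B" for V
  proof -
    interpret A: ring "sections \<O> V"
      by (rule ring_sections[OF V(1)])
    show ?thesis
      using triv_closed[OF V A.zero_closed] triv_zero[OF V] by simp
  qed
  obtain Z where Z: "Z \<in> superderivations M \<O> B p"
    "\<And>V f. openin M V \<Longrightarrow> V \<subseteq> B \<Longrightarrow> f \<in> carrier (sections \<O> V) \<Longrightarrow> \<psi> V (Z V f) = (\<lambda>I x. 0)"
    by (rule superderivation_transfer[of "\<lambda>V F I x. 0" p])
       (auto simp: z model_sheaf_simps grassmann_mult_def)
  have "Z V f = \<zero>\<^bsub>sections \<O> V\<^esub>"
    if V: "openin M V" "V \<subseteq> B" and f: "f \<in> carrier (sections \<O> V)" for V f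
  proof -
    interpret A: ring "sections \<O> V"
      by (rule ring_sections[OF V(1)])
    have "V \<in> opens_in M B"
      using V by (simp add: opens_in_def)
    then have "Z V f \<in> carrier (sections \<O> V)"
      using Z(1) f unfolding superderivations_def Let_def by blast
    then show ?thesis
      using Z(2)[OF V f] by (intro triv_inj[OF V]) (simp_all add: triv_zero[OF V])
  qed
  then show ?thesis
    using that Z(1) by blast
qed

lemma superderivation_closed:
  assumes "D \<in> superderivations M \<O> U p" "openin M V" "V \<subseteq> U" "f \<in> carrier (sections \<O> V)"
  shows "D V f \<in> carrier (sections \<O> V)"
proof -
  have "V \<in> opens_in M U"
    using assms by (simp add: opens_in_def)
  then show ?thesis
    using assms(1,4) unfolding superderivations_def Let_def by blast
qed

lemma superderivation_vector_field:
  assumes D: "D \<in> superderivations M \<O> B p"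
  shows "D \<in> carrier (vector_fields M \<O> B)"
proof -
  obtain Z where Z: "Z \<in> superderivations M \<O> B (p + 1)"
    "\<And>V f. openin M V \<Longrightarrow> V \<subseteq> B \<Longrightarrow> f \<in> carrier (sections \<O> V) \<Longrightarrow> Z V f = \<zero>\<^bsub>sections \<O> V\<^esub>"
    using zero_superderivation[of "p + 1"] by blast
  have ext: "D V f = undefined" if "V \<in> opens_in M B" "f \<notin> carrier (sections \<O> V)" for V f
    using D that unfolding superderivations_def Let_def by (auto simp: PiE_def extensional_def)
  have ext': "D V = undefined" if "V \<notin> opens_in M B" for V
    using D that unfolding superderivations_def by (auto simp: extensional_def)
  have sum: "D V f \<oplus>\<^bsub>sections \<O> V\<^esub> Z V f = D V f" "Z V f \<oplus>\<^bsub>sections \<O> V\<^esub> D V f = D V f"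
    if V: "openin M V" "V \<subseteq> B" and f: "f \<in> carrier (sections \<O> V)" for V f
  proof -
    interpret A: ring "sections \<O> V"
      by (rule ring_sections[OF V(1)])
    show "D V f \<oplus>\<^bsub>sections \<O> V\<^esub> Z V f = D V f" "Z V f \<oplus>\<^bsub>sections \<O> V\<^esub> D V f = D V f"
      using superderivation_closed[OF D V f] Z(2)[OF V f] by simp_all
  qed
  have "vector_field_add M \<O> B D Z = D" "vector_field_add M \<O> B Z D = D"
    using sum ext ext' by (auto simp: vector_field_add_def fun_eq_iff restrict_def opens_in_def)
  moreover have "p = 0 \<or> p = 1"
    by (cases p) auto
  ultimately have "\<exists>D0\<in>superderivations M \<O> B 0. \<exists>D1\<in>superderivations M \<O> B 1.
      D = vector_field_add M \<O> B D0 D1"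
    using D Z(1) by (elim disjE) (simp, metis)+
  then show ?thesis
    by (auto simp: tangent_sheaf_def)
qed

lemma even_coordinate_field:
  assumes W: "(W, \<phi>) \<in> \<A>" and BW: "B \<subseteq> W" and k: "k < n"
  obtains D where "D \<in> superderivations M \<O> B 0"
    "\<And>f I. f \<in> carrier (sections \<O> B) \<Longrightarrow> \<psi> B (D B f) I = coord_deriv W \<phi> k B (\<psi> B f I)"
proof -
  let ?\<delta> = "\<lambda>V F I. coord_deriv W \<phi> k V (F I)"
  have smooth: "F I \<in> smooth_functions n \<A> V" if "F \<in> model_carrier n m \<A> V" for F I V
    using that by (simp add: model_carrier_def)
  have zero: "coord_deriv W \<phi> k V (\<lambda>x. 0) = (\<lambda>x. 0)" for V
    by (simp add: coord_deriv_def partial_deriv_def fun_eq_iff)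
  have closed: "?\<delta> V F \<in> model_carrier n m \<A> V"
    if V: "openin M V" "V \<subseteq> B" and F: "F \<in> model_carrier n m \<A> V" for V F
    using F coord_deriv_smooth[OF W V(1) _ k] V BW zero by (auto simp: model_carrier_def)
  have VW: "V \<subseteq> W" if "V \<subseteq> B" for V
    using that BW by blast
  have pd: "has_partial_deriv (\<lambda>y. F I (inv_into W \<phi> y)) (?\<delta> V F I x) k (\<phi> x)"
    if V: "openin M V" "V \<subseteq> B" and F: "F \<in> model_carrier n m \<A> V" and x: "x \<in> V" for V F I x
    by (rule coord_deriv_has_partial_deriv[OF W V(1) VW[OF V(2)] k smooth[OF F] x])
  obtain D where D: "D \<in> superderivations M \<O> B 0"
    "\<And>V f. openin M V \<Longrightarrow> V \<subseteq> B \<Longrightarrow> f \<in> carrier (sections \<O> V) \<Longrightarrow> \<psi> V (D V f) = ?\<delta> V (\<psi> V f)"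
  proof (rule superderivation_transfer[of ?\<delta> 0])
    fix V F G assume V: "openin M V" "V \<subseteq> B" and F: "F \<in> model_carrier n m \<A> V"
      and G: "G \<in> model_carrier n m \<A> V"
    show "?\<delta> V (\<lambda>I x. F I x + G I x) = (\<lambda>I x. ?\<delta> V F I x + ?\<delta> V G I x)"
    proof (intro ext)
      fix I x
      show "?\<delta> V (\<lambda>I x. F I x + G I x) I x = ?\<delta> V F I x + ?\<delta> V G I x"
      proof (cases "x \<in> V")
        case True
        show ?thesis
          by (rule coord_deriv_eqI[OF DERIV_add[OF pd[OF V F True] pd[OF V G True]] True])
      qed (simp add: coord_deriv_def)
    qed
  next
    fix V r F assume V: "openin M V" "V \<subseteq> B" and F: "F \<in> model_carrier n m \<A> V"
    show "?\<delta> V (\<lambda>I x. r * F I x) = (\<lambda>I x. r * ?\<delta> V F I x)"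
    proof (intro ext)
      fix I x
      show "?\<delta> V (\<lambda>I x. r * F I x) I x = r * ?\<delta> V F I x"
      proof (cases "x \<in> V")
        case True
        show ?thesis
          by (rule coord_deriv_eqI[OF DERIV_cmult[OF pd[OF V F True]] True])
      qed (simp add: coord_deriv_def)
    qed
  next
    fix V F q assume V: "openin M V" "V \<subseteq> B" and F: "F \<in> homog (sections (model_sheaf n m \<A>) V) q"
    then show "?\<delta> V F \<in> homog (sections (model_sheaf n m \<A>) V) (0 + q)"
      using closed[OF V] zero by (auto simp: model_sheaf_simps)
  next
    fix V F G q assume V: "openin M V" "V \<subseteq> B" and F: "F \<in> homog (sections (model_sheaf n m \<A>) V) q"
      and G: "G \<in> model_carrier n m \<A> V"
    then show "?\<delta> V (grassmann_mult F G) =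
        (\<lambda>I x. grassmann_mult (?\<delta> V F) G I x + bit_sign (0 * q) * grassmann_mult F (?\<delta> V G) I x)"
      using coord_deriv_grassmann_mult[OF W V(1) VW[OF V(2)] k, of F G] smooth
      by (auto simp: model_sheaf_simps fun_eq_iff)
  next
    fix V V' F assume V: "openin M V" "openin M V'" "V' \<subseteq> V" "V \<subseteq> B"
    show "?\<delta> V' (\<lambda>I x. if x \<in> V' then F I x else 0) = (\<lambda>I x. if x \<in> V' then ?\<delta> V F I x else 0)"
      using coord_deriv_restrict[OF W V(2,3) VW[OF V(4)] k] by (simp add: fun_eq_iff)
  qed (use closed in auto)
  then show ?thesis
    using that openin_region by simp
qed

lemma odd_coordinate_field:
  assumes a: "a < m"
  obtains D where "D \<in> superderivations M \<O> B 1"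
    "\<And>f. f \<in> carrier (sections \<O> B) \<Longrightarrow> \<psi> B (D B f) = odd_deriv a (\<psi> B f)"
proof -
  have bit_swap: "1 + c \<noteq> q" if "c \<noteq> 1 + q" for c q :: bit
    using that by (cases c; cases q) simp_all
  have closed: "odd_deriv a F \<in> model_carrier n m \<A> V"
    if V: "openin M V" and F: "F \<in> model_carrier n m \<A> V" for V F
  proof -
    have "odd_deriv a F I \<in> smooth_functions n \<A> V" for I
    proof -
      define c where "c = (if a \<in> I then 0 else grassmann_sign {a} I)"
      have "odd_deriv a F I = (\<lambda>x. c * F (insert a I) x)"
        by (auto simp: odd_deriv_def c_def)
      moreover have "F (insert a I) \<in> smooth_functions n \<A> V"
        using F by (simp add: model_carrier_def)
      ultimately show ?thesis
        using C_k_mult[OF openin_chart_image[OF _ V] C_k_const[OF openin_chart_image[OF _ V]], of _ _ _ _ c]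
        by (auto simp: smooth_functions_def C_infinity_def)
    qed
    moreover have "odd_deriv a F I = (\<lambda>x. 0)" if "\<not> I \<subseteq> {..<m}" for I
      using F that by (auto simp: odd_deriv_def model_carrier_def fun_eq_iff)
    ultimately show ?thesis
      by (simp add: model_carrier_def)
  qed
  obtain D where D: "D \<in> superderivations M \<O> B 1"
    "\<And>V f. openin M V \<Longrightarrow> V \<subseteq> B \<Longrightarrow> f \<in> carrier (sections \<O> V) \<Longrightarrow> \<psi> V (D V f) = odd_deriv a (\<psi> V f)"
  proof (rule superderivation_transfer[of "\<lambda>V. odd_deriv a" 1])
    fix V F q assume V: "openin M V" "V \<subseteq> B" and F: "F \<in> homog (sections (model_sheaf n m \<A>) V) q"
    have "odd_deriv a F I = (\<lambda>x. 0)" if I: "of_nat (card I) \<noteq> 1 + q" for I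
    proof (cases "a \<notin> I \<and> finite I")
      case True
      then have "of_nat (card (insert a I)) \<noteq> q"
        using I bit_swap by simp
      then show ?thesis
        using F by (auto simp: odd_deriv_def model_sheaf_simps)
    next
      case False
      then have "a \<in> I \<or> \<not> insert a I \<subseteq> {..<m}"
        using finite_subset[of "insert a I" "{..<m}"] by auto
      moreover have "F (insert a I) x = 0" if "\<not> insert a I \<subseteq> {..<m}" for x
      proof -
        have "F \<in> model_carrier n m \<A> V"
          using F by (simp add: model_sheaf_simps)
        then show ?thesis
          using that by (rule model_carrier_large)
      qed
      ultimately show ?thesis
        by (auto simp: odd_deriv_def fun_eq_iff)
    qed
    then show "odd_deriv a F \<in> homog (sections (model_sheaf n m \<A>) V) (1 + q)"
      using closed[OF V(1)] F by (auto simp: model_sheaf_simps)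
  next
    fix V F G q assume V: "openin M V" "V \<subseteq> B" and F: "F \<in> homog (sections (model_sheaf n m \<A>) V) q"
    have "bit_sign (1 * q) = (- 1) ^ card K" if "F K x \<noteq> 0" for K x
    proof -
      have "of_nat (card K) = q"
        using F that by (auto simp: model_sheaf_simps)
      then show ?thesis
        by (metis bit_sign_of_nat mult_1)
    qed
    then show "odd_deriv a (grassmann_mult F G) = (\<lambda>I x. grassmann_mult (odd_deriv a F) G I x +
        bit_sign (1 * q) * grassmann_mult F (odd_deriv a G) I x)"
      by (intro ext odd_deriv_grassmann_mult)
  qed (use closed in \<open>auto simp: odd_deriv_def fun_eq_iff algebra_simps\<close>)
  then show ?thesis
    using that openin_region by simp
qed

subsection \<open>Evaluation of functions at a point\<close>

text \<open>
  Each factor with vanishing body contributes at least one generator, so the \<open>j\<close>-th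
  power has only coefficients at \<open>\<xi>^I\<close> with \<open>card I \<ge> j\<close>;
  there are \<open>m\<close> generators.
\<close>

lemma triv_nilpotent:
  assumes V: "openin M V" "V \<subseteq> B" and f: "f \<in> carrier (sections \<O> V)" and "\<And>x. \<psi> V f {} x = 0"
  shows "f [^]\<^bsub>sections \<O> V\<^esub> Suc m = \<zero>\<^bsub>sections \<O> V\<^esub>"
proof -
  interpret A: ring "sections \<O> V"
    by (rule ring_sections[OF V(1)])
  have low: "\<psi> V (f [^]\<^bsub>sections \<O> V\<^esub> j) I x = 0" if "finite I" "card I < j" for j I x
    using that
  proof (induction j arbitrary: I)
    case (Suc j)
    have "\<psi> V (f [^]\<^bsub>sections \<O> V\<^esub> j) K x * \<psi> V f (I - K) x = 0" if "K \<subseteq> I" for K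
    proof (cases "K = I")
      case False
      then have "K \<subset> I"
        using that by blast
      then have "card K < card I"
        using Suc.prems by (intro psubset_card_mono)
      then show ?thesis
        using Suc.prems that by (simp add: Suc.IH[of K] finite_subset)
    qed (simp add: assms(4))
    then show ?case
      using f by (auto simp: triv_mult[OF V] grassmann_mult_def mult.assoc intro!: sum.neutral)
  qed simp
  have "\<psi> V (f [^]\<^bsub>sections \<O> V\<^esub> Suc m) I x = 0" for I x
  proof (cases "I \<subseteq> {..<m}")
    case True
    then have "card I < Suc m"
      using card_mono[OF _ True] by simp
    then show ?thesis
      using low finite_subset[OF True] by blast
  next
    case False
    then show ?thesis
      using model_carrier_large[OF triv_closed[OF V]] f by blast
  qed
  then show ?thesis
    using f by (intro triv_inj[OF V]) (auto simp: triv_zero[OF V] fun_eq_iff)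
qed

lemma triv_body_pow:
  assumes V: "openin M V" "V \<subseteq> B" and f: "f \<in> carrier (sections \<O> V)" and x: "x \<in> V"
  shows "\<psi> V (f [^]\<^bsub>sections \<O> V\<^esub> (j::nat)) {} x = \<psi> V f {} x ^ j"
proof -
  interpret A: ring "sections \<O> V"
    by (rule ring_sections[OF V(1)])
  show ?thesis
    using f x by (induction j) (simp_all add: triv_one[OF V] triv_mult[OF V])
qed

end

text \<open>
  Suppose that the body of \<open>h\<close> at \<open>x\<close> is nonzero in the first
  trivialization and zero in the second. The body in the first trivialization has a reciprocal
  near \<open>x\<close>, so that there is a \<open>k\<close> for which \<open>u = k h -
  1\<close> has body 0 in it. Hence \<open>u\<close> is nilpotent, and its body is 0 in every
  trivialization. In the second one, however, the body of \<open>u\<close> at \<open>x\<close>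
  is -1.
\<close>

lemma body_vanishes_independent:
  assumes T: "trivialized_region n m M \<A> \<O> B \<psi>" and T': "trivialized_region n m M \<A> \<O> B' \<psi>'"
    and N: "openin M N" "N \<subseteq> B" "N \<subseteq> B'" and h: "h \<in> carrier (sections \<O> N)" and x: "x \<in> N"
    and zero: "\<psi>' N h {} x = 0"
  shows "\<psi> N h {} x = 0"
proof (rule ccontr)
  assume nonzero: "\<psi> N h {} x \<noteq> 0"
  interpret T: trivialized_region n m M \<A> \<O> B \<psi> by fact
  interpret T': trivialized_region n m M \<A> \<O> B' \<psi>' by fact
  have smooth: "\<psi> N h {} \<in> smooth_functions n \<A> N"
    using T.triv_closed[OF N(1,2) h] by (simp add: model_carrier_def)
  obtain V where V: "openin M V" "x \<in> V" "V \<subseteq> N" and nz': "\<forall>z\<in>V. \<psi> N h {} z \<noteq> 0"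
    using T.smooth_functions_nonzero_nhd[OF N(1) smooth x nonzero] .
  then have nz: "\<psi> N h {} z \<noteq> 0" if "z \<in> V" for z
    using that by simp
  have VB: "V \<subseteq> B" "V \<subseteq> B'"
    using V N by auto
  interpret A: ring "sections \<O> V"
    by (rule T.ring_sections[OF V(1)])
  define H :: "nat set \<Rightarrow> 'a \<Rightarrow> real"
    where "H = (\<lambda>I z. if I = {} \<and> z \<in> V then inverse (\<psi> N h {} z) else 0)"
  have "H \<in> model_carrier n m \<A> V"
  proof -
    have "(\<lambda>z. 0) \<in> smooth_functions n \<A> V"
      using T.triv_closed[OF V(1) VB(1) A.zero_closed]
      by (simp add: T.triv_zero[OF V(1) VB(1)] model_carrier_def)
    moreover have "H I = (if I = {} then (\<lambda>z. if z \<in> V then inverse (\<psi> N h {} z) else 0) else (\<lambda>z. 0))" for I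
      by (auto simp: H_def)
    ultimately show ?thesis
      using T.smooth_functions_inverse[OF N(1) V(1,3) smooth nz] by (simp add: model_carrier_def)
  qed
  then obtain k where k: "k \<in> carrier (sections \<O> V)" "\<psi> V k = H"
    using T.triv_surj[OF V(1) VB(1)] by blast
  define h' where "h' = restr \<O> N V h"
  have h': "h' \<in> carrier (sections \<O> V)"
    using T.restr_closed[OF N(1) V(1,3) h] by (simp add: h'_def)
  define u where "u = k \<otimes>\<^bsub>sections \<O> V\<^esub> h' \<oplus>\<^bsub>sections \<O> V\<^esub> \<ominus>\<^bsub>sections \<O> V\<^esub> \<one>\<^bsub>sections \<O> V\<^esub>"
  have u: "u \<in> carrier (sections \<O> V)"
    using k h' by (simp add: u_def)
  have "\<psi> V u {} z = 0" for z
    using k h' nz[of z] T.triv_restr[OF N(1) V(1,3) N(2) h]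
    by (auto simp: u_def T.triv_add[OF V(1) VB(1)] T.triv_mult[OF V(1) VB(1)] T.triv_one[OF V(1) VB(1)]
        T.triv_minus[OF V(1) VB(1)] H_def h'_def)
  then have "u [^]\<^bsub>sections \<O> V\<^esub> Suc m = \<zero>\<^bsub>sections \<O> V\<^esub>"
    by (rule T.triv_nilpotent[OF V(1) VB(1) u])
  then have "\<psi>' V u {} x ^ Suc m = 0"
    using T'.triv_body_pow[OF V(1) VB(2) u V(2), of "Suc m"] T'.triv_zero[OF V(1) VB(2)] by simp
  then have "\<psi>' V u {} x = 0"
    by auto
  moreover have "\<psi>' V u {} x = - 1"
    using k h' V(2) zero T'.triv_restr[OF N(1) V(1,3) N(3) h]
    by (simp add: u_def T'.triv_add[OF V(1) VB(2)] T'.triv_mult[OF V(1) VB(2)] T'.triv_one[OF V(1) VB(2)]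
        T'.triv_minus[OF V(1) VB(2)] h'_def)
  ultimately show False
    by simp
qed

text \<open>
  Subtract a constant from \<open>f\<close> to make the body at \<open>x\<close> vanish in one
  of the trivializations.
\<close>

lemma body_independent:
  assumes T: "trivialized_region n m M \<A> \<O> B \<psi>" and T': "trivialized_region n m M \<A> \<O> B' \<psi>'"
    and U: "openin M U" "B \<subseteq> U" "B' \<subseteq> U" and f: "f \<in> carrier (sections \<O> U)"
    and x: "x \<in> B" "x \<in> B'"
  shows "\<psi> B (restr \<O> U B f) {} x = \<psi>' B' (restr \<O> U B' f) {} x"
proof -
  interpret T: trivialized_region n m M \<A> \<O> B \<psi> by fact
  interpret T': trivialized_region n m M \<A> \<O> B' \<psi>' by fact
  define N where "N = B \<inter> B'"
  have N: "openin M N" "N \<subseteq> B" "N \<subseteq> B'" "x \<in> N" and NU: "N \<subseteq> U"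
    using T.openin_region T'.openin_region x U by (auto simp: N_def)
  interpret A: ring "sections \<O> N"
    by (rule T.ring_sections[OF N(1)])
  define g where "g = restr \<O> U N f"
  have g: "g \<in> carrier (sections \<O> N)"
    using T.restr_closed[OF U(1) N(1) NU f] by (simp add: g_def)
  have "g = restr \<O> B N (restr \<O> U B f)" "g = restr \<O> B' N (restr \<O> U B' f)"
    using T.restr_restr[OF U(1) T.openin_region N(1,2) U(2) f]
      T.restr_restr[OF U(1) T'.openin_region N(1,3) U(3) f] by (simp_all add: g_def)
  then have eq: "\<psi> B (restr \<O> U B f) {} x = \<psi> N g {} x" "\<psi>' B' (restr \<O> U B' f) {} x = \<psi>' N g {} x"
    using N(4) T.triv_restr[OF T.openin_region N(1,2) order_refl T.restr_closed[OF U(1) T.openin_region U(2) f]]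
      T'.triv_restr[OF T'.openin_region N(1,3) order_refl T.restr_closed[OF U(1) T'.openin_region U(3) f]]
    by simp_all
  define r where "r = \<psi>' N g {} x"
  have r1: "r \<odot>\<^bsub>sections \<O> N\<^esub> \<one>\<^bsub>sections \<O> N\<^esub> \<in> carrier (sections \<O> N)"
    using T.real_smult_closed[OF N(1)] by simp
  define h where "h = g \<oplus>\<^bsub>sections \<O> N\<^esub> \<ominus>\<^bsub>sections \<O> N\<^esub> (r \<odot>\<^bsub>sections \<O> N\<^esub> \<one>\<^bsub>sections \<O> N\<^esub>)"
  have h: "h \<in> carrier (sections \<O> N)"
    using g r1 by (simp add: h_def)
  have "\<psi>' N h {} x = \<psi>' N g {} x - r"
    using g r1 N(4) by (simp add: h_def T'.triv_add[OF N(1,3)] T'.triv_minus[OF N(1,3)]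
        T'.triv_smult[OF N(1,3)] T'.triv_one[OF N(1,3)])
  then have "\<psi> N h {} x = 0"
    by (intro body_vanishes_independent[OF T T' N(1,2,3) h N(4)]) (simp add: r_def)
  moreover have "\<psi> N h {} x = \<psi> N g {} x - r"
    using g r1 N(4) by (simp add: h_def T.triv_add[OF N(1,2)] T.triv_minus[OF N(1,2)]
        T.triv_smult[OF N(1,2)] T.triv_one[OF N(1,2)])
  ultimately show ?thesis
    by (simp add: eq r_def)
qed

lemma (in trivialized_region) body_eq:
  assumes U: "openin M U" "B \<subseteq> U" and f: "f \<in> carrier (sections \<O> U)" and x: "x \<in> B"
  shows "body n m M \<A> \<O> U f x = \<psi> B (restr \<O> U B f) {} x"
proof -
  have "(THE c. \<exists>B' \<psi>'. local_trivialization n m M \<A> \<O> B' \<psi>' \<and> x \<in> B' \<and> B' \<subseteq> U \<and>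
      c = \<psi>' B' (restr \<O> U B' f) {} x) = \<psi> B (restr \<O> U B f) {} x"
  proof (rule the_equality)
    show "\<exists>B' \<psi>'. local_trivialization n m M \<A> \<O> B' \<psi>' \<and> x \<in> B' \<and> B' \<subseteq> U \<and>
      \<psi> B (restr \<O> U B f) {} x = \<psi>' B' (restr \<O> U B' f) {} x"
      using trivialization x U by blast
    fix c
    assume "\<exists>B' \<psi>'. local_trivialization n m M \<A> \<O> B' \<psi>' \<and> x \<in> B' \<and> B' \<subseteq> U \<and>
      c = \<psi>' B' (restr \<O> U B' f) {} x"
    then obtain B' \<psi>' where B': "local_trivialization n m M \<A> \<O> B' \<psi>'" "x \<in> B'" "B' \<subseteq> U"
      "c = \<psi>' B' (restr \<O> U B' f) {} x"
      by blast
    have "trivialized_region n m M \<A> \<O> B' \<psi>'"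
      using B'(1) by (intro trivialized_region.intro trivialized_region_axioms.intro supermanifold_axioms)
    from body_independent[OF this trivialized_region_axioms U(1) B'(3) U(2) f B'(2) x] B'(4)
    show "c = \<psi> B (restr \<O> U B f) {} x"
      by simp
  qed
  then show ?thesis
    using x U by (auto simp: body_def)
qed

section \<open>Linear algebra of sections\<close>

text \<open>
  Restriction maps, scalar multiplications and the connection are treated uniformly as additive
  maps between abelian groups.
\<close>

lemma additive_map_zero:
  assumes "abelian_group G" "abelian_group H" "h \<in> carrier G \<rightarrow> carrier H"
    and "\<And>a b. a \<in> carrier G \<Longrightarrow> b \<in> carrier G \<Longrightarrow> h (a \<oplus>\<^bsub>G\<^esub> b) = h a \<oplus>\<^bsub>H\<^esub> h b"
  shows "h \<zero>\<^bsub>G\<^esub> = \<zero>\<^bsub>H\<^esub>"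
proof -
  interpret G: abelian_group G by fact
  interpret H: abelian_group H by fact
  have c: "h \<zero>\<^bsub>G\<^esub> \<in> carrier H"
    using assms(3) by auto
  have "h \<zero>\<^bsub>G\<^esub> \<oplus>\<^bsub>H\<^esub> h \<zero>\<^bsub>G\<^esub> = h \<zero>\<^bsub>G\<^esub> \<oplus>\<^bsub>H\<^esub> \<zero>\<^bsub>H\<^esub>"
    using assms(4)[of "\<zero>\<^bsub>G\<^esub>" "\<zero>\<^bsub>G\<^esub>"] c by simp
  then show ?thesis
    using c by (simp only: H.add.l_cancel H.zero_closed)
qed

lemma additive_map_minus:
  assumes "abelian_group G" "abelian_group H" "h \<in> carrier G \<rightarrow> carrier H"
    and "\<And>a b. a \<in> carrier G \<Longrightarrow> b \<in> carrier G \<Longrightarrow> h (a \<oplus>\<^bsub>G\<^esub> b) = h a \<oplus>\<^bsub>H\<^esub> h b"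
    and "a \<in> carrier G"
  shows "h (\<ominus>\<^bsub>G\<^esub> a) = \<ominus>\<^bsub>H\<^esub> h a"
proof -
  interpret G: abelian_group G by fact
  interpret H: abelian_group H by fact
  have c: "h a \<in> carrier H" "h (\<ominus>\<^bsub>G\<^esub> a) \<in> carrier H"
    using assms(3,5) by auto
  have "h (\<ominus>\<^bsub>G\<^esub> a) \<oplus>\<^bsub>H\<^esub> h a = h \<zero>\<^bsub>G\<^esub>"
    using assms(4)[of "\<ominus>\<^bsub>G\<^esub> a" a] assms(5) by (simp add: G.l_neg)
  also have "\<dots> = \<zero>\<^bsub>H\<^esub>"
    by (rule additive_map_zero[OF assms(1-4)])
  finally show ?thesis
    using c by (intro H.minus_equality[symmetric])
qed

lemma additive_map_finsum:
  assumes "abelian_group G" "abelian_group H" "h \<in> carrier G \<rightarrow> carrier H"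
    and "\<And>a b. a \<in> carrier G \<Longrightarrow> b \<in> carrier G \<Longrightarrow> h (a \<oplus>\<^bsub>G\<^esub> b) = h a \<oplus>\<^bsub>H\<^esub> h b"
    and "finite I" "s \<in> I \<rightarrow> carrier G"
  shows "h (finsum G s I) = (\<Oplus>\<^bsub>H\<^esub> i\<in>I. h (s i))"
proof -
  interpret G: abelian_group G by fact
  interpret H: abelian_group H by fact
  show ?thesis
    using assms(5,6)
  proof (induction I rule: finite_induct)
    case empty
    show ?case
      using additive_map_zero[OF assms(1-4)] by simp
  next
    case (insert i I)
    have s: "s \<in> I \<rightarrow> carrier G" "s i \<in> carrier G"
      using insert.prems by auto
    have hs: "(\<lambda>i. h (s i)) \<in> I \<rightarrow> carrier H" "h (s i) \<in> carrier H"
      using s assms(3) by auto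
    show ?case
      using insert.hyps insert.IH[OF s(1)] s hs assms(4)[OF s(2) G.finsum_closed[OF s(1)]]
      by (simp add: G.finsum_insert H.finsum_insert)
  qed
qed

lemma additive_functional_finsum:
  fixes h :: "_ \<Rightarrow> real"
  assumes "abelian_group G"
    and add: "\<And>a b. a \<in> carrier G \<Longrightarrow> b \<in> carrier G \<Longrightarrow> h (a \<oplus>\<^bsub>G\<^esub> b) = h a + h b"
    and "finite I" "s \<in> I \<rightarrow> carrier G"
  shows "h (finsum G s I) = (\<Sum>i\<in>I. h (s i))"
proof -
  interpret G: abelian_group G by fact
  show ?thesis
    using assms(3,4)
  proof (induction I rule: finite_induct)
    case empty
    show ?case
      using add[of "\<zero>\<^bsub>G\<^esub>" "\<zero>\<^bsub>G\<^esub>"] by simp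
  next
    case (insert i I)
    have s: "s \<in> I \<rightarrow> carrier G" "s i \<in> carrier G"
      using insert.prems by auto
    show ?case
      using insert.hyps insert.IH[OF s(1)] s add[OF s(2) G.finsum_closed[OF s(1)]]
      by (simp add: G.finsum_insert)
  qed
qed

lemma (in sheaf_of_super_groups) abelian_group_sections:
  "openin M U \<Longrightarrow> abelian_group (sections F U)"
  using super_group_sections super_group.axioms(1) by blast

lemma (in sheaf_of_super_groups) homog_sections_closed:
  "openin M U \<Longrightarrow> s \<in> homog (sections F U) a \<Longrightarrow> s \<in> carrier (sections F U)"
  using super_group.homog_subgroup[OF super_group_sections] additive_subgroup.a_subset by blast

context sheaf_of_supermodules
begin

context
  fixes V assumes V: "openin M V"
begin

lemmas smult_sections =
  left_supermodule.smult_closed[OF supermodule_sections[OF V]]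
  left_supermodule.smult_l_distr[OF supermodule_sections[OF V]]
  left_supermodule.smult_r_distr[OF supermodule_sections[OF V]]
  left_supermodule.smult_assoc[OF supermodule_sections[OF V]]

lemma ring_group: "abelian_group (sections \<O> V)"
  by (rule \<O>.abelian_group_sections[OF V])

lemma smult_zero_left:
  assumes "u \<in> carrier (sections \<E> V)"
  shows "\<zero>\<^bsub>sections \<O> V\<^esub> \<odot>\<^bsub>sections \<E> V\<^esub> u = \<zero>\<^bsub>sections \<E> V\<^esub>"
  by (rule additive_map_zero[OF ring_group \<E>.abelian_group_sections[OF V], where h = "\<lambda>f. f \<odot>\<^bsub>sections \<E> V\<^esub> u"])
     (use assms smult_sections in auto)

lemma smult_minus_left:
  assumes "f \<in> carrier (sections \<O> V)" "u \<in> carrier (sections \<E> V)"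
  shows "(\<ominus>\<^bsub>sections \<O> V\<^esub> f) \<odot>\<^bsub>sections \<E> V\<^esub> u = \<ominus>\<^bsub>sections \<E> V\<^esub> (f \<odot>\<^bsub>sections \<E> V\<^esub> u)"
  by (rule additive_map_minus[OF ring_group \<E>.abelian_group_sections[OF V], where h = "\<lambda>f. f \<odot>\<^bsub>sections \<E> V\<^esub> u"])
     (use assms smult_sections in auto)

lemma smult_super_sign_left:
  assumes "f \<in> carrier (sections \<O> V)" "u \<in> carrier (sections \<E> V)"
  shows "super_sign (sections \<O> V) a f \<odot>\<^bsub>sections \<E> V\<^esub> u =
    super_sign (sections \<E> V) a (f \<odot>\<^bsub>sections \<E> V\<^esub> u)"
  using assms by (simp add: super_sign_def smult_minus_left)

lemma smult_finsum:
  assumes "f \<in> carrier (sections \<O> V)" "finite I" "s \<in> I \<rightarrow> carrier (sections \<E> V)"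
  shows "f \<odot>\<^bsub>sections \<E> V\<^esub> finsum (sections \<E> V) s I =
    (\<Oplus>\<^bsub>sections \<E> V\<^esub> i\<in>I. f \<odot>\<^bsub>sections \<E> V\<^esub> s i)"
  by (rule additive_map_finsum[OF \<E>.abelian_group_sections[OF V] \<E>.abelian_group_sections[OF V]])
     (use assms smult_sections in auto)

end

lemma restr_finsum:
  assumes "openin M U" "openin M V" "V \<subseteq> U" "finite I" "s \<in> I \<rightarrow> carrier (sections \<E> U)"
  shows "restr \<E> U V (finsum (sections \<E> U) s I) = (\<Oplus>\<^bsub>sections \<E> V\<^esub> i\<in>I. restr \<E> U V (s i))"
  by (rule additive_map_finsum[OF \<E>.abelian_group_sections \<E>.abelian_group_sections])
     (use assms \<E>.restr_closed \<E>.restr_add in auto)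

end

subsection \<open>Coefficients with respect to a frame\<close>

locale framed_region =
  trivialized_region n m M \<A> \<O> B \<psi> + sheaf_of_supermodules M \<O> \<E>
  for n m :: nat and M :: "'a topology" and \<A> :: "'a chart set"
    and \<O> :: "('a, real, 's) super_sheaf" and B :: "'a set"
    and \<psi> :: "'a set \<Rightarrow> 's \<Rightarrow> nat set \<Rightarrow> 'a \<Rightarrow> real"
    and \<E> :: "('a, 's, 'e) super_sheaf" +
  fixes U :: "'a set" and p q :: nat and e :: "nat \<Rightarrow> 'e"
  assumes frame: "local_frame M \<O> \<E> U p q e" and region_subset: "B \<subseteq> U"
begin

lemma openin_U: "openin M U"
  using frame by (simp add: local_frame_def)

lemma frame_homog_U: "i < p + q \<Longrightarrow> \<exists>a. e i \<in> homog (sections \<E> U) a"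
  using frame by (cases "i < p") (auto simp: local_frame_def)

lemma frame_carrier_U: "i < p + q \<Longrightarrow> e i \<in> carrier (sections \<E> U)"
  using frame_homog_U \<E>.homog_sections_closed[OF openin_U] by blast

lemma frame_carrier:
  assumes "openin M V" "V \<subseteq> U" "i < p + q"
  shows "restr \<E> U V (e i) \<in> carrier (sections \<E> V)"
  by (rule \<E>.restr_closed[OF openin_U assms(1,2) frame_carrier_U[OF assms(3)]])

lemma frame_homog:
  assumes "i < p + q"
  obtains a where "restr \<E> U B (e i) \<in> homog (sections \<E> B) a"
  using frame_homog_U[OF assms] \<E>.restr_homog[OF openin_U openin_region region_subset] by blast

text \<open>
  The frame isomorphism over \<open>V\<close>.
\<close>

definition comb :: "'a set \<Rightarrow> (nat \<Rightarrow> 's) \<Rightarrow> 'e" where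
  "comb V c = (\<Oplus>\<^bsub>sections \<E> V\<^esub> i \<in> {..<p + q}. c i \<odot>\<^bsub>sections \<E> V\<^esub> restr \<E> U V (e i))"

lemma comb_bij:
  assumes "openin M V" "V \<subseteq> U"
  shows "bij_betw (comb V) ({..<p + q} \<rightarrow>\<^sub>E carrier (sections \<O> V)) (carrier (sections \<E> V))"
  using frame assms unfolding local_frame_def comb_def by blast

lemma summand_closed:
  assumes "openin M V" "V \<subseteq> U" "c \<in> {..<p + q} \<rightarrow> carrier (sections \<O> V)"
  shows "(\<lambda>i. c i \<odot>\<^bsub>sections \<E> V\<^esub> restr \<E> U V (e i)) \<in> {..<p + q} \<rightarrow> carrier (sections \<E> V)"
  using assms(3) frame_carrier[OF assms(1,2)] smult_sections(1)[OF assms(1)] by auto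

lemma comb_cong:
  assumes V: "openin M V" "V \<subseteq> U" and c: "c \<in> {..<p + q} \<rightarrow> carrier (sections \<O> V)"
    and eq: "\<And>i. i < p + q \<Longrightarrow> c i = c' i"
  shows "comb V c = comb V c'"
proof -
  interpret E: abelian_group "sections \<E> V"
    by (rule \<E>.abelian_group_sections[OF V(1)])
  show ?thesis
    unfolding comb_def
  proof (rule E.finsum_cong'[OF refl])
    show "(\<lambda>i. c' i \<odot>\<^bsub>sections \<E> V\<^esub> restr \<E> U V (e i)) \<in> {..<p + q} \<rightarrow> carrier (sections \<E> V)"
      using c by (intro summand_closed[OF V]) (simp add: Pi_iff flip: eq)
  qed (simp add: eq)
qed

lemma comb_add:
  assumes V: "openin M V" "V \<subseteq> U" and c: "c \<in> {..<p + q} \<rightarrow> carrier (sections \<O> V)"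
    and d: "d \<in> {..<p + q} \<rightarrow> carrier (sections \<O> V)"
  shows "comb V (\<lambda>i. c i \<oplus>\<^bsub>sections \<O> V\<^esub> d i) = comb V c \<oplus>\<^bsub>sections \<E> V\<^esub> comb V d"
proof -
  interpret E: abelian_group "sections \<E> V"
    by (rule \<E>.abelian_group_sections[OF V(1)])
  have "comb V c \<oplus>\<^bsub>sections \<E> V\<^esub> comb V d = (\<Oplus>\<^bsub>sections \<E> V\<^esub> i \<in> {..<p + q}.
      c i \<odot>\<^bsub>sections \<E> V\<^esub> restr \<E> U V (e i) \<oplus>\<^bsub>sections \<E> V\<^esub> d i \<odot>\<^bsub>sections \<E> V\<^esub> restr \<E> U V (e i))"
    unfolding comb_def by (rule E.finsum_addf[OF summand_closed[OF V c] summand_closed[OF V d], symmetric])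
  also have "\<dots> = comb V (\<lambda>i. c i \<oplus>\<^bsub>sections \<O> V\<^esub> d i)"
    unfolding comb_def
  proof (rule E.finsum_cong'[OF refl])
    have "c i \<oplus>\<^bsub>sections \<O> V\<^esub> d i \<in> carrier (sections \<O> V)" if "i < p + q" for i
      using c d that abelian_group.axioms(1)[OF abelian_group_sections[OF V(1)]]
        abelian_monoid.a_closed by fastforce
    then show "(\<lambda>i. (c i \<oplus>\<^bsub>sections \<O> V\<^esub> d i) \<odot>\<^bsub>sections \<E> V\<^esub> restr \<E> U V (e i))
        \<in> {..<p + q} \<rightarrow> carrier (sections \<E> V)"
      by (intro summand_closed[OF V]) auto
  next
    fix i assume "i \<in> {..<p + q}"
    then show "c i \<odot>\<^bsub>sections \<E> V\<^esub> restr \<E> U V (e i) \<oplus>\<^bsub>sections \<E> V\<^esub> d i \<odot>\<^bsub>sections \<E> V\<^esub> restr \<E> U V (e i) =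
        (c i \<oplus>\<^bsub>sections \<O> V\<^esub> d i) \<odot>\<^bsub>sections \<E> V\<^esub> restr \<E> U V (e i)"
      using c d frame_carrier[OF V] smult_sections(2)[OF V(1)] by (auto simp: Pi_iff)
  qed
  finally show ?thesis
    by simp
qed

lemma comb_smult:
  assumes V: "openin M V" "V \<subseteq> U" and c: "c \<in> {..<p + q} \<rightarrow> carrier (sections \<O> V)"
    and g: "g \<in> carrier (sections \<O> V)"
  shows "comb V (\<lambda>i. g \<otimes>\<^bsub>sections \<O> V\<^esub> c i) = g \<odot>\<^bsub>sections \<E> V\<^esub> comb V c"
proof -
  interpret A: ring "sections \<O> V"
    by (rule ring_sections[OF V(1)])
  interpret E: abelian_group "sections \<E> V"
    by (rule \<E>.abelian_group_sections[OF V(1)])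
  have "g \<odot>\<^bsub>sections \<E> V\<^esub> comb V c = (\<Oplus>\<^bsub>sections \<E> V\<^esub> i \<in> {..<p + q}.
      g \<odot>\<^bsub>sections \<E> V\<^esub> (c i \<odot>\<^bsub>sections \<E> V\<^esub> restr \<E> U V (e i)))"
    unfolding comb_def by (rule smult_finsum[OF V(1) g _ summand_closed[OF V c]]) simp
  also have "\<dots> = comb V (\<lambda>i. g \<otimes>\<^bsub>sections \<O> V\<^esub> c i)"
    unfolding comb_def
  proof (rule E.finsum_cong'[OF refl])
    show "(\<lambda>i. (g \<otimes>\<^bsub>sections \<O> V\<^esub> c i) \<odot>\<^bsub>sections \<E> V\<^esub> restr \<E> U V (e i))
        \<in> {..<p + q} \<rightarrow> carrier (sections \<E> V)"
      using c g by (intro summand_closed[OF V]) auto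
  next
    fix i assume "i \<in> {..<p + q}"
    then show "g \<odot>\<^bsub>sections \<E> V\<^esub> (c i \<odot>\<^bsub>sections \<E> V\<^esub> restr \<E> U V (e i)) =
        (g \<otimes>\<^bsub>sections \<O> V\<^esub> c i) \<odot>\<^bsub>sections \<E> V\<^esub> restr \<E> U V (e i)"
      using c g frame_carrier[OF V] smult_sections(4)[OF V(1)] by (auto simp: Pi_iff)
  qed
  finally show ?thesis
    by simp
qed

lemma comb_inj:
  assumes V: "openin M V" "V \<subseteq> U" and c: "c \<in> {..<p + q} \<rightarrow> carrier (sections \<O> V)"
    and d: "d \<in> {..<p + q} \<rightarrow> carrier (sections \<O> V)" and eq: "comb V c = comb V d" and j: "j < p + q"
  shows "c j = d j"
proof -
  have "comb V (restrict c {..<p + q}) = comb V c" "comb V (restrict d {..<p + q}) = comb V d"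
    using c d by (auto intro!: comb_cong[OF V])
  then have "restrict c {..<p + q} = restrict d {..<p + q}"
    using c d eq by (intro inj_onD[OF bij_betw_imp_inj_on[OF comb_bij[OF V]]]) auto
  then show ?thesis
    using j by (metis lessThan_iff restrict_apply')
qed

lemma comb_zero:
  assumes V: "openin M V" "V \<subseteq> U"
  shows "comb V (\<lambda>i. \<zero>\<^bsub>sections \<O> V\<^esub>) = \<zero>\<^bsub>sections \<E> V\<^esub>"
proof -
  interpret E: abelian_group "sections \<E> V"
    by (rule \<E>.abelian_group_sections[OF V(1)])
  have "comb V (\<lambda>i. \<zero>\<^bsub>sections \<O> V\<^esub>) = (\<Oplus>\<^bsub>sections \<E> V\<^esub> i \<in> {..<p + q}. \<zero>\<^bsub>sections \<E> V\<^esub>)"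
    unfolding comb_def
    by (rule E.finsum_cong'[OF refl]) (use smult_zero_left[OF V(1)] frame_carrier[OF V] in auto)
  also have "\<dots> = \<zero>\<^bsub>sections \<E> V\<^esub>"
    by (rule E.finsum_zero)
  finally show ?thesis .
qed

lemma restr_comb:
  assumes V: "openin M V" "V \<subseteq> B" and c: "c \<in> {..<p + q} \<rightarrow> carrier (sections \<O> B)"
  shows "restr \<E> B V (comb B c) = comb V (\<lambda>i. restr \<O> B V (c i))"
proof -
  interpret E: abelian_group "sections \<E> V"
    by (rule \<E>.abelian_group_sections[OF V(1)])
  have VU: "V \<subseteq> U"
    using V region_subset by blast
  have "restr \<E> B V (comb B c) = (\<Oplus>\<^bsub>sections \<E> V\<^esub> i \<in> {..<p + q}.
      restr \<E> B V (c i \<odot>\<^bsub>sections \<E> B\<^esub> restr \<E> U B (e i)))"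
    unfolding comb_def
    by (rule restr_finsum[OF openin_region V _ summand_closed[OF openin_region region_subset c]]) simp
  also have "\<dots> = comb V (\<lambda>i. restr \<O> B V (c i))"
    unfolding comb_def
  proof (rule E.finsum_cong'[OF refl])
    show "(\<lambda>i. restr \<O> B V (c i) \<odot>\<^bsub>sections \<E> V\<^esub> restr \<E> U V (e i))
        \<in> {..<p + q} \<rightarrow> carrier (sections \<E> V)"
      using c by (intro summand_closed[OF V(1) VU]) (auto intro: restr_closed[OF openin_region V])
  next
    fix i assume "i \<in> {..<p + q}"
    then have i: "i < p + q"
      by simp
    show "restr \<E> B V (c i \<odot>\<^bsub>sections \<E> B\<^esub> restr \<E> U B (e i)) =
        restr \<O> B V (c i) \<odot>\<^bsub>sections \<E> V\<^esub> restr \<E> U V (e i)"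
      using c i restr_smult[OF openin_region V _ frame_carrier[OF openin_region region_subset i]]
        \<E>.restr_restr[OF openin_U openin_region V(1) V(2) region_subset frame_carrier_U[OF i]]
      by (auto simp: Pi_iff)
  qed
  finally show ?thesis .
qed

text \<open>
  The coefficients of a section over \<open>B\<close>, as real functions: the function
  multiplying \<open>\<xi>^I\<close> in the coefficient at the frame element \<open>e_j\<close>.
\<close>

definition coeff :: "'e \<Rightarrow> nat \<Rightarrow> nat set \<Rightarrow> 'a \<Rightarrow> real" where
  "coeff u j = \<psi> B (inv_into ({..<p + q} \<rightarrow>\<^sub>E carrier (sections \<O> B)) (comb B) u j)"

lemma coeff_comb:
  assumes c: "c \<in> {..<p + q} \<rightarrow> carrier (sections \<O> B)" and j: "j < p + q"
  shows "coeff (comb B c) j = \<psi> B (c j)"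
proof -
  have "comb B c = comb B (restrict c {..<p + q})"
    using c by (auto intro!: comb_cong[OF openin_region region_subset])
  moreover have "restrict c {..<p + q} \<in> {..<p + q} \<rightarrow>\<^sub>E carrier (sections \<O> B)"
    using c by auto
  ultimately show ?thesis
    using j bij_betw_imp_inj_on[OF comb_bij[OF openin_region region_subset]]
    by (simp add: coeff_def)
qed

lemma expand:
  assumes "u \<in> carrier (sections \<E> B)"
  obtains c where "c \<in> {..<p + q} \<rightarrow> carrier (sections \<O> B)" "u = comb B c"
    "\<forall>j<p + q. coeff u j = \<psi> B (c j)"
proof -
  have "u \<in> comb B ` ({..<p + q} \<rightarrow>\<^sub>E carrier (sections \<O> B))"
    using assms by (simp only: bij_betw_imp_surj_on[OF comb_bij[OF openin_region region_subset]])
  then obtain c where c: "c \<in> {..<p + q} \<rightarrow>\<^sub>E carrier (sections \<O> B)" "u = comb B c"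
    by blast
  then have "c \<in> {..<p + q} \<rightarrow> carrier (sections \<O> B)"
    by auto
  with c(2) show thesis
    using coeff_comb by (intro that[of c]) auto
qed

lemma coeff_model:
  assumes "u \<in> carrier (sections \<E> B)" "j < p + q"
  shows "coeff u j \<in> model_carrier n m \<A> B"
proof -
  obtain c where c: "c \<in> {..<p + q} \<rightarrow> carrier (sections \<O> B)" "\<forall>j<p + q. coeff u j = \<psi> B (c j)"
    using expand[OF assms(1)] by blast
  then show ?thesis
    using triv_closed[OF openin_region order_refl, of "c j"] assms(2) by auto
qed

lemma coeff_add:
  assumes u: "u \<in> carrier (sections \<E> B)" and v: "v \<in> carrier (sections \<E> B)" and j: "j < p + q"
  shows "coeff (u \<oplus>\<^bsub>sections \<E> B\<^esub> v) j I x = coeff u j I x + coeff v j I x"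
proof -
  interpret A: ring "sections \<O> B"
    by (rule ring_sections[OF openin_region])
  obtain c where c: "c \<in> {..<p + q} \<rightarrow> carrier (sections \<O> B)" "u = comb B c"
      "\<forall>j<p + q. coeff u j = \<psi> B (c j)"
    using expand[OF u] .
  obtain d where d: "d \<in> {..<p + q} \<rightarrow> carrier (sections \<O> B)" "v = comb B d"
      "\<forall>j<p + q. coeff v j = \<psi> B (d j)"
    using expand[OF v] .
  have cd: "c j \<in> carrier (sections \<O> B)" "d j \<in> carrier (sections \<O> B)"
    using c(1) d(1) j by auto
  have "coeff (u \<oplus>\<^bsub>sections \<E> B\<^esub> v) j = \<psi> B (c j \<oplus>\<^bsub>sections \<O> B\<^esub> d j)"
    using c d j comb_add[OF openin_region region_subset c(1) d(1)]
      coeff_comb[of "\<lambda>i. c i \<oplus>\<^bsub>sections \<O> B\<^esub> d i" j] by (auto simp: Pi_iff)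
  then show ?thesis
    using c(3) d(3) j triv_add[OF openin_region order_refl cd] by simp
qed

lemma coeff_smult:
  assumes g: "g \<in> carrier (sections \<O> B)" and u: "u \<in> carrier (sections \<E> B)" and j: "j < p + q"
  shows "coeff (g \<odot>\<^bsub>sections \<E> B\<^esub> u) j = grassmann_mult (\<psi> B g) (coeff u j)"
proof -
  interpret A: ring "sections \<O> B"
    by (rule ring_sections[OF openin_region])
  obtain c where c: "c \<in> {..<p + q} \<rightarrow> carrier (sections \<O> B)" "u = comb B c"
      "\<forall>j<p + q. coeff u j = \<psi> B (c j)"
    using expand[OF u] .
  have "coeff (g \<odot>\<^bsub>sections \<E> B\<^esub> u) j = \<psi> B (g \<otimes>\<^bsub>sections \<O> B\<^esub> c j)"
    using c g j comb_smult[OF openin_region region_subset c(1) g]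
      coeff_comb[of "\<lambda>i. g \<otimes>\<^bsub>sections \<O> B\<^esub> c i" j] by (auto simp: Pi_iff)
  then show ?thesis
    using c(1,3) g j triv_mult[OF openin_region order_refl g, of "c j"] by auto
qed

lemma coeff_zero:
  assumes "j < p + q"
  shows "coeff \<zero>\<^bsub>sections \<E> B\<^esub> j I x = 0"
proof -
  interpret E: abelian_group "sections \<E> B"
    by (rule \<E>.abelian_group_sections[OF openin_region])
  show ?thesis
    using coeff_add[OF E.zero_closed E.zero_closed assms, of I x] by simp
qed

lemma coeff_diff:
  assumes u: "u \<in> carrier (sections \<E> B)" and v: "v \<in> carrier (sections \<E> B)" and j: "j < p + q"
  shows "coeff (u \<ominus>\<^bsub>sections \<E> B\<^esub> v) j I x = coeff u j I x - coeff v j I x"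
proof -
  interpret E: abelian_group "sections \<E> B"
    by (rule \<E>.abelian_group_sections[OF openin_region])
  have "u = (u \<ominus>\<^bsub>sections \<E> B\<^esub> v) \<oplus>\<^bsub>sections \<E> B\<^esub> v"
    using u v by (simp add: E.minus_eq E.a_assoc E.l_neg)
  then have "coeff u j I x = coeff (u \<ominus>\<^bsub>sections \<E> B\<^esub> v) j I x + coeff v j I x"
    using coeff_add[of "u \<ominus>\<^bsub>sections \<E> B\<^esub> v" v j I x] u v j by (metis E.minus_closed)
  then show ?thesis
    by simp
qed

lemma coeff_finsum:
  assumes "j < p + q" "finite K" "s \<in> K \<rightarrow> carrier (sections \<E> B)"
  shows "coeff (finsum (sections \<E> B) s K) j I x = (\<Sum>k\<in>K. coeff (s k) j I x)"
  by (rule additive_functional_finsum[OF \<E>.abelian_group_sections[OF openin_region],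
        where h = "\<lambda>u. coeff u j I x"])
     (use assms coeff_add in auto)

lemma coeff_all_zero:
  assumes u: "u \<in> carrier (sections \<E> B)" and zero: "\<And>j I x. j < p + q \<Longrightarrow> coeff u j I x = 0"
  shows "u = \<zero>\<^bsub>sections \<E> B\<^esub>"
proof -
  interpret A: ring "sections \<O> B"
    by (rule ring_sections[OF openin_region])
  obtain c where c: "c \<in> {..<p + q} \<rightarrow> carrier (sections \<O> B)" "u = comb B c"
      "\<forall>j<p + q. coeff u j = \<psi> B (c j)"
    using expand[OF u] .
  have "c j = \<zero>\<^bsub>sections \<O> B\<^esub>" if j: "j < p + q" for j
  proof (rule triv_inj[OF openin_region order_refl _ A.zero_closed])
    show "c j \<in> carrier (sections \<O> B)"
      using c(1) j by auto
    show "\<psi> B (c j) = \<psi> B \<zero>\<^bsub>sections \<O> B\<^esub>"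
      using c(3) j zero[OF j] by (simp add: triv_zero[OF openin_region order_refl] fun_eq_iff)
  qed
  then have "comb B c = comb B (\<lambda>i. \<zero>\<^bsub>sections \<O> B\<^esub>)"
    by (intro comb_cong[OF openin_region region_subset c(1)])
  then show ?thesis
    using c(2) comb_zero[OF openin_region region_subset] by simp
qed

text \<open>
  The frame restricts to a frame over \<open>V\<close>, so the coefficients of the restricted
  section are the restricted coefficients; those of 0 are 0.
\<close>

lemma coeff_local:
  assumes V: "openin M V" "V \<subseteq> B" and u: "u \<in> carrier (sections \<E> B)"
    and zero: "restr \<E> B V u = \<zero>\<^bsub>sections \<E> V\<^esub>" and x: "x \<in> V" and j: "j < p + q"
  shows "coeff u j I x = 0"
proof -
  interpret A: ring "sections \<O> V"
    by (rule ring_sections[OF V(1)])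
  have VU: "V \<subseteq> U"
    using V region_subset by blast
  obtain c where c: "c \<in> {..<p + q} \<rightarrow> carrier (sections \<O> B)" "u = comb B c"
      "\<forall>j<p + q. coeff u j = \<psi> B (c j)"
    using expand[OF u] .
  have cj: "c j \<in> carrier (sections \<O> B)"
    using c(1) j by auto
  have "comb V (\<lambda>i. restr \<O> B V (c i)) = comb V (\<lambda>i. \<zero>\<^bsub>sections \<O> V\<^esub>)"
    using restr_comb[OF V c(1)] c(2) zero comb_zero[OF V(1) VU] by simp
  then have "restr \<O> B V (c j) = \<zero>\<^bsub>sections \<O> V\<^esub>"
    by (rule comb_inj[OF V(1) VU _ _ _ j, rotated -1])
       (use c(1) restr_closed[OF openin_region V] in auto)
  then have "\<psi> V (restr \<O> B V (c j)) I x = 0"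
    using triv_zero[OF V] by simp
  then show ?thesis
    using triv_restr[OF openin_region V order_refl cj] x c(3) j by simp
qed

end

section \<open>Parallel sections over a trivialized region\<close>

locale region_with_connection = framed_region n m M \<A> \<O> B \<psi> \<E> U p q e + super_connection M \<O> \<E> nabla
  for n m :: nat and M :: "'a topology" and \<A> :: "'a chart set"
    and \<O> :: "('a, real, 's) super_sheaf" and B :: "'a set"
    and \<psi> :: "'a set \<Rightarrow> 's \<Rightarrow> nat set \<Rightarrow> 'a \<Rightarrow> real"
    and \<E> :: "('a, 's, 'e) super_sheaf" and U :: "'a set" and p q :: nat and e :: "nat \<Rightarrow> 'e"
    and nabla :: "'a set \<Rightarrow> ('a, 's) vector_field \<Rightarrow> 'e \<Rightarrow> 'e"
begin

lemma superderivation_add: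
  assumes D: "D \<in> superderivations M \<O> B a"
    and "f \<in> carrier (sections \<O> B)" "g \<in> carrier (sections \<O> B)"
  shows "D B (f \<oplus>\<^bsub>sections \<O> B\<^esub> g) = D B f \<oplus>\<^bsub>sections \<O> B\<^esub> D B g"
proof -
  have "B \<in> opens_in M B"
    using openin_region by (simp add: opens_in_def)
  then show ?thesis
    using assms unfolding superderivations_def Let_def by blast
qed

text \<open>
  The sign in the Leibniz rule is that of a homogeneous function. For a general \<open>f\<close>
  the even and the odd component are treated separately, and the signs change \<open>f\<close>
  in the second term to the function \<open>f'\<close> whose coefficient at
  \<open>\<xi>^I\<close> is that of \<open>f\<close> up to the sign given by the parities of
  \<open>D\<close> and \<open>\<xi>^I\<close>.
\<close>

lemma Leibniz_twisted:
  assumes D: "D \<in> superderivations M \<O> B a" and f: "f \<in> carrier (sections \<O> B)"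
  shows "\<exists>f'\<in>carrier (sections \<O> B).
    \<psi> B f' = (\<lambda>I x. bit_sign (a * of_nat (card I)) * \<psi> B f I x) \<and>
    (\<forall>b. \<forall>v\<in>homog (sections \<E> B) b. nabla B D (f \<odot>\<^bsub>sections \<E> B\<^esub> v) =
      D B f \<odot>\<^bsub>sections \<E> B\<^esub> v \<oplus>\<^bsub>sections \<E> B\<^esub> f' \<odot>\<^bsub>sections \<E> B\<^esub> nabla B D v)"
proof -
  interpret A: ring "sections \<O> B"
    by (rule ring_sections[OF openin_region])
  interpret E: abelian_group "sections \<E> B"
    by (rule \<E>.abelian_group_sections[OF openin_region])
  note smult = smult_sections[OF openin_region]
  note vf = superderivation_vector_field[OF D]
  have Dh: "D \<in> homog (vector_fields M \<O> B) a"
    using D by (simp add: tangent_sheaf_def)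
  have sgn: "super_sign (sections \<O> B) b h \<in> carrier (sections \<O> B)"
    if "h \<in> carrier (sections \<O> B)" for b h
    using that by (simp add: super_sign_def)
  obtain f0 f1 where f01: "f0 \<in> homog (sections \<O> B) 0" "f1 \<in> homog (sections \<O> B) 1"
    "f = f0 \<oplus>\<^bsub>sections \<O> B\<^esub> f1"
    using homog_decomposition[OF openin_region order_refl f] .
  note c = f01(1,2)[THEN homog_carrier[OF openin_region order_refl]]
  note Dc = superderivation_closed[OF D openin_region order_refl]
  \<comment> \<open>The exponents are the products of the parity of \<open>D\<close> with the parities 0 and 1 of the components.\<close>
  define g0 where "g0 = super_sign (sections \<O> B) (a * 0) f0"
  define g1 where "g1 = super_sign (sections \<O> B) (a * 1) f1"
  have g: "g0 \<in> carrier (sections \<O> B)" "g1 \<in> carrier (sections \<O> B)"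
    using c sgn by (simp_all add: g0_def g1_def)
  have twist: "\<psi> B (super_sign (sections \<O> B) (a * b) h) I x = bit_sign (a * of_nat (card I)) * \<psi> B h I x"
    if h: "h \<in> homog (sections \<O> B) b" for h b I x
    using triv_super_sign[OF openin_region order_refl homog_carrier[OF openin_region order_refl h], of "a * b"]
      triv_homog_coeff[OF openin_region order_refl h, of I x]
    by (cases "\<psi> B h I x = 0") auto
  have Leibniz: "nabla B D (h \<odot>\<^bsub>sections \<E> B\<^esub> v) = D B h \<odot>\<^bsub>sections \<E> B\<^esub> v \<oplus>\<^bsub>sections \<E> B\<^esub>
      super_sign (sections \<O> B) (a * b') h \<odot>\<^bsub>sections \<E> B\<^esub> nabla B D v"
    if h: "h \<in> homog (sections \<O> B) b'" and v: "v \<in> homog (sections \<E> B) b" for h b' v b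
    using nabla_Leibniz[OF openin_region h Dh v]
      smult_super_sign_left[OF openin_region homog_carrier[OF openin_region order_refl h]
        nabla_closed[OF openin_region vf \<E>.homog_sections_closed[OF openin_region v]]]
    by simp
  show ?thesis
  proof (intro bexI[of _ "g0 \<oplus>\<^bsub>sections \<O> B\<^esub> g1"] conjI)
    show "g0 \<oplus>\<^bsub>sections \<O> B\<^esub> g1 \<in> carrier (sections \<O> B)"
      using g by simp
    show "\<psi> B (g0 \<oplus>\<^bsub>sections \<O> B\<^esub> g1) = (\<lambda>I x. bit_sign (a * of_nat (card I)) * \<psi> B f I x)"
      unfolding f01(3) triv_add[OF openin_region order_refl g] triv_add[OF openin_region order_refl c]
      using twist[OF f01(1)] twist[OF f01(2)] by (simp only: g0_def g1_def distrib_left)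
    show "\<forall>b. \<forall>v\<in>homog (sections \<E> B) b. nabla B D (f \<odot>\<^bsub>sections \<E> B\<^esub> v) =
      D B f \<odot>\<^bsub>sections \<E> B\<^esub> v \<oplus>\<^bsub>sections \<E> B\<^esub> (g0 \<oplus>\<^bsub>sections \<O> B\<^esub> g1) \<odot>\<^bsub>sections \<E> B\<^esub> nabla B D v"
    proof (intro allI ballI)
      fix b v assume v: "v \<in> homog (sections \<E> B) b"
      note vc = \<E>.homog_sections_closed[OF openin_region v]
      define w where "w = nabla B D v"
      have w: "w \<in> carrier (sections \<E> B)"
        using nabla_closed[OF openin_region vf vc] by (simp add: w_def)
      have "nabla B D (f \<odot>\<^bsub>sections \<E> B\<^esub> v) =
          nabla B D (f0 \<odot>\<^bsub>sections \<E> B\<^esub> v) \<oplus>\<^bsub>sections \<E> B\<^esub> nabla B D (f1 \<odot>\<^bsub>sections \<E> B\<^esub> v)"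
        unfolding f01(3) smult(2)[OF c vc]
        by (rule nabla_add_right[OF openin_region vf smult(1)[OF c(1) vc] smult(1)[OF c(2) vc]])
      also have "\<dots> = (D B f0 \<odot>\<^bsub>sections \<E> B\<^esub> v \<oplus>\<^bsub>sections \<E> B\<^esub> g0 \<odot>\<^bsub>sections \<E> B\<^esub> w)
          \<oplus>\<^bsub>sections \<E> B\<^esub> (D B f1 \<odot>\<^bsub>sections \<E> B\<^esub> v \<oplus>\<^bsub>sections \<E> B\<^esub> g1 \<odot>\<^bsub>sections \<E> B\<^esub> w)"
        unfolding Leibniz[OF f01(1) v] Leibniz[OF f01(2) v] g0_def g1_def w_def ..
      also have "\<dots> = (D B f0 \<odot>\<^bsub>sections \<E> B\<^esub> v \<oplus>\<^bsub>sections \<E> B\<^esub> D B f1 \<odot>\<^bsub>sections \<E> B\<^esub> v)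
          \<oplus>\<^bsub>sections \<E> B\<^esub> (g0 \<odot>\<^bsub>sections \<E> B\<^esub> w \<oplus>\<^bsub>sections \<E> B\<^esub> g1 \<odot>\<^bsub>sections \<E> B\<^esub> w)"
        using smult(1) Dc c g vc w by (simp add: E.a_ac)
      also have "\<dots> = D B f \<odot>\<^bsub>sections \<E> B\<^esub> v \<oplus>\<^bsub>sections \<E> B\<^esub>
          (g0 \<oplus>\<^bsub>sections \<O> B\<^esub> g1) \<odot>\<^bsub>sections \<E> B\<^esub> w"
        unfolding f01(3) superderivation_add[OF D c] smult(2)[OF Dc[OF c(1)] Dc[OF c(2)] vc] smult(2)[OF g w] ..
      finally show "nabla B D (f \<odot>\<^bsub>sections \<E> B\<^esub> v) = D B f \<odot>\<^bsub>sections \<E> B\<^esub> v \<oplus>\<^bsub>sections \<E> B\<^esub>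
          (g0 \<oplus>\<^bsub>sections \<O> B\<^esub> g1) \<odot>\<^bsub>sections \<E> B\<^esub> nabla B D v"
        by (simp only: w_def)
    qed
  qed
qed

text \<open>
  The coordinate form of \<open>\<nabla>_D t = 0\<close>, taken at the point \<open>x\<close>
  and the monomial \<open>\<xi>^I\<close>. The functional \<open>\<delta>\<close> expresses the
  coefficient of \<open>D f\<close> by the coefficients of \<open>f\<close>; it is kept abstract
  so that one proof serves even and odd coordinate fields.
\<close>

lemma parallel_equation:
  assumes D: "D \<in> superderivations M \<O> B a" and t: "t \<in> carrier (sections \<E> B)"
    and parallel: "nabla B D t = \<zero>\<^bsub>sections \<E> B\<^esub>"
    and \<delta>: "\<And>f. f \<in> carrier (sections \<O> B) \<Longrightarrow> \<psi> B (D B f) I x = \<delta> (\<psi> B f)"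
    and j: "j < p + q"
  shows "\<delta> (coeff t j) = - (\<Sum>i<p + q. grassmann_mult
    (\<lambda>K y. bit_sign (a * of_nat (card K)) * coeff t i K y) (coeff (nabla B D (restr \<E> U B (e i))) j) I x)"
proof -
  interpret E: abelian_group "sections \<E> B"
    by (rule \<E>.abelian_group_sections[OF openin_region])
  note smult = smult_sections[OF openin_region]
  note vf = superderivation_vector_field[OF D]
  note Dc = superderivation_closed[OF D openin_region order_refl]
  define eB where "eB i = restr \<E> U B (e i)" for i
  obtain c where c: "c \<in> {..<p + q} \<rightarrow> carrier (sections \<O> B)" "t = comb B c"
      "\<forall>j<p + q. coeff t j = \<psi> B (c j)"
    using expand[OF t] .
  have ci: "c i \<in> carrier (sections \<O> B)" if "i < p + q" for i
    using c(1) that by auto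
  have "\<forall>i\<in>{..<p + q}. \<exists>f'\<in>carrier (sections \<O> B).
    \<psi> B f' = (\<lambda>I x. bit_sign (a * of_nat (card I)) * \<psi> B (c i) I x) \<and>
    (\<forall>b. \<forall>v\<in>homog (sections \<E> B) b. nabla B D (c i \<odot>\<^bsub>sections \<E> B\<^esub> v) =
      D B (c i) \<odot>\<^bsub>sections \<E> B\<^esub> v \<oplus>\<^bsub>sections \<E> B\<^esub> f' \<odot>\<^bsub>sections \<E> B\<^esub> nabla B D v)"
  proof
    fix i assume "i \<in> {..<p + q}"
    then have "c i \<in> carrier (sections \<O> B)"
      using ci by simp
    then show "\<exists>f'\<in>carrier (sections \<O> B).
      \<psi> B f' = (\<lambda>I x. bit_sign (a * of_nat (card I)) * \<psi> B (c i) I x) \<and>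
      (\<forall>b. \<forall>v\<in>homog (sections \<E> B) b. nabla B D (c i \<odot>\<^bsub>sections \<E> B\<^esub> v) =
        D B (c i) \<odot>\<^bsub>sections \<E> B\<^esub> v \<oplus>\<^bsub>sections \<E> B\<^esub> f' \<odot>\<^bsub>sections \<E> B\<^esub> nabla B D v)"
      by (rule Leibniz_twisted[OF D])
  qed
  from bchoice[OF this[unfolded Bex_def]] obtain c' where "\<forall>i\<in>{..<p + q}. c' i \<in> carrier (sections \<O> B) \<and>
    \<psi> B (c' i) = (\<lambda>I x. bit_sign (a * of_nat (card I)) * \<psi> B (c i) I x) \<and>
    (\<forall>b. \<forall>v\<in>homog (sections \<E> B) b. nabla B D (c i \<odot>\<^bsub>sections \<E> B\<^esub> v) =
      D B (c i) \<odot>\<^bsub>sections \<E> B\<^esub> v \<oplus>\<^bsub>sections \<E> B\<^esub> c' i \<odot>\<^bsub>sections \<E> B\<^esub> nabla B D v)"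
    by blast
  then have c': "\<And>i. i < p + q \<Longrightarrow> c' i \<in> carrier (sections \<O> B)"
      "\<And>i. i < p + q \<Longrightarrow> \<psi> B (c' i) = (\<lambda>I x. bit_sign (a * of_nat (card I)) * \<psi> B (c i) I x)"
      "\<And>i b v. i < p + q \<Longrightarrow> v \<in> homog (sections \<E> B) b \<Longrightarrow> nabla B D (c i \<odot>\<^bsub>sections \<E> B\<^esub> v) =
        D B (c i) \<odot>\<^bsub>sections \<E> B\<^esub> v \<oplus>\<^bsub>sections \<E> B\<^esub> c' i \<odot>\<^bsub>sections \<E> B\<^esub> nabla B D v"
    by auto
  have eB: "eB i \<in> carrier (sections \<E> B)" "nabla B D (eB i) \<in> carrier (sections \<E> B)" if "i < p + q" for i
    using frame_carrier[OF openin_region region_subset that] nabla_closed[OF openin_region vf]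
    by (simp_all add: eB_def)
  have Df: "(\<lambda>i. D B (c i)) \<in> {..<p + q} \<rightarrow> carrier (sections \<O> B)"
    using ci Dc by auto
  have s1: "(\<lambda>i. D B (c i) \<odot>\<^bsub>sections \<E> B\<^esub> eB i) \<in> {..<p + q} \<rightarrow> carrier (sections \<E> B)"
    unfolding eB_def by (rule summand_closed[OF openin_region region_subset Df])
  have s2: "(\<lambda>i. c' i \<odot>\<^bsub>sections \<E> B\<^esub> nabla B D (eB i)) \<in> {..<p + q} \<rightarrow> carrier (sections \<E> B)"
    using c'(1) eB(2) smult(1) by auto
  have "nabla B D t = (\<Oplus>\<^bsub>sections \<E> B\<^esub> i \<in> {..<p + q}. nabla B D (c i \<odot>\<^bsub>sections \<E> B\<^esub> eB i))"
    unfolding c(2) comb_def eB_def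
    by (rule additive_map_finsum[OF E.abelian_group_axioms E.abelian_group_axioms, where h = "nabla B D"])
       (use nabla_closed[OF openin_region vf] nabla_add_right[OF openin_region vf]
          summand_closed[OF openin_region region_subset c(1)] in auto)
  also have "\<dots> = (\<Oplus>\<^bsub>sections \<E> B\<^esub> i \<in> {..<p + q}. D B (c i) \<odot>\<^bsub>sections \<E> B\<^esub> eB i
      \<oplus>\<^bsub>sections \<E> B\<^esub> c' i \<odot>\<^bsub>sections \<E> B\<^esub> nabla B D (eB i))"
  proof (rule E.finsum_cong'[OF refl])
    show "(\<lambda>i. D B (c i) \<odot>\<^bsub>sections \<E> B\<^esub> eB i \<oplus>\<^bsub>sections \<E> B\<^esub> c' i \<odot>\<^bsub>sections \<E> B\<^esub> nabla B D (eB i))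
        \<in> {..<p + q} \<rightarrow> carrier (sections \<E> B)"
      using s1 s2 by (auto simp: Pi_iff)
    fix i assume "i \<in> {..<p + q}"
    then have i: "i < p + q"
      by simp
    obtain b where "eB i \<in> homog (sections \<E> B) b"
      using frame_homog[OF i] unfolding eB_def by blast
    then show "nabla B D (c i \<odot>\<^bsub>sections \<E> B\<^esub> eB i) = D B (c i) \<odot>\<^bsub>sections \<E> B\<^esub> eB i
        \<oplus>\<^bsub>sections \<E> B\<^esub> c' i \<odot>\<^bsub>sections \<E> B\<^esub> nabla B D (eB i)"
      by (rule c'(3)[OF i])
  qed
  also have "\<dots> = comb B (\<lambda>i. D B (c i)) \<oplus>\<^bsub>sections \<E> B\<^esub>
      (\<Oplus>\<^bsub>sections \<E> B\<^esub> i \<in> {..<p + q}. c' i \<odot>\<^bsub>sections \<E> B\<^esub> nabla B D (eB i))"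
    using E.finsum_addf[OF s1 s2] by (simp add: comb_def eB_def)
  finally have "coeff \<zero>\<^bsub>sections \<E> B\<^esub> j I x = coeff (comb B (\<lambda>i. D B (c i)) \<oplus>\<^bsub>sections \<E> B\<^esub>
      (\<Oplus>\<^bsub>sections \<E> B\<^esub> i \<in> {..<p + q}. c' i \<odot>\<^bsub>sections \<E> B\<^esub> nabla B D (eB i))) j I x"
    using parallel by simp
  also have "\<dots> = coeff (comb B (\<lambda>i. D B (c i))) j I x +
      coeff (\<Oplus>\<^bsub>sections \<E> B\<^esub> i \<in> {..<p + q}. c' i \<odot>\<^bsub>sections \<E> B\<^esub> nabla B D (eB i)) j I x"
  proof (rule coeff_add[OF _ _ j])
    show "comb B (\<lambda>i. D B (c i)) \<in> carrier (sections \<E> B)"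
      unfolding comb_def using s1 by (intro E.finsum_closed) (simp add: eB_def)
    show "(\<Oplus>\<^bsub>sections \<E> B\<^esub> i \<in> {..<p + q}. c' i \<odot>\<^bsub>sections \<E> B\<^esub> nabla B D (eB i)) \<in> carrier (sections \<E> B)"
      by (rule E.finsum_closed[OF s2])
  qed
  also have "coeff (comb B (\<lambda>i. D B (c i))) j I x = \<delta> (coeff t j)"
    using coeff_comb[OF Df j] \<delta>[OF ci[OF j]] c(3) j by simp
  also have "coeff (\<Oplus>\<^bsub>sections \<E> B\<^esub> i \<in> {..<p + q}. c' i \<odot>\<^bsub>sections \<E> B\<^esub> nabla B D (eB i)) j I x =
      (\<Sum>i<p + q. coeff (c' i \<odot>\<^bsub>sections \<E> B\<^esub> nabla B D (eB i)) j I x)"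
    by (rule coeff_finsum[OF j _ s2]) simp
  also have "\<dots> = (\<Sum>i<p + q. grassmann_mult
      (\<lambda>K y. bit_sign (a * of_nat (card K)) * coeff t i K y) (coeff (nabla B D (eB i)) j) I x)"
    using coeff_smult[OF c'(1) eB(2) j] c'(2) c(3) by (intro sum.cong) auto
  finally show ?thesis
    using coeff_zero[OF j, of I x] by (simp add: eB_def)
qed

definition region_parallel :: "'e \<Rightarrow> bool" where
  "region_parallel t \<longleftrightarrow> t \<in> carrier (sections \<E> B) \<and>
    (\<forall>Y\<in>carrier (vector_fields M \<O> B). nabla B Y t = \<zero>\<^bsub>sections \<E> B\<^esub>)"

text \<open>
  Induction on the number of elements of \<open>I\<close>. With \<open>I = insert a J\<close>,
  the derivative by \<open>\<xi>^a\<close> isolates the coefficient at \<open>\<xi>^I\<close>,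
  and by the parallel equation it is a combination of coefficients at subsets of
  \<open>J\<close>.
\<close>

lemma coeff_zero_if_body_zero:
  assumes t: "region_parallel t" and body: "\<And>j x. j < p + q \<Longrightarrow> coeff t j {} x = 0"
  shows "finite I \<Longrightarrow> j < p + q \<Longrightarrow> coeff t j I x = 0"
proof (induction "card I" arbitrary: I j x rule: less_induct)
  case less
  have tc: "t \<in> carrier (sections \<E> B)"
    using t by (simp add: region_parallel_def)
  show ?case
  proof (cases "I \<noteq> {} \<and> I \<subseteq> {..<m}")
    case True
    then obtain a where a: "a \<in> I" "a < m"
      by auto
    define J where "J = I - {a}"
    have J: "I = insert a J" "a \<notin> J" "finite J"
      using a less.prems(1) by (auto simp: J_def)
    then have card_I: "card I = Suc (card J)"
      by simp
    obtain D where D: "D \<in> superderivations M \<O> B 1"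
        "\<And>f. f \<in> carrier (sections \<O> B) \<Longrightarrow> \<psi> B (D B f) = odd_deriv a (\<psi> B f)"
      using odd_coordinate_field[OF a(2)] by blast
    have "nabla B D t = \<zero>\<^bsub>sections \<E> B\<^esub>"
      using t superderivation_vector_field[OF D(1)] by (simp add: region_parallel_def)
    from parallel_equation[OF D(1) tc this, of J x "\<lambda>F. odd_deriv a F J x" j] D(2) less.prems(2)
    have "odd_deriv a (coeff t j) J x = - (\<Sum>i<p + q. grassmann_mult
        (\<lambda>K y. bit_sign (1 * of_nat (card K)) * coeff t i K y)
        (coeff (nabla B D (restr \<E> U B (e i))) j) J x)"
      by simp
    also have "\<dots> = 0"
    proof -
      have "coeff t i K x = 0" if "K \<subseteq> J" "i < p + q" for i K
        using that card_I card_mono[OF J(3) that(1)] J(3) finite_subset[OF that(1)] by (intro less.hyps) auto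
      then have "grassmann_mult (\<lambda>K y. bit_sign (1 * of_nat (card K)) * coeff t i K y)
        (coeff (nabla B D (restr \<E> U B (e i))) j) J x = 0" if "i < p + q" for i
        using that unfolding grassmann_mult_def by (intro sum.neutral) auto
      then show ?thesis
        by simp
    qed
    finally have "grassmann_sign {a} J * coeff t j I x = 0"
      using J(1,2) by (simp add: odd_deriv_def)
    then show ?thesis
      using grassmann_sign_square[of "{a}" J] by (metis mult_eq_0_iff zero_neq_one)
  next
    case False
    then consider "I = {}" | "\<not> I \<subseteq> {..<m}"
      by blast
    then show ?thesis
    proof cases
      case 1
      then show ?thesis
        using body[OF less.prems(2)] by simp
    next
      case 2
      then show ?thesis
        using model_carrier_large[OF coeff_model[OF tc less.prems(2)]] by blast
    qed
  qed
qed

text \<open>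
  The bodies of the coefficients, read in the chart, satisfy a linear system of partial
  differential equations: at the monomial 1 a product only involves bodies.
\<close>

lemma body_zero_on_box:
  assumes t: "region_parallel t"
    and W: "(W, \<phi>) \<in> \<A>" "B \<subseteq> W" "\<phi> ` B = open_box n y d"
    and x0: "x0 \<in> B" "\<And>j. j < p + q \<Longrightarrow> coeff t j {} x0 = 0"
    and j: "j < p + q" and x: "x \<in> B"
  shows "coeff t j {} x = 0"
proof -
  have tc: "t \<in> carrier (sections \<E> B)"
    using t by (simp add: region_parallel_def)
  have BW: "B \<inter> W = B"
    using W(2) by blast
  have inv: "inv_into W \<phi> (\<phi> z) = z" if "z \<in> B" for z
    using chart_inverse[OF W(1)] that W(2) by blast
  have "\<exists>D. D \<in> superderivations M \<O> B 0 \<and> (\<forall>f I. f \<in> carrier (sections \<O> B) \<longrightarrow>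
      \<psi> B (D B f) I = coord_deriv W \<phi> k B (\<psi> B f I))" if "k < n" for k
    using even_coordinate_field[OF W(1,2) that] by metis
  then obtain D where D: "\<And>k. k < n \<Longrightarrow> D k \<in> superderivations M \<O> B 0"
      "\<And>k f I. k < n \<Longrightarrow> f \<in> carrier (sections \<O> B) \<Longrightarrow>
        \<psi> B (D k B f) I = coord_deriv W \<phi> k B (\<psi> B f I)"
    by metis
  define \<Gamma> where "\<Gamma> k i j = coeff (nabla B (D k) (restr \<E> U B (e i))) j {}" for k i j
  have vf: "D k \<in> carrier (vector_fields M \<O> B)" if "k < n" for k
    by (rule superderivation_vector_field[OF D(1)[OF that]])
  have smooth: "coeff u j {} \<in> smooth_functions n \<A> B" if "u \<in> carrier (sections \<E> B)" "j < p + q" for u j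
    using coeff_model[OF that] by (simp add: model_carrier_def)
  have Cinf: "C_infinity n (open_box n y d) (\<lambda>z. f (inv_into W \<phi> z))" if "f \<in> smooth_functions n \<A> B" for f
    using smooth_functions_chart[OF that W(1)] W(3) BW by simp
  have "coeff t j {} (inv_into W \<phi> (\<phi> x)) = 0"
  proof (rule linear_PDE_unique_zero[where u = "\<lambda>j z. coeff t j {} (inv_into W \<phi> z)" and n = n
        and c = y and d = d and r = "p + q" and ?y0.0 = "\<phi> x0"
        and a = "\<lambda>k i j z. - \<Gamma> k i j (inv_into W \<phi> z)"])
    show "C_k (Suc 0) n (open_box n y d) (\<lambda>z. coeff t j {} (inv_into W \<phi> z))" if "j < p + q" for j
      using Cinf[OF smooth[OF tc that]] unfolding C_infinity_def by blast
  next
    fix k i j assume k: "k < n" and "i < p + q" "j < p + q"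
    then have "\<Gamma> k i j \<in> smooth_functions n \<A> B"
      unfolding \<Gamma>_def by (intro smooth nabla_closed[OF openin_region vf[OF k]]
          frame_carrier[OF openin_region region_subset])
    from Cinf[OF this] have "C_k 0 n (open_box n y d) (\<lambda>z. \<Gamma> k i j (inv_into W \<phi> z))"
      unfolding C_infinity_def by blast
    from C_k_imp_continuous_on[OF this openin_open_box]
    show "continuous_on (open_box n y d) (\<lambda>z. - \<Gamma> k i j (inv_into W \<phi> z))"
      by (rule continuous_on_minus)
  next
    fix k j z assume k: "k < n" and j: "j < p + q" and z: "z \<in> open_box n y d"
    then obtain w where w: "w \<in> B" "z = \<phi> w"
      using W(3) by blast
    have "nabla B (D k) t = \<zero>\<^bsub>sections \<E> B\<^esub>"
      using t vf[OF k] by (simp add: region_parallel_def)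
    from parallel_equation[OF D(1)[OF k] tc this, of "{}" w "\<lambda>F. coord_deriv W \<phi> k B (F {}) w" j] D(2)[OF k] j
    have "coord_deriv W \<phi> k B (coeff t j {}) w = (\<Sum>i<p + q. coeff t i {} w * - \<Gamma> k i j w)"
      by (simp add: \<Gamma>_def sum_negf)
    then show "partial_deriv k (\<lambda>z. coeff t j {} (inv_into W \<phi> z)) z =
        (\<Sum>i<p + q. coeff t i {} (inv_into W \<phi> z) * - \<Gamma> k i j (inv_into W \<phi> z))"
      using w inv[OF w(1)] by (simp add: coord_deriv_def)
  next
    show "\<phi> x0 \<in> open_box n y d" "\<phi> x \<in> open_box n y d"
      using x x0(1) W(3) by auto
    show "coeff t j {} (inv_into W \<phi> (\<phi> x0)) = 0" if "j < p + q" for j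
      using inv[OF x0(1)] x0(2)[OF that] by simp
  qed (rule j)
  then show ?thesis
    using inv[OF x] by simp
qed

lemma parallel_zero_on_box:
  assumes t: "region_parallel t"
    and W: "(W, \<phi>) \<in> \<A>" "B \<subseteq> W" "\<phi> ` B = open_box n y d"
    and x0: "x0 \<in> B" "\<And>j. j < p + q \<Longrightarrow> coeff t j {} x0 = 0"
  shows "t = \<zero>\<^bsub>sections \<E> B\<^esub>"
proof (rule coeff_all_zero)
  show tc: "t \<in> carrier (sections \<E> B)"
    using t by (simp add: region_parallel_def)
  have body: "coeff t j {} x = 0" if "j < p + q" for j x
  proof (cases "x \<in> B")
    case True
    then show ?thesis
      using body_zero_on_box[OF t W x0 that] by blast
  next
    case False
    then show ?thesis
      using model_carrier_outside[OF coeff_model[OF tc that]] by blast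
  qed
  show "coeff t j I x = 0" if j: "j < p + q" for j I x
  proof (cases "finite I")
    case True
    then show ?thesis
      using coeff_zero_if_body_zero[OF t body] j by blast
  next
    case False
    then have "\<not> I \<subseteq> {..<m}"
      using finite_subset by blast
    then show ?thesis
      using model_carrier_large[OF coeff_model[OF tc j]] by blast
  qed
qed

end

section \<open>From local to global\<close>

lemma (in smooth_manifold) box_neighbourhood:
  assumes N: "openin M N" "x \<in> N"
  obtains W \<phi> B y d where "(W, \<phi>) \<in> \<A>" "openin M B" "x \<in> B" "B \<subseteq> N" "B \<subseteq> W"
    "\<phi> ` B = open_box n y d"
proof -
  have "x \<in> topspace M"
    using N openin_subset by blast
  then obtain W \<phi> where W: "(W, \<phi>) \<in> \<A>" "x \<in> W"
    by (auto simp flip: charts_cover)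
  have op: "openin (Euclidean_space n) (\<phi> ` (N \<inter> W))"
    by (rule openin_chart_image[OF W(1) N(1)])
  have "\<phi> x \<in> \<phi> ` (N \<inter> W)"
    using N(2) W(2) by blast
  then obtain d where d: "d > 0" "open_box n (\<phi> x) d \<subseteq> \<phi> ` (N \<inter> W)"
    using openin_Euclidean_contains_box[OF op] by blast
  define B where "B = {z \<in> W. \<phi> z \<in> open_box n (\<phi> x) d}"
  have "\<phi> x \<in> topspace (Euclidean_space n)"
    using \<open>\<phi> x \<in> \<phi> ` (N \<inter> W)\<close> openin_subset[OF op] by blast
  then have xB: "x \<in> B"
    using W(2) d(1) by (simp add: B_def open_box_def)
  have opB: "openin M B"
    unfolding B_def by (rule openin_chart_preimage[OF W(1) openin_open_box])
  have BN: "B \<subseteq> N"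
  proof
    fix z assume "z \<in> B"
    then have "z \<in> W" "\<phi> z \<in> \<phi> ` (N \<inter> W)"
      using d(2) by (auto simp: B_def)
    then show "z \<in> N"
      using inj_on_image_mem_iff[OF chart_inj_on[OF W(1)], of z "N \<inter> W"] by simp
  qed
  have BW: "B \<subseteq> W" "\<phi> ` B = open_box n (\<phi> x) d"
    using d(2) by (auto simp: B_def)
  show thesis
    by (rule that[OF W(1) opB xB BN BW])
qed

lemma local_trivialization_subset:
  assumes "local_trivialization n m M \<A> \<O> W \<psi>" "openin M B" "B \<subseteq> W"
  shows "local_trivialization n m M \<A> \<O> B \<psi>"
proof -
  have "V \<subseteq> W" if "V \<subseteq> B" for V
    using that assms(3) by blast
  with assms(1,2) show ?thesis
    unfolding local_trivialization_def by simp
qed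

text \<open>
  Intersect a trivializing neighbourhood of \<open>x\<close> with one that carries a frame, and
  take a coordinate box in it.
\<close>

lemma region_with_connection_exists:
  assumes S: "supermanifold n m M \<A> \<O>" and L: "locally_free_sheaf M \<O> \<E>"
    and C: "super_connection M \<O> \<E> nabla" and N: "openin M N" "x \<in> N"
  obtains W \<phi> B \<psi> U p q e y d where
    "region_with_connection n m M \<A> \<O> B \<psi> \<E> U p q e nabla"
    "(W, \<phi>) \<in> \<A>" "B \<subseteq> W" "\<phi> ` B = open_box n y d" "x \<in> B" "B \<subseteq> N"
proof -
  interpret S: supermanifold n m M \<A> \<O> by fact
  interpret L: locally_free_sheaf M \<O> \<E> by fact
  have x: "x \<in> topspace M"
    using N openin_subset by blast
  obtain W0 \<psi> where W0: "x \<in> W0" "local_trivialization n m M \<A> \<O> W0 \<psi>"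
    using S.locally_trivial[OF x] by blast
  obtain U p q e where U: "x \<in> U" "local_frame M \<O> \<E> U p q e"
    using L.locally_free[OF x] by blast
  have "openin M W0" "openin M U"
    using W0(2) U(2) by (simp_all add: local_trivialization_def local_frame_def)
  then have "openin M (N \<inter> W0 \<inter> U)"
    using N(1) by (intro openin_Int)
  moreover have "x \<in> N \<inter> W0 \<inter> U"
    using N(2) W0(1) U(1) by blast
  ultimately obtain W \<phi> B y d where B: "(W, \<phi>) \<in> \<A>" "openin M B" "x \<in> B" "B \<subseteq> N \<inter> W0 \<inter> U" "B \<subseteq> W"
    "\<phi> ` B = open_box n y d"
    using S.box_neighbourhood by metis
  have BB: "B \<subseteq> W0" "B \<subseteq> U" "B \<subseteq> N"
    using B(4) by blast+
  have "region_with_connection n m M \<A> \<O> B \<psi> \<E> U p q e nabla"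
    by (intro region_with_connection.intro framed_region.intro framed_region_axioms.intro
        trivialized_region.intro trivialized_region_axioms.intro S L.sheaf_of_supermodules_axioms C
        local_trivialization_subset[OF W0(2) B(2) BB(1)] U(2) BB(2))
  then show thesis
    using that B BB by blast
qed

text \<open>
  As 0 is an empty sum, \<open>a\<close> lies in its own coset, hence in that of
  \<open>b\<close>.
\<close>

lemma fibre_value_eqD:
  assumes Mod: "sheaf_of_supermodules M \<O> \<E>" and V: "openin M V"
    and a: "a \<in> carrier (sections \<E> V)" and b: "b \<in> carrier (sections \<E> V)"
    and eq: "fibre_value n m M \<A> \<O> \<E> V x a = fibre_value n m M \<A> \<O> \<E> V x b"
  obtains k :: nat and f s where "f \<in> {..<k} \<rightarrow> vanishing_ideal n m M \<A> \<O> V x"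
    "s \<in> {..<k} \<rightarrow> carrier (sections \<E> V)"
    "a = (\<Oplus>\<^bsub>sections \<E> V\<^esub> i \<in> {..<k}. f i \<odot>\<^bsub>sections \<E> V\<^esub> s i) \<oplus>\<^bsub>sections \<E> V\<^esub> b"
proof -
  interpret Mod: sheaf_of_supermodules M \<O> \<E> by fact
  interpret E: abelian_group "sections \<E> V"
    by (rule Mod.\<E>.abelian_group_sections[OF V])
  let ?H = "ideal_smult (vanishing_ideal n m M \<A> \<O> V x) (sections \<E> V)"
  have "(\<Oplus>\<^bsub>sections \<E> V\<^esub> i \<in> {..<0::nat}. undefined i \<odot>\<^bsub>sections \<E> V\<^esub> undefined i) \<in> ?H"
    unfolding ideal_smult_def by blast
  then have "\<zero>\<^bsub>sections \<E> V\<^esub> \<in> ?H"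
    by simp
  then have "\<zero>\<^bsub>sections \<E> V\<^esub> \<oplus>\<^bsub>sections \<E> V\<^esub> a \<in> fibre_value n m M \<A> \<O> \<E> V x a"
    by (auto simp: fibre_value_def a_r_coset_def')
  then have "a \<in> fibre_value n m M \<A> \<O> \<E> V x b"
    using a eq by simp
  then obtain h where "h \<in> ?H" "a = h \<oplus>\<^bsub>sections \<E> V\<^esub> b"
    by (auto simp: fibre_value_def a_r_coset_def')
  then show thesis
    using that unfolding ideal_smult_def by blast
qed

text \<open>
  The functional taking a section to the body of its \<open>j\<close>-th coefficient at
  \<open>x\<close> multiplies by the value at \<open>x\<close> under scalar multiplication, so
  it kills the product of the ideal of \<open>x\<close> with the module.
\<close>

lemma (in framed_region) coeff_body_eq_if_fibre_value_eq:
  assumes V: "openin M V" "B \<subseteq> V"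
    and a: "a \<in> carrier (sections \<E> V)" and b: "b \<in> carrier (sections \<E> V)"
    and eq: "fibre_value n m M \<A> \<O> \<E> V x a = fibre_value n m M \<A> \<O> \<E> V x b"
    and x: "x \<in> B" and j: "j < p + q"
  shows "coeff (restr \<E> V B a) j {} x = coeff (restr \<E> V B b) j {} x"
proof -
  interpret E: abelian_group "sections \<E> V"
    by (rule \<E>.abelian_group_sections[OF V(1)])
  obtain k :: nat and f s where fs: "f \<in> {..<k} \<rightarrow> vanishing_ideal n m M \<A> \<O> V x"
    "s \<in> {..<k} \<rightarrow> carrier (sections \<E> V)"
    "a = (\<Oplus>\<^bsub>sections \<E> V\<^esub> i \<in> {..<k}. f i \<odot>\<^bsub>sections \<E> V\<^esub> s i) \<oplus>\<^bsub>sections \<E> V\<^esub> b"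
    using fibre_value_eqD[OF sheaf_of_supermodules_axioms V(1) a b eq] .
  have f: "f i \<in> carrier (sections \<O> V)" "body n m M \<A> \<O> V (f i) x = 0" if "i < k" for i
    using fs(1) that by (auto simp: vanishing_ideal_def)
  have s: "s i \<in> carrier (sections \<E> V)" if "i < k" for i
    using fs(2) that by auto
  note r\<O> = restr_closed[OF V(1) openin_region V(2)]
  note r\<E> = \<E>.restr_closed[OF V(1) openin_region V(2)]
  have fsV: "(\<lambda>i. f i \<odot>\<^bsub>sections \<E> V\<^esub> s i) \<in> {..<k} \<rightarrow> carrier (sections \<E> V)"
    using f(1) s smult_sections(1)[OF V(1)] by auto
  let ?h = "\<Oplus>\<^bsub>sections \<E> V\<^esub> i \<in> {..<k}. f i \<odot>\<^bsub>sections \<E> V\<^esub> s i"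
  have h: "?h \<in> carrier (sections \<E> V)"
    by (rule E.finsum_closed[OF fsV])
  have "coeff (restr \<E> V B ?h) j {} x = (\<Sum>i<k. coeff (restr \<E> V B (f i \<odot>\<^bsub>sections \<E> V\<^esub> s i)) j {} x)"
    unfolding restr_finsum[OF V(1) openin_region V(2) finite_lessThan fsV]
    using fsV r\<E> by (intro coeff_finsum[OF j]) auto
  also have "\<dots> = (\<Sum>i<k. \<psi> B (restr \<O> V B (f i)) {} x * coeff (restr \<E> V B (s i)) j {} x)"
  proof (rule sum.cong[OF refl])
    fix i assume "i \<in> {..<k}"
    then have i: "i < k"
      by simp
    show "coeff (restr \<E> V B (f i \<odot>\<^bsub>sections \<E> V\<^esub> s i)) j {} x =
        \<psi> B (restr \<O> V B (f i)) {} x * coeff (restr \<E> V B (s i)) j {} x"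
      unfolding restr_smult[OF V(1) openin_region V(2) f(1)[OF i] s[OF i]]
        coeff_smult[OF r\<O>[OF f(1)[OF i]] r\<E>[OF s[OF i]] j]
      by (rule grassmann_mult_empty)
  qed
  also have "\<dots> = 0"
    using f body_eq[OF V f(1) x] by (intro sum.neutral) auto
  finally have "coeff (restr \<E> V B ?h) j {} x = 0" .
  then show ?thesis
    using coeff_add[OF r\<E>[OF h] r\<E>[OF b] j, of "{}" x] \<E>.restr_add[OF V(1) openin_region V(2) h b] fs(3)
    by simp
qed

context region_with_connection
begin

lemma region_parallel_restr_diff:
  assumes s: "parallel M \<O> \<E> nabla s" and s': "parallel M \<O> \<E> nabla s'"
  shows "region_parallel (restr \<E> (topspace M) B s \<ominus>\<^bsub>sections \<E> B\<^esub> restr \<E> (topspace M) B s')"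
proof -
  interpret E: abelian_group "sections \<E> B"
    by (rule \<E>.abelian_group_sections[OF openin_region])
  let ?r = "restr \<E> (topspace M) B"
  have r: "?r s \<in> carrier (sections \<E> B)" "?r s' \<in> carrier (sections \<E> B)"
    using s s' \<E>.restr_closed[OF openin_topspace openin_region openin_subset[OF openin_region]]
    by (simp_all add: parallel_def)
  have "nabla B Y (?r s \<ominus>\<^bsub>sections \<E> B\<^esub> ?r s') = \<zero>\<^bsub>sections \<E> B\<^esub>"
    if Y: "Y \<in> carrier (vector_fields M \<O> B)" for Y
  proof -
    have zero: "nabla B Y (?r s) = \<zero>\<^bsub>sections \<E> B\<^esub>" "nabla B Y (?r s') = \<zero>\<^bsub>sections \<E> B\<^esub>"
      using s s' Y openin_region by (simp_all add: parallel_def)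
    have "nabla B Y (\<ominus>\<^bsub>sections \<E> B\<^esub> ?r s') = \<ominus>\<^bsub>sections \<E> B\<^esub> nabla B Y (?r s')"
      by (rule additive_map_minus[OF E.abelian_group_axioms E.abelian_group_axioms])
         (use nabla_closed[OF openin_region Y] nabla_add_right[OF openin_region Y] r in auto)
    then show ?thesis
      using nabla_add_right[OF openin_region Y r(1) E.a_inv_closed[OF r(2)]] zero
      by (simp add: E.minus_eq)
  qed
  then show ?thesis
    using r by (simp add: region_parallel_def)
qed

lemma restr_eq_if_body_eq:
  assumes s: "parallel M \<O> \<E> nabla s" and s': "parallel M \<O> \<E> nabla s'"
    and W: "(W, \<phi>) \<in> \<A>" "B \<subseteq> W" "\<phi> ` B = open_box n y d" and x: "x \<in> B"
    and body: "\<And>j. j < p + q \<Longrightarrow> coeff (restr \<E> (topspace M) B s) j {} x =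
      coeff (restr \<E> (topspace M) B s') j {} x"
  shows "restr \<E> (topspace M) B s = restr \<E> (topspace M) B s'"
proof -
  interpret E: abelian_group "sections \<E> B"
    by (rule \<E>.abelian_group_sections[OF openin_region])
  let ?r = "restr \<E> (topspace M) B"
  have r: "?r s \<in> carrier (sections \<E> B)" "?r s' \<in> carrier (sections \<E> B)"
    using s s' \<E>.restr_closed[OF openin_topspace openin_region openin_subset[OF openin_region]]
    by (simp_all add: parallel_def)
  have "?r s \<ominus>\<^bsub>sections \<E> B\<^esub> ?r s' = \<zero>\<^bsub>sections \<E> B\<^esub>"
    by (rule parallel_zero_on_box[OF region_parallel_restr_diff[OF s s'] W x])
       (simp add: coeff_diff[OF r] body)
  moreover have "?r s = (?r s \<ominus>\<^bsub>sections \<E> B\<^esub> ?r s') \<oplus>\<^bsub>sections \<E> B\<^esub> ?r s'"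
    using r by (simp add: E.minus_eq E.a_assoc E.l_neg)
  ultimately show ?thesis
    using r(2) by simp
qed

lemma coeff_eq_if_restr_eq:
  assumes s: "s \<in> carrier (sections \<E> (topspace M))" and s': "s' \<in> carrier (sections \<E> (topspace M))"
    and V: "openin M V" "x \<in> V" "restr \<E> (topspace M) V s = restr \<E> (topspace M) V s'"
    and x: "x \<in> B" and j: "j < p + q"
  shows "coeff (restr \<E> (topspace M) B s) j I x = coeff (restr \<E> (topspace M) B s') j I x"
proof -
  define N where "N = V \<inter> B"
  have N: "openin M N" "N \<subseteq> B" "N \<subseteq> V" "x \<in> N"
    using V openin_region x by (auto simp: N_def)
  interpret EB: abelian_group "sections \<E> B"
    by (rule \<E>.abelian_group_sections[OF openin_region])
  interpret EN: abelian_group "sections \<E> N"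
    by (rule \<E>.abelian_group_sections[OF N(1)])
  let ?r = "restr \<E> (topspace M) B"
  note sub = openin_subset[OF openin_region] openin_subset[OF V(1)]
  have r: "?r s \<in> carrier (sections \<E> B)" "?r s' \<in> carrier (sections \<E> B)"
    using s s' \<E>.restr_closed[OF openin_topspace openin_region sub(1)] by simp_all
  have "restr \<E> B N (?r t) = restr \<E> V N (restr \<E> (topspace M) V t)"
    if "t \<in> carrier (sections \<E> (topspace M))" for t
    using \<E>.restr_restr[OF openin_topspace openin_region N(1,2) sub(1) that]
      \<E>.restr_restr[OF openin_topspace V(1) N(1,3) sub(2) that] by simp
  then have eq: "restr \<E> B N (?r s) = restr \<E> B N (?r s')"
    using s s' V(3) by simp
  note rc = \<E>.restr_closed[OF openin_region N(1,2)]
  have "restr \<E> B N (\<ominus>\<^bsub>sections \<E> B\<^esub> ?r s') = \<ominus>\<^bsub>sections \<E> N\<^esub> restr \<E> B N (?r s')"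
    by (rule additive_map_minus[OF EB.abelian_group_axioms EN.abelian_group_axioms])
       (use rc \<E>.restr_add[OF openin_region N(1,2)] r in auto)
  then have "restr \<E> B N (?r s \<ominus>\<^bsub>sections \<E> B\<^esub> ?r s') = \<zero>\<^bsub>sections \<E> N\<^esub>"
    using \<E>.restr_add[OF openin_region N(1,2) r(1) EB.a_inv_closed[OF r(2)]] eq rc[OF r(2)]
    by (simp add: EB.minus_eq EN.r_neg)
  from coeff_local[OF N(1,2) EB.minus_closed[OF r] this N(4) j]
  show ?thesis
    using coeff_diff[OF r j] by simp
qed

end

theorem proposition6p1:
  fixes n m :: nat
    and M :: "'a topology"
    and \<A> :: "'a chart set"
    and \<O> :: "('a, real, 's) super_sheaf"
    and \<E> :: "('a, 's, 'e) super_sheaf"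
    and nabla :: "'a set \<Rightarrow> ('a, 's) vector_field \<Rightarrow> 'e \<Rightarrow> 'e"
    and x :: 'a
    and V :: "'a set"
    and s s' :: 'e
  assumes "supermanifold n m M \<A> \<O>"
    and "connected_space M"
    and "locally_free_sheaf M \<O> \<E>"
    and "super_connection M \<O> \<E> nabla"
    and "parallel M \<O> \<E> nabla s"
    and "parallel M \<O> \<E> nabla s'"
    and "openin M V" and "x \<in> V"
    and "fibre_value n m M \<A> \<O> \<E> V x (restr \<E> (topspace M) V s) =
         fibre_value n m M \<A> \<O> \<E> V x (restr \<E> (topspace M) V s')"
  shows "s = s'"
proof -
  interpret L: locally_free_sheaf M \<O> \<E> by fact
  note region = region_with_connection_exists[OF assms(1,3,4)]
  let ?r = "restr \<E> (topspace M)"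
  have s: "s \<in> carrier (sections \<E> (topspace M))" and s': "s' \<in> carrier (sections \<E> (topspace M))"
    using assms(5,6) by (simp_all add: parallel_def)
  define \<Z> where "\<Z> = {N. openin M N \<and> ?r N s = ?r N s'}"
  define Z where "Z = \<Union>\<Z>"
  have open_Z: "openin M Z"
    unfolding Z_def by (rule openin_Union) (simp add: \<Z>_def)
  \<comment> \<open>A good region that meets \<open>Z\<close> lies in \<open>Z\<close>; this makes \<open>Z\<close> closed.\<close>
  have spread: "B \<subseteq> Z"
    if B: "region_with_connection n m M \<A> \<O> B \<psi> \<E> U p q e nabla"
      and W: "(W, \<phi>) \<in> \<A>" "B \<subseteq> W" "\<phi> ` B = open_box n c d" and z: "z \<in> B" "z \<in> Z"
    for W \<phi> B \<psi> U p q e c d z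
  proof -
    interpret B: region_with_connection n m M \<A> \<O> B \<psi> \<E> U p q e nabla
      by (rule B)
    obtain N where N: "openin M N" "z \<in> N" "?r N s = ?r N s'"
      using z(2) by (auto simp: Z_def \<Z>_def)
    have "?r B s = ?r B s'"
      by (rule B.restr_eq_if_body_eq[OF assms(5,6) W z(1)])
         (rule B.coeff_eq_if_restr_eq[OF s s' N z(1)])
    then show ?thesis
      using B.openin_region by (auto simp: Z_def \<Z>_def)
  qed
  have "openin M (topspace M - Z)"
  proof (subst openin_subopen, intro ballI)
    fix z assume "z \<in> topspace M - Z"
    then have z: "z \<in> topspace M" "z \<notin> Z"
      by auto
    obtain W \<phi> B \<psi> U p q e c d where B: "region_with_connection n m M \<A> \<O> B \<psi> \<E> U p q e nabla"
        and W: "(W, \<phi>) \<in> \<A>" "B \<subseteq> W" "\<phi> ` B = open_box n c d" and zB: "z \<in> B" "B \<subseteq> topspace M"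
      using region[OF openin_topspace z(1)] .
    have "B \<inter> Z = {}"
      using spread[OF B W] zB(1) z(2) by blast
    moreover have "openin M B"
      using B unfolding region_with_connection_def framed_region_def
      by (blast intro: trivialized_region.openin_region)
    ultimately show "\<exists>T. openin M T \<and> z \<in> T \<and> T \<subseteq> topspace M - Z"
      using zB by blast
  qed
  moreover have "Z \<subseteq> topspace M"
    using open_Z by (rule openin_subset)
  ultimately have "closedin M Z"
    by (simp add: closedin_def)
  with open_Z assms(2) have "Z = {} \<or> Z = topspace M"
    by (simp add: connected_space_clopen_in)
  moreover have "Z \<noteq> {}"
  proof -
    obtain W \<phi> B \<psi> U p q e c d where B: "region_with_connection n m M \<A> \<O> B \<psi> \<E> U p q e nabla"
        and W: "(W, \<phi>) \<in> \<A>" "B \<subseteq> W" "\<phi> ` B = open_box n c d" and xB: "x \<in> B" "B \<subseteq> V"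
      using region[OF assms(7,8)] .
    interpret B: region_with_connection n m M \<A> \<O> B \<psi> \<E> U p q e nabla
      by (rule B)
    note sub = openin_subset[OF assms(7)]
    have "B.coeff (?r B s) j {} x = B.coeff (?r B s') j {} x" if "j < p + q" for j
      using B.coeff_body_eq_if_fibre_value_eq[OF assms(7) xB(2) _ _ assms(9) xB(1) that]
        L.\<E>.restr_closed[OF openin_topspace assms(7) sub] s s'
        L.\<E>.restr_restr[OF openin_topspace assms(7) B.openin_region xB(2) sub]
      by simp
    then have "?r B s = ?r B s'"
      by (rule B.restr_eq_if_body_eq[OF assms(5,6) W xB(1)])
    then show ?thesis
      using B.openin_region xB(1) by (auto simp: Z_def \<Z>_def)
  qed
  ultimately have "Z = topspace M"
    by blast
  then have "topspace M = \<Union>\<Z>"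
    unfolding Z_def by (rule sym)
  then show ?thesis
    by (rule L.\<E>.locality[OF _ _ s s', rotated]) (simp_all add: \<Z>_def)
qed

end
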